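(* Let $\Omega\subseteq\mathbb{R}^n$, $n\ge 2$, be a bounded Lipschitz domain, let $\alpha_\Omega$ be the critical exponent associated with $\Omega$, and let $u$ be the unique function in $W^{1,2}_0(\Omega)$ with $\Delta u=-1$ in $\Omega$. Then $\int_\Omega u(x)^{-\beta}\,dx<+\infty$ granted that $$0<\beta<\frac{1}{\alpha_\Omega}.$$ In particular, $\int_\Omega u(x)^{-\beta}\,dx<+\infty$ for any $\beta\in(0,1)$ in the case when $\Omega$ is a bounded $C^1$ domain.
   Context: A bounded domain $\Omega\subset\mathbb{R}^n$ is Lipschitz if for any $x_0\in\partial\Omega$ there exist $r,h>0$, a coordinate system $\{x_1,\dots,x_n\}$ (isometric to the canonical one) with origin at $x_0$, and a Lipschitz function $\varphi:\mathbb{R}^{n-1}\to\mathbb{R}$ such that, with $C(r,h)=\{(x',x_n):|x'|<r,\ -h<x_n<h\}$, one has $\partial\Omega\cap C(r,h)=\{|x'|<r,\ x_n=\varphi(x')\}$ and $\Omega\cap C(r,h)=\{|x'|<r,\ \varphi(x')<x_n<h\}$. It is a $C^1$ domain if the functions $\varphi$ can be taken of class $C^1$. An atlas is a finite family of such cylinders $C_k(r_k,h_k)$, with associated maps $\varphi_k$, $1\le k\le N$, covering $\partial\Omega$; the Lipschitz constant $\kappa_\Omega$ is the infimum of $\max_{1\le k\le N}\|\nabla\varphi_k\|_{L^\infty}$ over all atlases. For $\theta\in(0,\pi)$ let $\Lambda_\theta>0$ be the first Dirichlet eigenvalue of $-\Delta_{S^{n-1}}$ (Laplace-Beltrami operator)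 on the spherical cap $\{\omega\in S^{n-1}:\omega\cdot e_n>\cos\theta\}$ and $\alpha_\theta:=-\frac{n-2}{2}+\sqrt{\frac{(n-2)^2}{4}+\Lambda_\theta}$. Then $\alpha_\Omega:=\alpha_{\theta_\Omega}$ with $\theta_\Omega:=\arctan(1/\kappa_\Omega)$ (interpreted as $\pi/2$ if $\kappa_\Omega=0$, in which case $\alpha_\Omega=\alpha_{\pi/2}=1$). *)

theory Defs
  imports "HOL-Analysis.Analysis" "HOL-Probability.Essential_Supremum"
begin

text \<open>
  Euclidean space of dimension \<open>n \<ge> 2\<close> is rendered as \<open>'a \<times> real\<close> with \<open>'a :: euclidean_space\<close> of dimension
  \<open>n - 1 \<ge> 1\<close>; a point is \<open>(x', x\<^sub>n)\<close> and the norm on the product type is the Euclidean one.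
\<close>

section \<open>Differentiable functions\<close>

text \<open>Meant for open \<open>S\<close>.\<close>

primrec Ck_on :: "nat \<Rightarrow> ('a::euclidean_space \<Rightarrow> real) \<Rightarrow> 'a set \<Rightarrow> bool" where
  "Ck_on 0 f S \<longleftrightarrow> continuous_on S f"
| "Ck_on (Suc k) f S \<longleftrightarrow>
     (\<forall>x\<in>S. f differentiable (at x)) \<and>
     (\<forall>b\<in>Basis. Ck_on k (\<lambda>x. frechet_derivative f (at x) b) S)"

definition grad :: "('a::euclidean_space \<Rightarrow> real) \<Rightarrow> 'a \<Rightarrow> 'a" where
  "grad f x = (\<Sum>b\<in>Basis. frechet_derivative f (at x) b *\<^sub>R b)"

definition laplacian :: "('a::euclidean_space \<Rightarrow> real) \<Rightarrow> 'a \<Rightarrow> real" where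
  "laplacian f x =
     (\<Sum>b\<in>Basis. frechet_derivative (\<lambda>y. frechet_derivative f (at y) b) (at x) b)"

text \<open>
  For Lipschitz \<open>\<phi>\<close> the classical gradient exists almost everywhere (Rademacher). The complete
  measure makes the unspecified values on the exceptional null set irrelevant also for measurability.
\<close>

definition grad_Linf :: "('a::euclidean_space \<Rightarrow> real) \<Rightarrow> real" where
  "grad_Linf \<phi> = real_of_ereal (esssup lebesgue (\<lambda>y. ereal (norm (grad \<phi> y))))"

section \<open>Lipschitz and \<open>C\<^sup>1\<close> domains\<close>

text \<open>
  The coordinates of \<open>x\<close> in a coordinate system with origin \<open>x0\<close>, isometric to the canonical one,
  are \<open>Q (x - x0)\<close> for an orthogonal map \<open>Q\<close>.
\<close>

definition cylinder ::
  "'a::euclidean_space \<times> real \<Rightarrow> ('a \<times> real \<Rightarrow> 'a \<times> real) \<Rightarrow> real \<Rightarrow> real \<Rightarrow> ('a \<times> real) set" where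
  "cylinder x0 Q r h =
     {x. norm (fst (Q (x - x0))) < r \<and> - h < snd (Q (x - x0)) \<and> snd (Q (x - x0)) < h}"

definition lipschitz_chart ::
  "('a::euclidean_space \<times> real) set \<Rightarrow> 'a \<times> real \<Rightarrow> ('a \<times> real \<Rightarrow> 'a \<times> real) \<Rightarrow> real \<Rightarrow> real \<Rightarrow>
     ('a \<Rightarrow> real) \<Rightarrow> bool" where
  "lipschitz_chart \<Omega> x0 Q r h \<phi> \<longleftrightarrow>
     x0 \<in> frontier \<Omega> \<and> r > 0 \<and> h > 0 \<and> orthogonal_transformation Q \<and>
     (\<exists>L. L-lipschitz_on UNIV \<phi>) \<and>
     frontier \<Omega> \<inter> cylinder x0 Q r h =
       {x. norm (fst (Q (x - x0))) < r \<and> snd (Q (x - x0)) = \<phi> (fst (Q (x - x0)))} \<and>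
     \<Omega> \<inter> cylinder x0 Q r h =
       {x. norm (fst (Q (x - x0))) < r \<and>
           \<phi> (fst (Q (x - x0))) < snd (Q (x - x0)) \<and> snd (Q (x - x0)) < h}"

definition bounded_domain :: "'a::euclidean_space set \<Rightarrow> bool" where
  "bounded_domain \<Omega> \<longleftrightarrow> open \<Omega> \<and> connected \<Omega> \<and> \<Omega> \<noteq> {} \<and> bounded \<Omega>"

definition bounded_lipschitz_domain :: "('a::euclidean_space \<times> real) set \<Rightarrow> bool" where
  "bounded_lipschitz_domain \<Omega> \<longleftrightarrow> bounded_domain \<Omega> \<and>
     (\<forall>x0\<in>frontier \<Omega>. \<exists>Q r h \<phi>. lipschitz_chart \<Omega> x0 Q r h \<phi>)"

definition bounded_C1_domain :: "('a::euclidean_space \<times> real) set \<Rightarrow> bool" where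
  "bounded_C1_domain \<Omega> \<longleftrightarrow> bounded_domain \<Omega> \<and>
     (\<forall>x0\<in>frontier \<Omega>. \<exists>Q r h \<phi>. lipschitz_chart \<Omega> x0 Q r h \<phi> \<and> Ck_on 1 \<phi> UNIV)"

definition lipschitz_atlas ::
  "('a::euclidean_space \<times> real) set \<Rightarrow> nat \<Rightarrow> (nat \<Rightarrow> 'a \<times> real) \<Rightarrow>
     (nat \<Rightarrow> 'a \<times> real \<Rightarrow> 'a \<times> real) \<Rightarrow> (nat \<Rightarrow> real) \<Rightarrow> (nat \<Rightarrow> real) \<Rightarrow> (nat \<Rightarrow> 'a \<Rightarrow> real) \<Rightarrow> bool" where
  "lipschitz_atlas \<Omega> N x0 Q r h \<phi> \<longleftrightarrow> N \<ge> 1 \<and>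
     (\<forall>k\<in>{1..N}. lipschitz_chart \<Omega> (x0 k) (Q k) (r k) (h k) (\<phi> k)) \<and>
     frontier \<Omega> \<subseteq> (\<Union>k\<in>{1..N}. cylinder (x0 k) (Q k) (r k) (h k))"

definition lipschitz_constant :: "('a::euclidean_space \<times> real) set \<Rightarrow> real" where
  "lipschitz_constant \<Omega> =
     Inf {Max ((\<lambda>k. grad_Linf (\<phi> k)) ` {1..N}) | N x0 Q r h \<phi>. lipschitz_atlas \<Omega> N x0 Q r h \<phi>}"

section \<open>The critical exponent\<close>

definition radial_extension :: "('a::euclidean_space \<Rightarrow> real) \<Rightarrow> 'a \<Rightarrow> real" where
  "radial_extension f x = f (x /\<^sub>R norm x)"

text \<open>
  The Laplace-Beltrami operator of the unit sphere is the Euclidean Laplacian, restricted to the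
  sphere, of the extension that is constant along rays; \<open>f\<close> is \<open>C\<^sup>2\<close> on a relatively open subset
  \<open>U\<close> of the sphere iff this extension is \<open>C\<^sup>2\<close> on the open cone over \<open>U\<close>.
\<close>

definition sphere_laplacian :: "('a::euclidean_space \<Rightarrow> real) \<Rightarrow> 'a \<Rightarrow> real" where
  "sphere_laplacian f \<omega> = laplacian (radial_extension f) \<omega>"

text \<open>
  Dirichlet eigenvalues with classical eigenfunctions. The set \<open>U\<close> is relatively open in the
  sphere, so \<open>closure U - U\<close> is its relative boundary; on caps this boundary is smooth, so classical
  and weak eigenfunctions agree.
\<close>

definition sphere_dirichlet_eigenvalue :: "'a::euclidean_space set \<Rightarrow> real \<Rightarrow> bool" where
  "sphere_dirichlet_eigenvalue U \<mu> \<longleftrightarrow>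
     (\<exists>f. Ck_on 2 (radial_extension f) {x. x \<noteq> 0 \<and> x /\<^sub>R norm x \<in> U} \<and>
          continuous_on (closure U) f \<and> (\<forall>\<omega>\<in>closure U - U. f \<omega> = 0) \<and>
          (\<exists>\<omega>\<in>U. f \<omega> \<noteq> 0) \<and>
          (\<forall>\<omega>\<in>U. - sphere_laplacian f \<omega> = \<mu> * f \<omega>))"

definition first_dirichlet_eigenvalue :: "'a::euclidean_space set \<Rightarrow> real" where
  "first_dirichlet_eigenvalue U = (LEAST \<mu>. sphere_dirichlet_eigenvalue U \<mu>)"

definition spherical_cap :: "real \<Rightarrow> ('a::euclidean_space \<times> real) set" where
  "spherical_cap \<theta> = {\<omega> \<in> sphere 0 1. \<omega> \<bullet> (0, 1) > cos \<theta>}"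

text \<open>The type argument carries the dimension \<open>n = DIM('a \<times> real)\<close>.\<close>

definition cap_exponent :: "'a::euclidean_space itself \<Rightarrow> real \<Rightarrow> real" where
  "cap_exponent T \<theta> =
     - ((real DIM('a \<times> real) - 2) / 2) +
       sqrt ((real DIM('a \<times> real) - 2)\<^sup>2 / 4 +
         first_dirichlet_eigenvalue (spherical_cap \<theta> :: ('a \<times> real) set))"

definition critical_angle :: "('a::euclidean_space \<times> real) set \<Rightarrow> real" where
  "critical_angle \<Omega> =
     (if lipschitz_constant \<Omega> = 0 then pi / 2 else arctan (1 / lipschitz_constant \<Omega>))"

definition critical_exponent :: "('a::euclidean_space \<times> real) set \<Rightarrow> real" where
  "critical_exponent \<Omega> = cap_exponent TYPE('a) (critical_angle \<Omega>)"

section \<open>Sobolev spaces and the equation\<close>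

definition test_function :: "'a::euclidean_space set \<Rightarrow> ('a \<Rightarrow> real) \<Rightarrow> bool" where
  "test_function \<Omega> \<psi> \<longleftrightarrow> (\<forall>k. Ck_on k \<psi> UNIV) \<and>
     compact (closure {x. \<psi> x \<noteq> 0}) \<and> closure {x. \<psi> x \<noteq> 0} \<subseteq> \<Omega>"

definition L2_on :: "'a::euclidean_space set \<Rightarrow> ('a \<Rightarrow> 'b::euclidean_space) \<Rightarrow> bool" where
  "L2_on \<Omega> f \<longleftrightarrow> f \<in> borel_measurable (lebesgue_on \<Omega>) \<and>
     integrable (lebesgue_on \<Omega>) (\<lambda>x. (norm (f x))\<^sup>2)"

text \<open>\<open>u\<close> belongs to \<open>W\<^sup>1\<^sup>,\<^sup>2(\<Omega>)\<close> and its weak gradient, unique up to null sets, is \<open>g\<close>.\<close>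

definition W12_grad :: "'a::euclidean_space set \<Rightarrow> ('a \<Rightarrow> real) \<Rightarrow> ('a \<Rightarrow> 'a) \<Rightarrow> bool" where
  "W12_grad \<Omega> u g \<longleftrightarrow> L2_on \<Omega> u \<and> L2_on \<Omega> g \<and>
     (\<forall>\<psi>. test_function \<Omega> \<psi> \<longrightarrow> (\<forall>b\<in>Basis.
        integral\<^sup>L (lebesgue_on \<Omega>) (\<lambda>x. u x * frechet_derivative \<psi> (at x) b) =
        - integral\<^sup>L (lebesgue_on \<Omega>) (\<lambda>x. (g x \<bullet> b) * \<psi> x)))"

text \<open>The closure of the test functions in the norm of \<open>W\<^sup>1\<^sup>,\<^sup>2(\<Omega>)\<close>.\<close>

definition W12_0 :: "'a::euclidean_space set \<Rightarrow> ('a \<Rightarrow> real) \<Rightarrow> bool" where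
  "W12_0 \<Omega> u \<longleftrightarrow> (\<exists>g. W12_grad \<Omega> u g \<and>
     (\<exists>\<psi>. (\<forall>k. test_function \<Omega> (\<psi> k)) \<and>
       (\<lambda>k::nat. integral\<^sup>L (lebesgue_on \<Omega>)
          (\<lambda>x. (\<psi> k x - u x)\<^sup>2 + (norm (grad (\<psi> k) x - g x))\<^sup>2)) \<longlonglongrightarrow> 0))"

text \<open>Weak form of \<open>\<Delta> u = -1\<close> in \<open>\<Omega>\<close>, for \<open>u\<close> in \<open>W\<^sup>1\<^sup>,\<^sup>2(\<Omega>)\<close>.\<close>

definition weak_laplacian_minus_one :: "'a::euclidean_space set \<Rightarrow> ('a \<Rightarrow> real) \<Rightarrow> bool" where
  "weak_laplacian_minus_one \<Omega> u \<longleftrightarrow> (\<exists>g. W12_grad \<Omega> u g \<and>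
     (\<forall>\<psi>. test_function \<Omega> \<psi> \<longrightarrow>
        integral\<^sup>L (lebesgue_on \<Omega>) (\<lambda>x. g x \<bullet> grad \<psi> x) = integral\<^sup>L (lebesgue_on \<Omega>) \<psi>))"

text \<open>
  \<open>t\<close> to the power \<open>-\<beta>\<close>, with value \<open>\<infinity>\<close> for \<open>t \<le> 0\<close> (as \<open>0 powr (-\<beta>) = 0\<close> in the library): a finite
  integral then includes that \<open>u\<close> is positive almost everywhere.
\<close>

definition neg_power :: "real \<Rightarrow> real \<Rightarrow> ennreal" where
  "neg_power \<beta> t = (if t > 0 then ennreal (t powr (- \<beta>)) else \<infinity>)"

end

theory Submission
  imports Defs "HOL-Computational_Algebra.Polynomial" "HOL-Real_Asymp.Real_Asymp"
begin

text \<open>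
  The solution \<open>u\<close> dominates every compactly supported smooth \<open>w\<close> with \<open>\<Delta> w \<ge> -1\<close>. Near a boundary point, \<open>\<Omega>\<close>
  contains translates of one truncated circular cone whose half-angle is as close to \<open>\<theta>\<^sub>\<Omega>\<close> from below
  as desired. By Sturm comparison the zonal function of degree \<open>\<alpha>\<close>, for any \<open>\<alpha> > \<alpha>\<^sub>\<Omega>\<close>, vanishes before the
  angle \<open>\<theta>\<^sub>\<Omega>\<close>; the corresponding homogeneous harmonic function, suitably truncated, is a barrier in such a cone
  and gives \<open>u \<ge> c t\<^sup>\<alpha>\<close> at height \<open>t\<close> above the boundary. If \<open>\<alpha> \<beta> < 1\<close>, then \<open>t\<close> to the power \<open>- \<alpha> \<beta>\<close> is integrable. For
  \<open>C\<^sup>1\<close> domains the cones may be taken arbitrarily close to half-spaces, where \<open>\<alpha> = 1\<close>. That a bound on the essential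
  supremum of the gradient of a chart is a Lipschitz bound rests on Rademacher's theorem.
\<close>

section \<open>Smooth functions\<close>

text \<open>The strict inequality \<beta> < 1/\<alpha>_\<Omega> leaves room for an exponent \<alpha>
  with \<alpha>_\<Omega> < \<alpha> < 1/\<beta>. The Lipschitz constant is an infimum that no atlas
  need attain, so only cones of half-angle strictly below \<theta>_\<Omega> can be placed in the
  domain, and positive harmonic functions vanishing on the sides of such a cone have degree above
  \<alpha>_\<Omega>. Degree and cap are linked by the eigenvalue \<alpha>(\<alpha> + n - 2) of the
  angular part. The solution is given only as a limit of test functions in the Sobolev norm, without
  boundary values or a preferred representative. So a barrier must itself be a test function, which
  forces a smooth truncation away from the apex and the sides of the cone. Each barrier bounds u
  only outside its own null set, so countably many of them have to serve all points. In the C^1 case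
  the Lipschitz constant is never computed: the axis of the cone is turned to the inner normal at
  the boundary point, so that the tilt of the chart does no harm.\<close>

abbreviation pd :: "'a::euclidean_space \<Rightarrow> ('a \<Rightarrow> real) \<Rightarrow> 'a \<Rightarrow> real" where
  "pd b f \<equiv> (\<lambda>x. frechet_derivative f (at x) b)"

definition smooth_on :: "'a::euclidean_space set \<Rightarrow> ('a \<Rightarrow> real) \<Rightarrow> bool" where
  "smooth_on S f \<longleftrightarrow> (\<forall>k. Ck_on k f S)"

section \<open>Stability of the classes C^k under the usual operations\<close>

lemma differentiable_transform_open:
  assumes "open S" "x \<in> S" "\<And>y. y \<in> S \<Longrightarrow> f y = g y" "f differentiable (at x)"
  shows "g differentiable (at x)"
  using assms has_derivative_transform_within_open unfolding differentiable_def by blast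

lemma Ck_on_cong:
  assumes "open S" "\<And>x. x \<in> S \<Longrightarrow> f x = g x" "Ck_on k f S"
  shows "Ck_on k g S"
  using assms(2,3)
proof (induction k arbitrary: f g)
  case 0
  then show ?case using continuous_on_eq by auto
next
  case (Suc k)
  have d: "f differentiable (at x)" if "x \<in> S" for x using Suc.prems that by simp
  have e: "pd b f x = pd b g x" if "x \<in> S" for x b
    using frechet_derivative_transform_within_open[OF d[OF that] assms(1) that, of g] Suc.prems by simp
  show ?case
    using Suc.IH[of "pd _ f" "pd _ g"] e Suc.prems differentiable_transform_open[OF assms(1) _ Suc.prems(1)]
    by auto
qed

lemma Ck_on_subset: "Ck_on k f S \<Longrightarrow> T \<subseteq> S \<Longrightarrow> Ck_on k f T"
  by (induction k arbitrary: f) (auto intro: continuous_on_subset)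

lemma Ck_on_SucD: "Ck_on (Suc k) f S \<Longrightarrow> Ck_on k f S"
proof (induction k arbitrary: f)
  case 0
  then show ?case
    by (auto intro!: continuous_at_imp_continuous_on differentiable_imp_continuous_within)
next
  case (Suc k)
  then show ?case by (metis Ck_on.simps(2))
qed

lemma Ck_on_const: "Ck_on k (\<lambda>x. c) S"
  by (induction k arbitrary: c) auto

lemma Ck_on_bounded_linear:
  assumes "bounded_linear f" shows "Ck_on k f S"
proof (cases k)
  case 0
  then show ?thesis using assms by (simp add: linear_continuous_on)
next
  case (Suc k)
  have "(f has_derivative f) (at x)" for x
    using assms bounded_linear_imp_has_derivative by blast
  then have "f differentiable (at x)" "frechet_derivative f (at x) = f" for x
    using differentiable_def frechet_derivative_at by metis+
  then show ?thesis using Suc by (simp add: Ck_on_const)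
qed

lemma pd_add:
  assumes "f differentiable (at x)" "g differentiable (at x)"
  shows "pd b (\<lambda>x. f x + g x) x = pd b f x + pd b g x"
  using frechet_derivative_at[OF has_derivative_add[OF assms[unfolded frechet_derivative_works]]]
  by metis

lemma pd_mult:
  fixes f g :: "'a::euclidean_space \<Rightarrow> real"
  assumes "f differentiable (at x)" "g differentiable (at x)"
  shows "pd b (\<lambda>x. f x * g x) x = f x * pd b g x + pd b f x * g x"
  using frechet_derivative_at[OF has_derivative_mult[OF assms[unfolded frechet_derivative_works]]]
  by metis

lemma has_derivative_real_chain:
  fixes f :: "'a::euclidean_space \<Rightarrow> real"
  assumes "f differentiable (at x)" "(h has_real_derivative d) (at (f x))"
  shows "((\<lambda>x. h (f x)) has_derivative (\<lambda>v. d * frechet_derivative f (at x) v)) (at x)"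
  using has_derivative_compose[OF assms(1)[unfolded frechet_derivative_works], of h "\<lambda>v. d * v"] assms(2)
  by (simp add: has_field_derivative_def)

lemma pd_chain:
  fixes f :: "'a::euclidean_space \<Rightarrow> real"
  assumes "f differentiable (at x)" "(h has_real_derivative d) (at (f x))"
  shows "pd b (\<lambda>x. h (f x)) x = d * pd b f x"
  using frechet_derivative_at[OF has_derivative_real_chain[OF assms]] by metis

lemma pd_transform:
  assumes "f differentiable (at x)" "open S" "x \<in> S" "\<And>y. y \<in> S \<Longrightarrow> f y = g y"
  shows "pd b f x = pd b g x"
  using frechet_derivative_transform_within_open[OF assms] by simp

lemma has_real_derivative_frechet:
  assumes "(h :: real \<Rightarrow> real) differentiable (at t)"
  shows "(h has_real_derivative frechet_derivative h (at t) 1) (at t)"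
proof -
  obtain d where d: "(h has_real_derivative d) (at t)"
    using assms real_differentiable_def by blast
  then show ?thesis
    using frechet_derivative_at[of h "(*) d" t] by (metis has_field_derivative_def mult.right_neutral)
qed

lemma pd_real: "((h :: real \<Rightarrow> real) has_real_derivative d) (at t) \<Longrightarrow> pd 1 h t = d"
  using frechet_derivative_at[of h "(*) d" t] by (metis has_field_derivative_def mult.right_neutral)

lemma Ck_on_add:
  assumes "open S" "Ck_on k f S" "Ck_on k g S"
  shows "Ck_on k (\<lambda>x. f x + g x) S"
  using assms(2,3)
proof (induction k arbitrary: f g)
  case 0
  then show ?case by (auto intro: continuous_on_add)
next
  case (Suc k)
  have "Ck_on k (pd b (\<lambda>x. f x + g x)) S" if "b \<in> Basis" for b
    by (rule Ck_on_cong[OF assms(1), of "\<lambda>x. pd b f x + pd b g x"])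
      (use Suc that in \<open>auto simp: pd_add\<close>)
  then show ?case using Suc.prems by auto
qed

lemma Ck_on_mult:
  fixes f g :: "'a::euclidean_space \<Rightarrow> real"
  assumes "open S" "Ck_on k f S" "Ck_on k g S"
  shows "Ck_on k (\<lambda>x. f x * g x) S"
  using assms(2,3)
proof (induction k arbitrary: f g)
  case 0
  then show ?case by (auto intro: continuous_on_mult)
next
  case (Suc k)
  have c: "Ck_on k f S" "Ck_on k g S" using Suc.prems Ck_on_SucD by blast+
  have "Ck_on k (pd b (\<lambda>x. f x * g x)) S" if "b \<in> Basis" for b
    by (rule Ck_on_cong[OF assms(1), of "\<lambda>x. f x * pd b g x + pd b f x * g x"])
      (use Suc c that in \<open>auto simp: pd_mult intro!: Ck_on_add assms\<close>)
  then show ?case using Suc.prems by auto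
qed

lemma Ck_on_chain:
  fixes f :: "'a::euclidean_space \<Rightarrow> real"
  assumes "open S" "open T" "\<And>x. x \<in> S \<Longrightarrow> f x \<in> T" "Ck_on k f S" "Ck_on k h T"
  shows "Ck_on k (\<lambda>x. h (f x)) S"
  using assms(3,4,5)
proof (induction k arbitrary: f h)
  case 0
  then show ?case by (auto intro!: continuous_on_compose2[of T h S f])
next
  case (Suc k)
  have c: "Ck_on k f S" using Suc.prems Ck_on_SucD by blast
  have h: "(h has_real_derivative pd 1 h (f x)) (at (f x))" if "x \<in> S" for x
    using Suc.prems that by (intro has_real_derivative_frechet) auto
  have h': "Ck_on k (pd 1 h) T" using Suc.prems(3) by simp
  have "Ck_on k (pd b (\<lambda>x. h (f x))) S" if "b \<in> Basis" for b
  proof (rule Ck_on_cong[OF assms(1), of "\<lambda>x. pd 1 h (f x) * pd b f x"])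
    show "pd 1 h (f x) * pd b f x = pd b (\<lambda>x. h (f x)) x" if "x \<in> S" for x
      using pd_chain[where f=f and h=h and x=x and b=b, OF _ h[OF that]] Suc.prems that by simp
    show "Ck_on k (\<lambda>x. pd 1 h (f x) * pd b f x) S"
      using Suc.IH[OF Suc.prems(1) c h'] Suc.prems that by (intro Ck_on_mult assms) auto
  qed
  moreover have "(\<lambda>x. h (f x)) differentiable (at x)" if "x \<in> S" for x
    using has_derivative_real_chain[where f=f and h=h and x=x, OF _ h[OF that]] Suc.prems(2) that
    by (auto intro: differentiableI)
  ultimately show ?case by auto
qed

lemma Ck_on_Un:
  assumes "open S" "open T" "Ck_on k f S" "Ck_on k f T"
  shows "Ck_on k f (S \<union> T)"
  using assms(3,4)
  by (induction k arbitrary: f) (auto intro: continuous_on_open_Un assms)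

lemma smooth_onI: "(\<And>k. Ck_on k f S) \<Longrightarrow> smooth_on S f"
  by (simp add: smooth_on_def)

lemma smooth_on_C2: "smooth_on S f \<Longrightarrow> Ck_on 2 f S"
  by (simp add: smooth_on_def)

lemma smooth_on_differentiable: "smooth_on S f \<Longrightarrow> x \<in> S \<Longrightarrow> f differentiable (at x)"
  unfolding smooth_on_def using Ck_on.simps(2) by blast

lemma smooth_on_continuous: "smooth_on S f \<Longrightarrow> continuous_on S f"
  unfolding smooth_on_def using Ck_on.simps(1) by blast

lemma smooth_on_pd: "smooth_on S f \<Longrightarrow> b \<in> Basis \<Longrightarrow> smooth_on S (pd b f)"
  unfolding smooth_on_def using Ck_on.simps(2) by blast

lemma smooth_on_const: "smooth_on S (\<lambda>x. c)"
  by (simp add: smooth_on_def Ck_on_const)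

lemma smooth_on_bounded_linear: "bounded_linear f \<Longrightarrow> smooth_on S f"
  by (simp add: smooth_on_def Ck_on_bounded_linear)

lemma smooth_on_subset: "smooth_on S f \<Longrightarrow> T \<subseteq> S \<Longrightarrow> smooth_on T f"
  by (auto simp: smooth_on_def intro: Ck_on_subset)

lemma smooth_on_cong:
  "open S \<Longrightarrow> smooth_on S f \<Longrightarrow> (\<And>x. x \<in> S \<Longrightarrow> f x = g x) \<Longrightarrow> smooth_on S g"
  using Ck_on_cong unfolding smooth_on_def by blast

lemma smooth_on_add: "open S \<Longrightarrow> smooth_on S f \<Longrightarrow> smooth_on S g \<Longrightarrow> smooth_on S (\<lambda>x. f x + g x)"
  by (simp add: smooth_on_def Ck_on_add)

lemma smooth_on_mult: "open S \<Longrightarrow> smooth_on S f \<Longrightarrow> smooth_on S g \<Longrightarrow> smooth_on S (\<lambda>x. f x * g x)"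
  by (simp add: smooth_on_def Ck_on_mult)

lemma smooth_on_cmult: "open S \<Longrightarrow> smooth_on S f \<Longrightarrow> smooth_on S (\<lambda>x. c * f x)"
  by (simp add: smooth_on_mult smooth_on_const)

lemma smooth_on_diff:
  assumes "open S" "smooth_on S f" "smooth_on S g" shows "smooth_on S (\<lambda>x. f x - g x)"
  using smooth_on_add[OF assms(1,2) smooth_on_cmult[OF assms(1,3), of "-1"]] by simp

lemma smooth_on_chain:
  "open S \<Longrightarrow> open T \<Longrightarrow> (\<And>x. x \<in> S \<Longrightarrow> f x \<in> T) \<Longrightarrow> smooth_on S f \<Longrightarrow> smooth_on T h
    \<Longrightarrow> smooth_on S (\<lambda>x. h (f x))"
  by (simp add: smooth_on_def Ck_on_chain)

lemma smooth_on_Un: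
  "open S \<Longrightarrow> open T \<Longrightarrow> smooth_on S f \<Longrightarrow> smooth_on T f \<Longrightarrow> smooth_on (S \<union> T) f"
  by (simp add: smooth_on_def Ck_on_Un)

text \<open>A family closed under differentiation consists of smooth functions, so no formula for
  the k-th derivative has to be found. The families used are multiples of powers, polynomials in 1/t
  times exp(-1/t), and power series.\<close>

lemma smooth_on_real_closed:
  assumes "open T" "f \<in> F"
    and "\<And>f. f \<in> F \<Longrightarrow> \<exists>g\<in>F. \<forall>t\<in>T. (f has_real_derivative g t) (at t)"
  shows "smooth_on T f"
proof (rule smooth_onI)
  show "Ck_on k f T" for k
    using assms(2)
  proof (induction k arbitrary: f)
    case 0
    then show ?case
      using assms(3) by (fastforce intro!: continuous_at_imp_continuous_on DERIV_isCont)
  next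
    case (Suc k)
    then obtain g where g: "g \<in> F" "\<And>t. t \<in> T \<Longrightarrow> (f has_real_derivative g t) (at t)"
      using assms(3) by blast
    have "Ck_on k (pd 1 f) T"
      by (rule Ck_on_cong[OF assms(1), of g]) (use g Suc pd_real[OF g(2)] in auto)
    moreover have "f differentiable (at t)" if "t \<in> T" for t
      using g that real_differentiable_def differentiable_def has_field_derivative_def by blast
    ultimately show ?case by auto
  qed
qed

lemma smooth_on_powr: "smooth_on {0<..} (\<lambda>t. t powr a)"
proof (rule smooth_on_real_closed[where F = "{\<lambda>t. c * t powr a | c a. True}"])
  show "(\<lambda>t. t powr a) \<in> {\<lambda>t. c * t powr a | c a. True}"
    by (intro CollectI exI[of _ 1] exI[of _ a]) simp
  fix f assume "f \<in> {\<lambda>t::real. c * t powr a | c a. True}"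
  then obtain c a where f: "f = (\<lambda>t. c * t powr a)" by blast
  show "\<exists>g\<in>{\<lambda>t. c * t powr a | c a. True}. \<forall>t\<in>{0<..}. (f has_real_derivative g t) (at t)"
    unfolding f
    by (rule bexI[of _ "\<lambda>t. (c * a) * t powr (a - 1)"]) (auto intro!: derivative_eq_intros)
qed simp

subsection \<open>A flat function\<close>

definition flat :: "real \<Rightarrow> real" where
  "flat t = (if t > 0 then exp (- 1 / t) else 0)"

lemma poly_div_exp_tendsto:
  "((\<lambda>y. y ^ k * poly p y / exp y) \<longlongrightarrow> (0::real)) at_top"
proof (induction p arbitrary: k)
  case 0
  show ?case by simp
next
  case (pCons a p)
  have "((\<lambda>y. a * (y ^ k / exp y) + y ^ (Suc k) * poly p y / exp y) \<longlongrightarrow> a * 0 + 0) at_top"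
    by (intro tendsto_intros tendsto_power_div_exp_0 pCons)
  then show ?case by (simp add: field_simps)
qed

text \<open>The shape of all derivatives of \<open>flat\<close>. Differentiation replaces the
  polynomial p in y = 1/t by y^2 (p - p'), so the family is closed under it.\<close>

definition flat_poly :: "real poly \<Rightarrow> real \<Rightarrow> real" where
  "flat_poly p t = (if t > 0 then poly p (1 / t) * exp (- 1 / t) else 0)"

lemma flat_poly_deriv:
  "(flat_poly p has_real_derivative flat_poly (monom 1 2 * (p - pderiv p)) t) (at t)"
proof -
  consider "t > 0" | "t < 0" | "t = 0" by linarith
  then show ?thesis
  proof cases
    case 1
    have "((\<lambda>t. poly p (1 / t) * exp (- 1 / t)) has_real_derivative
        flat_poly (monom 1 2 * (p - pderiv p)) t) (at t)"
      unfolding flat_poly_def using 1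
      by (auto intro!: derivative_eq_intros simp: poly_monom field_simps power2_eq_square)
    then show ?thesis
      by (rule DERIV_cong_ev[THEN iffD1, rotated 3])
        (use 1 eventually_nhds_in_open[of "{0<..}" t] in \<open>auto simp: flat_poly_def elim!: eventually_mono\<close>)
  next
    case 2
    have "((\<lambda>t. 0) has_real_derivative 0) (at t)" by simp
    then have "(flat_poly p has_real_derivative 0) (at t)"
      by (rule DERIV_cong_ev[THEN iffD1, rotated 3])
        (use 2 eventually_nhds_in_open[of "{..<0}" t] in \<open>auto simp: flat_poly_def elim!: eventually_mono\<close>)
    then show ?thesis using 2 by (simp add: flat_poly_def)
  next
    case 3
    \<comment> \<open>With y = 1/h the right-hand difference quotient at 0 is y p(y) / exp y, which
      tends to 0 as y grows; the left-hand quotient is identically 0.\<close>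
    have "((\<lambda>h. (1/h) ^ 1 * poly p (1/h) / exp (1/h)) \<longlongrightarrow> 0) (at_right 0)"
      using filterlim_compose[OF poly_div_exp_tendsto[of 1 p] filterlim_inverse_at_top_right]
      by (simp add: inverse_eq_divide)
    then have "((\<lambda>h. flat_poly p h / h) \<longlongrightarrow> 0) (at_right 0)"
      by (rule Lim_transform_eventually)
        (auto simp: eventually_at_filter flat_poly_def exp_minus field_simps)
    moreover have "((\<lambda>h. flat_poly p h / h) \<longlongrightarrow> 0) (at_left 0)"
      by (rule Lim_transform_eventually[of "\<lambda>_. 0"])
        (auto simp: eventually_at_filter flat_poly_def)
    ultimately have "((\<lambda>h. flat_poly p h / h) \<longlongrightarrow> 0) (at 0)"
      using filterlim_split_at by blast
    then show ?thesis
      by (simp add: DERIV_def 3 flat_poly_def)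
  qed
qed

lemma smooth_on_flat: "smooth_on UNIV flat"
proof (rule smooth_on_real_closed[where F = "range flat_poly"])
  have "flat = flat_poly 1" by (auto simp: flat_def flat_poly_def)
  then show "flat \<in> range flat_poly" by blast
  fix f assume "f \<in> range flat_poly"
  then show "\<exists>g\<in>range flat_poly. \<forall>t\<in>UNIV. (f has_real_derivative g t) (at t)"
    using flat_poly_deriv by blast
qed simp

definition flat' :: "real \<Rightarrow> real" where
  "flat' t = (if t > 0 then exp (- 1 / t) / t\<^sup>2 else 0)"

lemma flat_deriv: "(flat has_real_derivative flat' t) (at t)"
proof -
  have "flat = flat_poly 1" by (auto simp: flat_def flat_poly_def)
  moreover have "flat' t = flat_poly (monom 1 2 * (1 - pderiv 1)) t"
    by (simp add: flat'_def flat_poly_def poly_monom field_simps pderiv_1)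
  ultimately show ?thesis using flat_poly_deriv by metis
qed

text \<open>With y = 1/t this is the bound \<open>flat' t \<le> 1\<close>. Squaring 1 + y/4 \<le>
  exp(y/4) yields y \<le> exp(y/2), and a second squaring gives the claim.\<close>

lemma square_le_exp: "0 \<le> y \<Longrightarrow> y\<^sup>2 \<le> exp (y::real)"
proof -
  assume y: "0 \<le> y"
  have "y \<le> (1 + y/4)\<^sup>2"
    using zero_le_power2[of "1 - y/4"] by (simp add: power2_eq_square algebra_simps)
  moreover have "1 + y/4 \<le> exp (y/4)" by (rule exp_ge_add_one_self)
  then have "(1 + y/4)\<^sup>2 \<le> (exp (y/4))\<^sup>2" using y by (intro power_mono) auto
  ultimately have "y \<le> exp (y/2)" by (simp add: power2_eq_square flip: exp_add)
  then have "y\<^sup>2 \<le> (exp (y/2))\<^sup>2" using y by (intro power_mono) auto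
  then show ?thesis by (simp add: power2_eq_square flip: exp_add)
qed

lemma flat'_bounds: "0 \<le> flat' t" "flat' t \<le> 1"
proof -
  show "0 \<le> flat' t" by (simp add: flat'_def)
  show "flat' t \<le> 1"
    using square_le_exp[of "1/t"] by (auto simp: flat'_def exp_minus field_simps)
qed

lemma flat_simps: "t \<le> 0 \<Longrightarrow> flat t = 0" "t > 0 \<Longrightarrow> flat t > 0" "flat t \<ge> 0" "flat t \<le> 1"
  by (auto simp: flat_def)

text \<open>A smooth convex substitute for the positive part, with slope between 0 and 1. Convexity
  keeps a composition from losing Laplacian through the gradient term, and the slope bound controls
  what remains.\<close>

definition soft_pos :: "real \<Rightarrow> real" where "soft_pos t = t * flat t"

definition soft_pos' :: "real \<Rightarrow> real" where
  "soft_pos' t = (if t > 0 then (1 + 1 / t) * exp (- 1 / t) else 0)"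

definition soft_pos'' :: "real \<Rightarrow> real" where
  "soft_pos'' t = (if t > 0 then exp (- 1 / t) / t ^ 3 else 0)"

lemma smooth_on_soft_pos: "smooth_on UNIV soft_pos"
  unfolding soft_pos_def[abs_def]
  by (intro smooth_on_mult smooth_on_flat smooth_on_bounded_linear bounded_linear_ident open_UNIV)

lemma soft_pos_deriv: "(soft_pos has_real_derivative soft_pos' t) (at t)"
  unfolding soft_pos_def[abs_def]
  by (rule derivative_eq_intros flat_deriv refl)+
    (auto simp: soft_pos'_def flat_def flat'_def field_simps power2_eq_square)

lemma soft_pos'_deriv: "(soft_pos' has_real_derivative soft_pos'' t) (at t)"
proof -
  have "soft_pos' = flat_poly [:1, 1:]" by (auto simp: soft_pos'_def flat_poly_def)
  moreover have "soft_pos'' t = flat_poly (monom 1 2 * ([:1, 1:] - pderiv [:1, 1:])) t"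
    by (simp add: soft_pos''_def flat_poly_def poly_monom field_simps pderiv_pCons power2_eq_square power3_eq_cube)
  ultimately show ?thesis using flat_poly_deriv by metis
qed

lemma soft_pos'_bounds: "0 \<le> soft_pos' t" "soft_pos' t \<le> 1"
proof -
  show "0 \<le> soft_pos' t" by (simp add: soft_pos'_def)
  show "soft_pos' t \<le> 1"
    using exp_ge_add_one_self[of "1/t"] by (auto simp: soft_pos'_def exp_minus divide_simps mult.commute add.commute)
qed

lemma soft_pos''_nonneg: "0 \<le> soft_pos'' t"
  by (simp add: soft_pos''_def)

subsection \<open>Power series\<close>

lemma smooth_on_power_series:
  fixes a :: "nat \<Rightarrow> real"
  assumes "\<And>t. \<bar>t\<bar> < 1 \<Longrightarrow> summable (\<lambda>n. a n * t ^ n)"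
  shows "smooth_on {-1<..<1} (\<lambda>t. \<Sum>n. a n * t ^ n)"
proof (rule smooth_on_real_closed[where
      F = "{\<lambda>t. \<Sum>n. a n * t ^ n | a. \<forall>t. \<bar>t\<bar> < 1 \<longrightarrow> summable (\<lambda>n. a n * t ^ n)}"])
  fix f assume "f \<in> {\<lambda>t. \<Sum>n. a n * t ^ n | a. \<forall>t::real. \<bar>t\<bar> < 1 \<longrightarrow> summable (\<lambda>n. a n * t ^ n)}"
  then obtain a where f: "f = (\<lambda>t. \<Sum>n. a n * t ^ n)" and a: "\<And>t::real. \<bar>t\<bar> < 1 \<Longrightarrow> summable (\<lambda>n. a n * t ^ n)"
    by blast
  show "\<exists>g\<in>{\<lambda>t. \<Sum>n. a n * t ^ n | a. \<forall>t::real. \<bar>t\<bar> < 1 \<longrightarrow> summable (\<lambda>n. a n * t ^ n)}.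
      \<forall>t\<in>{-1<..<1}. (f has_real_derivative g t) (at t)"
    unfolding f
  proof (rule bexI[of _ "\<lambda>t. \<Sum>n. diffs a n * t ^ n"])
    show "\<forall>t\<in>{-1<..<1}. ((\<lambda>t. \<Sum>n. a n * t ^ n) has_real_derivative (\<Sum>n. diffs a n * t ^ n)) (at t)"
      using termdiffs_strong'[of 1 a] a by (auto simp: abs_less_iff)
    have "summable (\<lambda>n. diffs a n * t ^ n)" if "\<bar>t\<bar> < 1" for t
      using termdiff_converges[of t 1 a] a that by simp
    then show "(\<lambda>t. \<Sum>n. diffs a n * t ^ n) \<in>
        {\<lambda>t. \<Sum>n. a n * t ^ n | a. \<forall>t::real. \<bar>t\<bar> < 1 \<longrightarrow> summable (\<lambda>n. a n * t ^ n)}"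
      by blast
  qed
next
  show "(\<lambda>t. \<Sum>n. a n * t ^ n) \<in>
      {\<lambda>t. \<Sum>n. a n * t ^ n | a. \<forall>t::real. \<bar>t\<bar> < 1 \<longrightarrow> summable (\<lambda>n. a n * t ^ n)}"
    by (rule CollectI, rule exI[of _ a]) (simp add: assms)
qed simp

subsection \<open>Gradient and Laplacian\<close>

lemma grad_inner_Basis: "b \<in> Basis \<Longrightarrow> grad f x \<bullet> b = pd b f x"
  by (simp add: grad_def inner_sum_left_Basis)

lemma grad_eqI: "(\<And>b. b \<in> Basis \<Longrightarrow> pd b f x = v \<bullet> b) \<Longrightarrow> grad f x = v"
  by (rule euclidean_eqI) (simp add: grad_inner_Basis)

lemma grad_inner_grad: "grad f x \<bullet> grad g x = (\<Sum>b\<in>Basis. pd b f x * pd b g x)"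
  by (subst euclidean_inner) (simp add: grad_inner_Basis)

lemma grad_add:
  assumes "f differentiable (at x)" "g differentiable (at x)"
  shows "grad (\<lambda>x. f x + g x) x = grad f x + grad g x"
  by (rule grad_eqI) (simp add: pd_add[OF assms] grad_inner_Basis inner_add_left)

lemma grad_mult:
  assumes "f differentiable (at x)" "g differentiable (at x)"
  shows "grad (\<lambda>x. f x * g x) x = f x *\<^sub>R grad g x + g x *\<^sub>R grad f x"
  by (rule grad_eqI) (simp add: pd_mult[OF assms] grad_inner_Basis inner_add_left)

lemma grad_chain:
  assumes "f differentiable (at x)" "(h has_real_derivative d) (at (f x))"
  shows "grad (\<lambda>x. h (f x)) x = d *\<^sub>R grad f x"
  by (rule grad_eqI) (simp add: pd_chain[OF assms] grad_inner_Basis)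

lemma Ck_on_2D:
  assumes "Ck_on 2 f S" "x \<in> S"
  shows "f differentiable (at x)" "b \<in> Basis \<Longrightarrow> pd b f differentiable (at x)"
  using assms by (auto simp: numeral_2_eq_2)

lemma laplacian_add:
  assumes S: "open S" "x \<in> S" and f: "Ck_on 2 f S" and g: "Ck_on 2 g S"
  shows "laplacian (\<lambda>x. f x + g x) x = laplacian f x + laplacian g x"
proof -
  have "pd b (pd b (\<lambda>x. f x + g x)) x = pd b (pd b f) x + pd b (pd b g) x" if b: "b \<in> Basis" for b
  proof -
    have "pd b (pd b (\<lambda>x. f x + g x)) x = pd b (\<lambda>x. pd b f x + pd b g x) x"
      by (rule pd_transform[OF _ S, symmetric])
        (use S b Ck_on_2D[OF f] Ck_on_2D[OF g] in \<open>auto simp: pd_add\<close>)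
    then show ?thesis using pd_add[of "pd b f" x "pd b g"] b S Ck_on_2D[OF f] Ck_on_2D[OF g] by simp
  qed
  then show ?thesis by (simp add: laplacian_def sum.distrib)
qed

lemma laplacian_mult:
  assumes S: "open S" "x \<in> S" and f: "Ck_on 2 f S" and g: "Ck_on 2 g S"
  shows "laplacian (\<lambda>x. f x * g x) x =
    f x * laplacian g x + 2 * (grad f x \<bullet> grad g x) + g x * laplacian f x"
proof -
  have "pd b (pd b (\<lambda>x. f x * g x)) x =
      f x * pd b (pd b g) x + 2 * (pd b f x * pd b g x) + g x * pd b (pd b f) x" if b: "b \<in> Basis" for b
  proof -
    note d = Ck_on_2D[OF f] Ck_on_2D[OF g]
    have m: "(\<lambda>x. f x * pd b g x) differentiable (at x)" "(\<lambda>x. pd b f x * g x) differentiable (at x)"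
      using S b d by (auto intro!: differentiable_mult)
    have "pd b (pd b (\<lambda>x. f x * g x)) x = pd b (\<lambda>x. f x * pd b g x + pd b f x * g x) x"
      by (rule pd_transform[OF _ S, symmetric])
        (use S b d in \<open>auto simp: pd_mult intro!: differentiable_add differentiable_mult\<close>)
    then show ?thesis
      using pd_add[OF m, of b] pd_mult[of f x "pd b g" b] pd_mult[of "pd b f" x g b] b S d
      by simp
  qed
  then show ?thesis
    by (simp add: laplacian_def sum.distrib grad_inner_grad sum_distrib_left)
qed

lemma laplacian_const [simp]: "laplacian (\<lambda>x. c) x = 0"
  by (simp add: laplacian_def)

lemma grad_const [simp]: "grad (\<lambda>x. c) x = 0"
  by (simp add: grad_def)

lemma laplacian_cmult:
  assumes "open S" "x \<in> S" "Ck_on 2 f S"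
  shows "laplacian (\<lambda>x. c * f x) x = c * laplacian f x"
  using laplacian_mult[OF assms(1,2) Ck_on_const[of 2 c] assms(3)] by simp

lemma laplacian_chain:
  assumes S: "open S" "x \<in> S" and f: "Ck_on 2 f S"
    and T: "\<And>x. x \<in> S \<Longrightarrow> f x \<in> T"
    and h: "\<And>t. t \<in> T \<Longrightarrow> (h has_real_derivative h' t) (at t)"
    and h': "(h' has_real_derivative h'') (at (f x))"
  shows "laplacian (\<lambda>x. h (f x)) x = h'' * (grad f x \<bullet> grad f x) + h' (f x) * laplacian f x"
proof -
  have "pd b (pd b (\<lambda>x. h (f x))) x =
      h'' * (pd b f x * pd b f x) + h' (f x) * pd b (pd b f) x" if b: "b \<in> Basis" for b
  proof -
    note d = Ck_on_2D[OF f]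
    have 1: "(\<lambda>x. h' (f x)) differentiable (at x)"
      using has_derivative_real_chain[where f=f and h=h' and x=x, OF _ h'] d S unfolding differentiable_def by auto
    have "pd b (pd b (\<lambda>x. h (f x))) x = pd b (\<lambda>x. h' (f x) * pd b f x) x"
      by (rule pd_transform[OF _ S, symmetric])
        (use S b d pd_chain[where f=f and h=h and b=b, OF _ h] T 1 in \<open>auto intro!: differentiable_mult\<close>)
    then show ?thesis
      using pd_mult[OF 1, of "pd b f" b] pd_chain[where f=f and h=h' and x=x and b=b, OF _ h'] b S d
      by simp
  qed
  then show ?thesis
    by (simp add: laplacian_def sum.distrib grad_inner_grad sum_distrib_left)
qed

lemma laplacian_transform:
  assumes S: "open S" "x \<in> S" and f: "Ck_on 2 f S" and e: "\<And>x. x \<in> S \<Longrightarrow> f x = g x"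
  shows "laplacian f x = laplacian g x"
proof -
  have "pd b (pd b f) x = pd b (pd b g) x" if b: "b \<in> Basis" for b
    by (rule pd_transform[OF _ S]) (use S b Ck_on_2D[OF f] e pd_transform[OF _ S(1) _ e] in auto)
  then show ?thesis by (simp add: laplacian_def)
qed

section \<open>Derivatives of linear and quadratic functions\<close>

lemma pd_inner: "pd b (\<lambda>x. x \<bullet> v) x = b \<bullet> v"
proof -
  have "((\<lambda>x. x \<bullet> v) has_derivative (\<lambda>x. x \<bullet> v)) (at x)"
    by (auto intro!: derivative_eq_intros)
  from frechet_derivative_at[OF this] show ?thesis by metis
qed

lemma smooth_on_inner: "smooth_on S (\<lambda>x. x \<bullet> v)"
  by (intro smooth_on_bounded_linear bounded_linear_inner_left)

lemma grad_inner: "grad (\<lambda>x. x \<bullet> v) x = v"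
  by (rule grad_eqI) (simp add: pd_inner inner_commute)

lemma laplacian_inner: "laplacian (\<lambda>x. x \<bullet> v) x = 0"
  by (simp add: laplacian_def pd_inner)

lemma pd_inner_self: "pd b (\<lambda>x. x \<bullet> x) x = 2 * (x \<bullet> b)"
proof -
  have "((\<lambda>x. x \<bullet> x) has_derivative (\<lambda>v. 2 * (x \<bullet> v))) (at x)"
    by (auto intro!: derivative_eq_intros simp: inner_commute)
  from frechet_derivative_at[OF this] show ?thesis by metis
qed

lemma smooth_on_inner_self:
  assumes "open S" shows "smooth_on S (\<lambda>x. x \<bullet> x)"
proof -
  have "Ck_on k (\<lambda>x. x \<bullet> x) S" for k
  proof (cases k)
    case 0
    then show ?thesis by (simp add: continuous_on_inner continuous_on_id)
  next
    case (Suc k)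
    have "(\<lambda>x. x \<bullet> x) differentiable (at x)" for x :: 'a
      unfolding differentiable_def by (rule exI) (auto intro!: derivative_eq_intros)
    moreover have "Ck_on k (\<lambda>x. 2 * (x \<bullet> b)) S" for b
      using smooth_on_cmult[OF assms smooth_on_inner[of S b], of 2] by (simp add: smooth_on_def)
    ultimately show ?thesis using Suc by (simp add: pd_inner_self)
  qed
  then show ?thesis by (simp add: smooth_on_def)
qed

lemma grad_inner_self: "grad (\<lambda>x. x \<bullet> x) x = 2 *\<^sub>R x"
  by (rule grad_eqI) (simp add: pd_inner_self)

lemma laplacian_inner_self: "laplacian (\<lambda>x::'a. x \<bullet> x) x = 2 * DIM('a::euclidean_space)"
proof -
  have "pd b (\<lambda>x. 2 * (x \<bullet> b)) x = 2" if "b \<in> Basis" for b :: 'a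
    using pd_mult[of "\<lambda>_. 2" x "\<lambda>x. x \<bullet> b" b] smooth_on_differentiable[OF smooth_on_inner[of UNIV b]] that
    by (simp add: pd_inner)
  then show ?thesis by (simp add: laplacian_def pd_inner_self)
qed

section \<open>Partial integration\<close>

lemma lborel_integral_translate:
  fixes f :: "'a::euclidean_space \<Rightarrow> real"
  assumes "f \<in> borel_measurable borel"
  shows "integral\<^sup>L lborel (\<lambda>x. f (c + x)) = integral\<^sup>L lborel f"
proof -
  have "integral\<^sup>L lborel f = integral\<^sup>L (distr lborel borel ((+) c)) f"
    by (simp add: lborel_distr_plus)
  also have "\<dots> = integral\<^sup>L lborel (\<lambda>x. f (c + x))"
    using assms by (intro integral_distr) auto
  finally show ?thesis by simp
qed

lemma directional_has_real_derivative:
  fixes f :: "'a::euclidean_space \<Rightarrow> real"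
  assumes "f differentiable (at (x + t *\<^sub>R b))"
  shows "((\<lambda>t. f (x + t *\<^sub>R b)) has_real_derivative pd b f (x + t *\<^sub>R b)) (at t)"
proof -
  have 1: "(f has_derivative frechet_derivative f (at (x + t *\<^sub>R b))) (at (x + t *\<^sub>R b))"
    using assms frechet_derivative_works by blast
  have "((\<lambda>t. x + t *\<^sub>R b) has_derivative (\<lambda>s. s *\<^sub>R b)) (at t)"
    by (auto intro!: derivative_eq_intros)
  from has_derivative_compose[OF this 1]
  have "((\<lambda>t. f (x + t *\<^sub>R b)) has_derivative (\<lambda>s. s * pd b f (x + t *\<^sub>R b))) (at t)"
    using linear_cmul[OF has_derivative_linear[OF 1]] by simp
  moreover have "(\<lambda>s. s * pd b f (x + t *\<^sub>R b)) = (*) (pd b f (x + t *\<^sub>R b))"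
    by (rule ext) (rule mult.commute)
  ultimately show ?thesis by (simp only: has_field_derivative_def)
qed

text \<open>By translation invariance every difference quotient in direction b has integral 0, and
  dominated convergence carries this over to the derivative.\<close>

lemma integral_pd_eq_0:
  fixes f :: "'a::euclidean_space \<Rightarrow> real"
  assumes f: "\<And>x. f differentiable (at x)" and c: "continuous_on UNIV (pd b f)"
    and R: "\<And>x. norm x > R \<Longrightarrow> f x = 0"
  shows "integral\<^sup>L lborel (pd b f) = 0"
proof -
  define h where "h = (\<lambda>n::nat. inverse (real (Suc n)))"
  define q where "q = (\<lambda>n x. (f (x + h n *\<^sub>R b) - f x) / h n)"
  have h: "0 < h n" "h n \<le> 1" for n by (auto simp: h_def field_simps)
  have cf: "continuous_on UNIV f"
    using f by (simp add: continuous_at_imp_continuous_on differentiable_imp_continuous_within)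
  then have mf: "f \<in> borel_measurable borel" by (rule borel_measurable_continuous_onI)
  \<comment> \<open>Outside radius R + |b| the quotients vanish, as h n \<le> 1. Inside it the mean
    value theorem evaluates the derivative at a point displaced by at most |b|, hence the second
    |b|.\<close>
  define K where "K = cball (0::'a) (R + 2 * norm b)"
  have "compact (pd b f ` K)"
    unfolding K_def by (intro compact_continuous_image continuous_on_subset[OF c]) auto
  then obtain M where M: "\<And>x. x \<in> K \<Longrightarrow> \<bar>pd b f x\<bar> \<le> M"
    using compact_imp_bounded[of "pd b f ` K"] unfolding bounded_iff by auto
  have int_f: "integrable lborel f"
  proof -
    have "integrable lborel (\<lambda>x. indicator (cball 0 R) x *\<^sub>R f x)"
      by (intro borel_integrable_compact continuous_on_subset[OF cf]) auto
    also have "(\<lambda>x. indicator (cball 0 R) x *\<^sub>R f x) = f"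
      using R by (auto simp: fun_eq_iff indicator_def not_le)
    finally show ?thesis .
  qed
  have int_f': "integrable lborel (\<lambda>x. f (c + x))" for c
  proof -
    have "integrable (distr lborel borel ((+) c)) f" using int_f by (simp add: lborel_distr_plus)
    then show ?thesis using mf by (subst (asm) integrable_distr_eq) auto
  qed
  have q0: "integral\<^sup>L lborel (q n) = 0" for n
    using lborel_integral_translate[OF mf, of "h n *\<^sub>R b"] int_f int_f'[of "h n *\<^sub>R b"]
    by (simp add: q_def add.commute)
  have "(\<lambda>n. integral\<^sup>L lborel (q n)) \<longlonglongrightarrow> integral\<^sup>L lborel (pd b f)"
  proof (rule integral_dominated_convergence[where w = "\<lambda>x. indicator K x *\<^sub>R M"])
    show "pd b f \<in> borel_measurable lborel" using borel_measurable_continuous_onI[OF c] by simp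
    show "q n \<in> borel_measurable lborel" for n
      unfolding q_def using mf by measurable
    show "integrable lborel (\<lambda>x. indicator K x *\<^sub>R M)"
      unfolding K_def by (intro borel_integrable_compact) auto
    have lim: "(\<lambda>n. q n x) \<longlonglongrightarrow> pd b f x" for x
    proof -
      have "((\<lambda>t. f (x + t *\<^sub>R b)) has_real_derivative pd b f x) (at 0)"
        using directional_has_real_derivative[of f x 0 b] f by simp
      then have "((\<lambda>t. (f (x + t *\<^sub>R b) - f x) / t) \<longlongrightarrow> pd b f x) (at 0)"
        by (simp add: DERIV_def)
      moreover have "filterlim h (at 0) sequentially"
        unfolding filterlim_at h_def using LIMSEQ_inverse_real_of_nat by auto
      ultimately show ?thesis unfolding q_def by (rule filterlim_compose)
    qed
    then show "AE x in lborel. (\<lambda>n. q n x) \<longlonglongrightarrow> pd b f x" by simp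
    have "norm (q n x) \<le> indicator K x *\<^sub>R M" for n x
    proof (cases "norm x \<le> R + norm b")
      case False
      have "h n * norm b \<le> norm b" using h[of n] by (simp add: mult_left_le_one_le)
      then have "norm (x + h n *\<^sub>R b) > R"
        using False norm_triangle_ineq4[of "x + h n *\<^sub>R b" "h n *\<^sub>R b"] h[of n] by simp
      moreover have "norm x > R" using False norm_ge_zero[of b] by linarith
      moreover have "x \<in> K \<Longrightarrow> 0 \<le> M" using M[of x] by simp
      ultimately show ?thesis using R by (simp add: q_def indicator_def)
    next
      case True
      obtain t where t: "0 < t" "t < h n" "f (x + h n *\<^sub>R b) - f (x + 0 *\<^sub>R b) = (h n - 0) * pd b f (x + t *\<^sub>R b)"
        using MVT2[of 0 "h n" "\<lambda>t. f (x + t *\<^sub>R b)" "\<lambda>t. pd b f (x + t *\<^sub>R b)"]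
          directional_has_real_derivative f h by metis
      have "t * norm b \<le> norm b" using t h[of n] by (simp add: mult_left_le_one_le)
      then have "x + t *\<^sub>R b \<in> K" using True norm_triangle_ineq[of x "t *\<^sub>R b"] t by (simp add: K_def)
      moreover have "x \<in> K" using True by (simp add: K_def) (use norm_ge_zero[of b] in linarith)
      ultimately show ?thesis using M t h[of n] by (simp add: q_def)
    qed
    then show "AE x in lborel. norm (q n x) \<le> indicator K x *\<^sub>R M" for n by simp
  qed
  then show ?thesis using q0 by (simp add: LIMSEQ_const_iff)
qed

section \<open>Test functions\<close>

text \<open>The closure of the support is traded for any compact set outside which f vanishes. Such
  sets combine under sums and products without any support being computed.\<close>

lemma test_function_iff:
  "test_function \<Omega> f \<longleftrightarrow> smooth_on UNIV f \<and> (\<exists>K. compact K \<and> K \<subseteq> \<Omega> \<and> (\<forall>x. x \<notin> K \<longrightarrow> f x = 0))"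
proof (intro iffI conjI)
  assume "test_function \<Omega> f"
  then show "smooth_on UNIV f" "\<exists>K. compact K \<and> K \<subseteq> \<Omega> \<and> (\<forall>x. x \<notin> K \<longrightarrow> f x = 0)"
    unfolding test_function_def smooth_on_def
    using closure_subset[of "{x. f x \<noteq> 0}"] by (auto intro!: exI[of _ "closure {x. f x \<noteq> 0}"])
next
  assume a: "smooth_on UNIV f \<and> (\<exists>K. compact K \<and> K \<subseteq> \<Omega> \<and> (\<forall>x. x \<notin> K \<longrightarrow> f x = 0))"
  then obtain K where K: "compact K" "K \<subseteq> \<Omega>" "\<And>x. x \<notin> K \<Longrightarrow> f x = 0" by blast
  then have "closure {x. f x \<noteq> 0} \<subseteq> K"
    by (intro closure_minimal compact_imp_closed) auto
  then show "test_function \<Omega> f"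
    using a K bounded_subset[OF compact_imp_bounded[OF K(1)]]
    unfolding test_function_def smooth_on_def compact_eq_bounded_closed by auto
qed

lemma test_functionE:
  assumes "test_function \<Omega> f"
  obtains K where "smooth_on UNIV f" "compact K" "K \<subseteq> \<Omega>" "\<And>x. x \<notin> K \<Longrightarrow> f x = 0"
  using assms test_function_iff by blast

lemma test_function_diff:
  assumes "test_function \<Omega> f" "test_function \<Omega> g"
  shows "test_function \<Omega> (\<lambda>x. f x - g x)"
proof -
  obtain K where "smooth_on UNIV f" "compact K" "K \<subseteq> \<Omega>" "\<And>x. x \<notin> K \<Longrightarrow> f x = 0"
    using test_functionE[OF assms(1)] by metis
  moreover obtain L where "smooth_on UNIV g" "compact L" "L \<subseteq> \<Omega>" "\<And>x. x \<notin> L \<Longrightarrow> g x = 0"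
    using test_functionE[OF assms(2)] by metis
  ultimately show ?thesis unfolding test_function_iff
    by (intro conjI smooth_on_diff exI[of _ "K \<union> L"]) (auto intro: compact_Un)
qed

lemma test_function_mult:
  assumes "test_function \<Omega> f" "smooth_on UNIV g"
  shows "test_function \<Omega> (\<lambda>x. f x * g x)"
proof -
  obtain K where "smooth_on UNIV f" "compact K" "K \<subseteq> \<Omega>" "\<And>x. x \<notin> K \<Longrightarrow> f x = 0"
    using test_functionE[OF assms(1)] by metis
  then show ?thesis using assms(2) unfolding test_function_iff
    by (intro conjI smooth_on_mult exI[of _ K]) auto
qed

lemma test_function_chain:
  assumes "test_function \<Omega> f" "smooth_on UNIV h" "h 0 = 0"
  shows "test_function \<Omega> (\<lambda>x. h (f x))"
proof -
  obtain K where "smooth_on UNIV f" "compact K" "K \<subseteq> \<Omega>" "\<And>x. x \<notin> K \<Longrightarrow> f x = 0"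
    using test_functionE[OF assms(1)] by metis
  moreover from this have "smooth_on UNIV (\<lambda>x. h (f x))"
    using smooth_on_chain[of UNIV UNIV f h] assms(2) by simp
  ultimately show ?thesis using assms(3) unfolding test_function_iff by (metis (no_types, lifting))
qed

lemma test_function_pd:
  assumes "test_function \<Omega> f" "b \<in> Basis"
  shows "test_function \<Omega> (pd b f)"
proof -
  obtain K where K: "smooth_on UNIV f" "compact K" "K \<subseteq> \<Omega>" "\<And>x. x \<notin> K \<Longrightarrow> f x = 0"
    using test_functionE[OF assms(1)] by metis
  have "pd b f x = 0" if "x \<notin> K" for x
    using pd_transform[of f x "- K" "\<lambda>_. 0" b] K that
    by (simp add: compact_imp_closed open_Compl smooth_on_differentiable)
  then show ?thesis using K assms(2) unfolding test_function_iff
    by (intro conjI smooth_on_pd exI[of _ K]) auto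
qed

lemma test_function_differentiable: "test_function \<Omega> f \<Longrightarrow> f differentiable (at x)"
  using test_functionE smooth_on_differentiable by blast

lemma test_function_continuous: "test_function \<Omega> f \<Longrightarrow> continuous_on UNIV f"
  using test_functionE smooth_on_continuous by blast

lemma borel_measurable_lebesgue_onI:
  "f \<in> borel_measurable borel \<Longrightarrow> f \<in> borel_measurable (lebesgue_on \<Omega>)"
  by (simp add: borel_measurable_if measurable_completion measurable_restrict_space1)

lemma test_function_bounded:
  assumes "test_function \<Omega> f" obtains B where "\<And>x. \<bar>f x\<bar> \<le> B"
proof -
  obtain K where K: "smooth_on UNIV f" "compact K" "K \<subseteq> \<Omega>" "\<And>x. x \<notin> K \<Longrightarrow> f x = 0"
    using test_functionE[OF assms(1)] by metis
  have "compact (f ` K)"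
    using K continuous_on_subset[OF test_function_continuous[OF assms]] by (intro compact_continuous_image) auto
  then obtain B where "\<And>x. x \<in> K \<Longrightarrow> \<bar>f x\<bar> \<le> B"
    using compact_imp_bounded[of "f ` K"] unfolding bounded_iff by auto
  then have "\<bar>f x\<bar> \<le> max B 0" for x using K(4)[of x] by (cases "x \<in> K") (auto simp: max.coboundedI1)
  then show ?thesis by (rule that)
qed

lemma integral_lebesgue_on_eq_lborel:
  fixes f :: "'a::euclidean_space \<Rightarrow> real"
  assumes "open \<Omega>" "f \<in> borel_measurable borel" "\<And>x. x \<notin> \<Omega> \<Longrightarrow> f x = 0"
  shows "integral\<^sup>L (lebesgue_on \<Omega>) f = integral\<^sup>L lborel f"
proof -
  have "integral\<^sup>L (lebesgue_on \<Omega>) f = integral\<^sup>L lebesgue (\<lambda>x. indicator \<Omega> x *\<^sub>R f x)"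
    using assms(1) by (intro integral_restrict_space) auto
  also have "(\<lambda>x. indicator \<Omega> x *\<^sub>R f x) = f" using assms(3) by (auto simp: fun_eq_iff indicator_def)
  also have "integral\<^sup>L lebesgue f = integral\<^sup>L lborel f"
    using assms(2) by (intro integral_completion) simp
  finally show ?thesis .
qed

lemma integral_test_function_pd:
  assumes "open \<Omega>" "test_function \<Omega> f" "b \<in> Basis"
  shows "integral\<^sup>L (lebesgue_on \<Omega>) (pd b f) = 0"
proof -
  obtain K where K: "smooth_on UNIV f" "compact K" "K \<subseteq> \<Omega>" "\<And>x. x \<notin> K \<Longrightarrow> f x = 0"
    using test_functionE[OF assms(2)] by metis
  obtain K' where K': "K' \<subseteq> \<Omega>" "\<And>x. x \<notin> K' \<Longrightarrow> pd b f x = 0"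
    using test_functionE[OF test_function_pd[OF assms(2,3)]] by metis
  have c: "continuous_on UNIV (pd b f)"
    using test_function_continuous[OF test_function_pd[OF assms(2,3)]] .
  obtain R where R: "\<And>x. x \<in> K \<Longrightarrow> norm x \<le> R" using compact_imp_bounded[OF K(2)] bounded_iff by metis
  have "integral\<^sup>L (lebesgue_on \<Omega>) (pd b f) = integral\<^sup>L lborel (pd b f)"
    using K' by (intro integral_lebesgue_on_eq_lborel assms borel_measurable_continuous_onI[OF c]) auto
  also have "\<dots> = 0"
    using K R by (intro integral_pd_eq_0[of f b R] c smooth_on_differentiable[of UNIV]) force+
  finally show ?thesis .
qed

section \<open>Square integrability, the Poincare inequality and Green's formula\<close>

lemma L2_on_mult_integrable:
  fixes f g :: "'a::euclidean_space \<Rightarrow> real"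
  assumes "L2_on \<Omega> f" "L2_on \<Omega> g"
  shows "integrable (lebesgue_on \<Omega>) (\<lambda>x. f x * g x)"
proof (rule Bochner_Integration.integrable_bound)
  show "integrable (lebesgue_on \<Omega>) (\<lambda>x. (norm (f x))\<^sup>2 + (norm (g x))\<^sup>2)"
    using assms by (auto simp: L2_on_def)
  show "(\<lambda>x. f x * g x) \<in> borel_measurable (lebesgue_on \<Omega>)"
    using assms by (auto simp: L2_on_def)
  have "\<bar>a * b\<bar> \<le> a\<^sup>2 + b\<^sup>2" for a b :: real
    using sum_squares_bound[of "\<bar>a\<bar>" "\<bar>b\<bar>"] by (simp add: abs_mult) (use zero_le_power2[of a] zero_le_power2[of b] in linarith)
  then show "AE x in lebesgue_on \<Omega>. norm (f x * g x) \<le> norm ((norm (f x))\<^sup>2 + (norm (g x))\<^sup>2)"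
    by simp
qed

lemma L2_on_inner:
  fixes g :: "'a::euclidean_space \<Rightarrow> 'b::euclidean_space"
  assumes "L2_on \<Omega> g" "b \<in> Basis"
  shows "L2_on \<Omega> (\<lambda>x. g x \<bullet> b)"
proof -
  have m: "(\<lambda>x. g x \<bullet> b) \<in> borel_measurable (lebesgue_on \<Omega>)"
    using assms by (auto simp: L2_on_def)
  have "\<bar>v \<bullet> b\<bar>\<^sup>2 \<le> (norm v)\<^sup>2" for v :: 'b
    using Basis_le_norm[OF assms(2), of v] by (intro power_mono) auto
  then have "integrable (lebesgue_on \<Omega>) (\<lambda>x. (norm (g x \<bullet> b))\<^sup>2)"
    using assms m by (auto simp: L2_on_def intro: Bochner_Integration.integrable_bound[of _ "\<lambda>x. (norm (g x))\<^sup>2"])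
  then show ?thesis using m by (simp add: L2_on_def)
qed

lemma L2_on_add:
  fixes f g :: "'a::euclidean_space \<Rightarrow> real"
  assumes "L2_on \<Omega> f" "L2_on \<Omega> g"
  shows "L2_on \<Omega> (\<lambda>x. f x + g x)" "L2_on \<Omega> (\<lambda>x. f x - g x)"
proof -
  have "integrable (lebesgue_on \<Omega>) (\<lambda>x. (f x)\<^sup>2 + 2 * (f x * g x) + (g x)\<^sup>2)"
    "integrable (lebesgue_on \<Omega>) (\<lambda>x. (f x)\<^sup>2 - 2 * (f x * g x) + (g x)\<^sup>2)"
    using assms L2_on_mult_integrable[OF assms] by (auto simp: L2_on_def)
  then show "L2_on \<Omega> (\<lambda>x. f x + g x)" "L2_on \<Omega> (\<lambda>x. f x - g x)"
    using assms by (auto simp: L2_on_def power2_eq_square algebra_simps)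
qed

lemma test_function_L2:
  assumes "open \<Omega>" "bounded \<Omega>" "test_function \<Omega> f"
  shows "L2_on \<Omega> f" "integrable (lebesgue_on \<Omega>) f"
proof -
  interpret finite_measure "lebesgue_on \<Omega>"
    using assms by (intro finite_measure_lebesgue_on lmeasurable_open)
  have m: "f \<in> borel_measurable (lebesgue_on \<Omega>)"
    using test_function_continuous[OF assms(3)] by (intro borel_measurable_lebesgue_onI borel_measurable_continuous_onI)
  obtain B where B: "\<And>x. \<bar>f x\<bar> \<le> B" using test_function_bounded[OF assms(3)] by blast
  show "integrable (lebesgue_on \<Omega>) f"
    by (rule integrable_const_bound[of _ B]) (use B m in auto)
  have "\<bar>f x\<bar>\<^sup>2 \<le> B\<^sup>2" for x using B[of x] by (intro power_mono) auto
  then have "integrable (lebesgue_on \<Omega>) (\<lambda>x. (norm (f x))\<^sup>2)"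
    using m by (intro integrable_const_bound[of _ "B\<^sup>2"]) auto
  then show "L2_on \<Omega> f" using m by (simp add: L2_on_def)
qed

lemma L2_on_components:
  fixes g :: "'a::euclidean_space \<Rightarrow> 'b::euclidean_space"
  assumes "\<And>b. b \<in> Basis \<Longrightarrow> L2_on \<Omega> (\<lambda>x. g x \<bullet> b)"
  shows "L2_on \<Omega> g"
proof -
  have "g \<in> borel_measurable (lebesgue_on \<Omega>)"
    using assms by (subst borel_measurable_euclidean_space) (auto simp: L2_on_def)
  moreover have "(\<lambda>x. (norm (g x))\<^sup>2) = (\<lambda>x. \<Sum>b\<in>Basis. (norm (g x \<bullet> b))\<^sup>2)"
    by (subst power2_norm_eq_inner, subst euclidean_inner) (simp add: power2_eq_square)
  then have "integrable (lebesgue_on \<Omega>) (\<lambda>x. (norm (g x))\<^sup>2)"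
    using assms by (auto simp: L2_on_def)
  ultimately show ?thesis by (simp add: L2_on_def)
qed

lemma test_function_grad_L2:
  assumes "open \<Omega>" "bounded \<Omega>" "test_function \<Omega> f"
  shows "L2_on \<Omega> (grad f)"
  by (rule L2_on_components) (simp add: grad_inner_Basis test_function_L2 test_function_pd assms)

lemma L2_on_inner_integrable:
  fixes f g :: "'a::euclidean_space \<Rightarrow> 'b::euclidean_space"
  assumes "L2_on \<Omega> f" "L2_on \<Omega> g"
  shows "integrable (lebesgue_on \<Omega>) (\<lambda>x. f x \<bullet> g x)"
  by (subst euclidean_inner) (intro Bochner_Integration.integrable_sum L2_on_mult_integrable L2_on_inner assms)

lemma L2_on_diff_vec:
  fixes f g :: "'a::euclidean_space \<Rightarrow> 'b::euclidean_space"
  assumes "L2_on \<Omega> f" "L2_on \<Omega> g"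
  shows "L2_on \<Omega> (\<lambda>x. f x - g x)"
  by (rule L2_on_components) (simp add: inner_diff_left L2_on_add L2_on_inner assms)

text \<open>The derivative of f^2 (x . b) in one coordinate direction b has integral 0 and equals
  f^2 + 2 f (pd b f) (x . b). Completing the square in f + 2 (pd b f) (x . b), with |x . b| \<le> R,
  leaves the gradient term with the factor 4 R^2.\<close>

lemma poincare_test_function:
  fixes f :: "'a::euclidean_space \<Rightarrow> real"
  assumes "open \<Omega>" "test_function \<Omega> f" and R: "\<And>x. x \<in> \<Omega> \<Longrightarrow> norm x \<le> R"
  shows "integral\<^sup>L (lebesgue_on \<Omega>) (\<lambda>x. (f x)\<^sup>2) \<le>
    4 * R\<^sup>2 * integral\<^sup>L (lebesgue_on \<Omega>) (\<lambda>x. (norm (grad f x))\<^sup>2)"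
proof -
  have bd: "bounded \<Omega>" using R bounded_iff by blast
  obtain b :: 'a where b: "b \<in> Basis" using nonempty_Basis by blast
  note tf = assms(2)
  have sf: "smooth_on UNIV f" using tf test_function_iff by blast
  define F where "F = (\<lambda>x. f x * f x * (x \<bullet> b))"
  have tF: "test_function \<Omega> F"
    unfolding F_def by (intro test_function_mult tf sf smooth_on_inner)
  have d: "f differentiable (at x)" for x using test_function_differentiable[OF tf] .
  have pdF: "pd b F x = f x * f x + 2 * f x * pd b f x * (x \<bullet> b)" for x
  proof -
    have "pd b F x = f x * f x * pd b (\<lambda>x. x \<bullet> b) x + pd b (\<lambda>x. f x * f x) x * (x \<bullet> b)"
      unfolding F_def
      by (rule pd_mult) (auto intro!: differentiable_mult d smooth_on_differentiable[OF smooth_on_inner[of UNIV]])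
    then show ?thesis using b by (simp add: pd_mult[OF d d] pd_inner algebra_simps)
  qed
  have i1: "integrable (lebesgue_on \<Omega>) (\<lambda>x. (f x)\<^sup>2)"
    using test_function_L2[OF assms(1) bd tf] by (simp add: L2_on_def)
  have i2: "integrable (lebesgue_on \<Omega>) (pd b F)"
    using test_function_L2[OF assms(1) bd test_function_pd[OF tF b]] by simp
  have i3: "integrable (lebesgue_on \<Omega>) (\<lambda>x. (norm (grad f x))\<^sup>2)"
    using test_function_grad_L2[OF assms(1) bd tf] by (simp add: L2_on_def)
  have "integral\<^sup>L (lebesgue_on \<Omega>) (\<lambda>x. (f x)\<^sup>2) \<le>
      integral\<^sup>L (lebesgue_on \<Omega>) (\<lambda>x. 2 * pd b F x + 4 * R\<^sup>2 * (norm (grad f x))\<^sup>2)"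
  proof (rule integral_mono)
    fix x assume "x \<in> space (lebesgue_on \<Omega>)"
    then have "norm x \<le> R" using R by simp
    then have y: "\<bar>x \<bullet> b\<bar> \<le> R" using Basis_le_norm[OF b, of x] by simp
    have p: "\<bar>pd b f x\<bar> \<le> norm (grad f x)"
      using Basis_le_norm[OF b, of "grad f x"] b by (simp add: grad_inner_Basis)
    have "\<bar>pd b f x\<bar> * \<bar>x \<bullet> b\<bar> \<le> norm (grad f x) * R"
      using y p by (intro mult_mono) auto
    then have "\<bar>pd b f x * (x \<bullet> b)\<bar>\<^sup>2 \<le> (norm (grad f x) * R)\<^sup>2"
      by (intro power_mono) (auto simp: abs_mult)
    moreover have "0 \<le> (f x + 2 * (pd b f x * (x \<bullet> b)))\<^sup>2" by simp
    ultimately show "(f x)\<^sup>2 \<le> 2 * pd b F x + 4 * R\<^sup>2 * (norm (grad f x))\<^sup>2"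
      unfolding pdF by (simp add: power2_eq_square algebra_simps)
  qed (use i1 i2 i3 in auto)
  also have "\<dots> = 4 * R\<^sup>2 * integral\<^sup>L (lebesgue_on \<Omega>) (\<lambda>x. (norm (grad f x))\<^sup>2)"
    using i2 i3 integral_test_function_pd[OF assms(1) tF b] by simp
  finally show ?thesis .
qed

lemma green_test_function:
  assumes "open \<Omega>" "bounded \<Omega>" "test_function \<Omega> w" "test_function \<Omega> f"
  shows "integral\<^sup>L (lebesgue_on \<Omega>) (\<lambda>x. grad w x \<bullet> grad f x) =
    - integral\<^sup>L (lebesgue_on \<Omega>) (\<lambda>x. laplacian w x * f x)"
    "integrable (lebesgue_on \<Omega>) (\<lambda>x. laplacian w x * f x)"
proof -
  let ?M = "lebesgue_on \<Omega>"
  note tpd = test_function_pd[OF assms(3)]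
  have sf: "smooth_on UNIV f" using assms(4) test_function_iff by blast
  have i: "integrable ?M (\<lambda>x. pd b (pd b w) x * f x)" "integrable ?M (\<lambda>x. pd b w x * pd b f x)"
    if "b \<in> Basis" for b
    using that by (auto intro!: L2_on_mult_integrable test_function_L2 tpd assms test_function_pd)
  have e: "integral\<^sup>L ?M (\<lambda>x. pd b (pd b w) x * f x) = - integral\<^sup>L ?M (\<lambda>x. pd b w x * pd b f x)"
    if b: "b \<in> Basis" for b
  proof -
    have "pd b (\<lambda>x. pd b w x * f x) x = pd b w x * pd b f x + pd b (pd b w) x * f x" for x
      by (rule pd_mult) (use tpd[OF b] assms(4) test_function_differentiable in auto)
    then have "integral\<^sup>L ?M (\<lambda>x. pd b w x * pd b f x + pd b (pd b w) x * f x) = 0"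
      using integral_test_function_pd[OF assms(1) test_function_mult[OF tpd[OF b] sf] b] by simp
    then show ?thesis using i[OF b] by simp
  qed
  have "integral\<^sup>L ?M (\<lambda>x. laplacian w x * f x) = (\<Sum>b\<in>Basis. integral\<^sup>L ?M (\<lambda>x. pd b (pd b w) x * f x))"
    unfolding laplacian_def sum_distrib_right using i by (intro Bochner_Integration.integral_sum) auto
  also have "\<dots> = - (\<Sum>b\<in>Basis. integral\<^sup>L ?M (\<lambda>x. pd b w x * pd b f x))"
    using e by (simp add: sum_negf)
  also have "(\<Sum>b\<in>Basis. integral\<^sup>L ?M (\<lambda>x. pd b w x * pd b f x)) = integral\<^sup>L ?M (\<lambda>x. grad w x \<bullet> grad f x)"
    unfolding grad_inner_grad using i by (intro Bochner_Integration.integral_sum[symmetric]) auto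
  finally show "integral\<^sup>L ?M (\<lambda>x. grad w x \<bullet> grad f x) = - integral\<^sup>L ?M (\<lambda>x. laplacian w x * f x)"
    by simp
  show "integrable ?M (\<lambda>x. laplacian w x * f x)"
    unfolding laplacian_def sum_distrib_right using i by auto
qed

section \<open>Comparison with the weak solution\<close>

text \<open>The right-hand side does not mention \<open>g\<close>. Hence the gradient in
  \<open>W12_0\<close> and the one in the equation, which are quantified separately, pair equally
  with gradients of test functions and may be exchanged.\<close>

lemma W12_grad_test:
  assumes "open \<Omega>" "bounded \<Omega>" "W12_grad \<Omega> u g" "test_function \<Omega> f"
  shows "integral\<^sup>L (lebesgue_on \<Omega>) (\<lambda>x. g x \<bullet> grad f x) =
    - integral\<^sup>L (lebesgue_on \<Omega>) (\<lambda>x. u x * laplacian f x)"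
proof -
  let ?M = "lebesgue_on \<Omega>"
  have L2: "L2_on \<Omega> u" "L2_on \<Omega> g" using assms(3) by (auto simp: W12_grad_def)
  note tpd = test_function_pd[OF assms(4)]
  have i: "integrable ?M (\<lambda>x. u x * pd b (pd b f) x)" "integrable ?M (\<lambda>x. (g x \<bullet> b) * pd b f x)"
    if "b \<in> Basis" for b
    using that by (auto intro!: L2_on_mult_integrable L2 L2_on_inner test_function_L2 tpd assms test_function_pd)
  have "integral\<^sup>L ?M (\<lambda>x. g x \<bullet> grad f x) = integral\<^sup>L ?M (\<lambda>x. \<Sum>b\<in>Basis. (g x \<bullet> b) * pd b f x)"
    by (rule Bochner_Integration.integral_cong[OF refl], subst euclidean_inner) (simp add: grad_inner_Basis)
  also have "\<dots> = (\<Sum>b\<in>Basis. integral\<^sup>L ?M (\<lambda>x. (g x \<bullet> b) * pd b f x))"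
    using i by (intro Bochner_Integration.integral_sum) auto
  also have "\<dots> = - (\<Sum>b\<in>Basis. integral\<^sup>L ?M (\<lambda>x. u x * pd b (pd b f) x))"
    using assms(3) tpd unfolding W12_grad_def by (simp add: sum_negf[symmetric])
  also have "(\<Sum>b\<in>Basis. integral\<^sup>L ?M (\<lambda>x. u x * pd b (pd b f) x)) = integral\<^sup>L ?M (\<lambda>x. u x * laplacian f x)"
    unfolding laplacian_def sum_distrib_left using i
    by (intro Bochner_Integration.integral_sum[symmetric]) auto
  finally show ?thesis .
qed

text \<open>
  The equation is tested with \<open>\<eta> = flat (w - \<psi>)\<close>, where the test functions \<open>\<psi>\<close> approximate \<open>u\<close>. As
  \<open>0 \<le> flat' \<le> 1\<close>, the energy of \<open>\<eta>\<close> itself is at most that of \<open>u - \<psi>\<close>, so no truncation operators on Sobolev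
  functions are needed.
\<close>

theorem weak_comparison:
  fixes u w :: "'a::euclidean_space \<Rightarrow> real"
  assumes \<Omega>: "open \<Omega>" "bounded \<Omega>" and "W12_0 \<Omega> u" "weak_laplacian_minus_one \<Omega> u"
    and tw: "test_function \<Omega> w" and lap: "\<And>x. x \<in> \<Omega> \<Longrightarrow> laplacian w x \<ge> -1"
  shows "AE x in lebesgue_on \<Omega>. w x \<le> u x"
proof -
  let ?M = "lebesgue_on \<Omega>"
  obtain g \<psi> where g: "W12_grad \<Omega> u g" and t\<psi>: "\<And>k. test_function \<Omega> (\<psi> k)"
    and lim: "(\<lambda>k::nat. integral\<^sup>L ?M (\<lambda>x. (\<psi> k x - u x)\<^sup>2 + (norm (grad (\<psi> k) x - g x))\<^sup>2)) \<longlonglongrightarrow> 0"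
    using assms(3) unfolding W12_0_def by blast
  define I where "I = (\<lambda>k::nat. integral\<^sup>L ?M (\<lambda>x. (\<psi> k x - u x)\<^sup>2 + (norm (grad (\<psi> k) x - g x))\<^sup>2))"
  have L2: "L2_on \<Omega> u" "L2_on \<Omega> g" using g by (auto simp: W12_grad_def)
  have weak: "integral\<^sup>L ?M (\<lambda>x. g x \<bullet> grad f x) = integral\<^sup>L ?M f" if "test_function \<Omega> f" for f
    using assms(4) W12_grad_test[OF \<Omega> _ that] g that unfolding weak_laplacian_minus_one_def by metis
  obtain R where R: "\<And>x. x \<in> \<Omega> \<Longrightarrow> norm x \<le> R" using \<Omega>(2) bounded_iff by metis
  define \<zeta> where "\<zeta> = (\<lambda>k x. w x - \<psi> k x)"
  define \<eta> where "\<eta> = (\<lambda>k x. flat (\<zeta> k x))"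
  have t\<zeta>: "test_function \<Omega> (\<zeta> k)" for k
    unfolding \<zeta>_def by (intro test_function_diff tw t\<psi>)
  have t\<eta>: "test_function \<Omega> (\<eta> k)" for k
    unfolding \<eta>_def by (rule test_function_chain[OF t\<zeta> smooth_on_flat]) (simp add: flat_def)
  have grad\<eta>: "grad (\<eta> k) x = flat' (\<zeta> k x) *\<^sub>R grad (\<zeta> k) x" for k x
    unfolding \<eta>_def by (rule grad_chain[OF test_function_differentiable[OF t\<zeta>] flat_deriv])
  have grad\<zeta>: "grad (\<zeta> k) x = grad w x - grad (\<psi> k) x" for k x
  proof (rule grad_eqI)
    fix b :: 'a assume "b \<in> Basis"
    have 1: "(\<lambda>x. (-1) * \<psi> k x) differentiable (at x)"
      using test_function_differentiable[OF t\<psi>] by (intro differentiable_mult) auto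
    show "pd b (\<zeta> k) x = (grad w x - grad (\<psi> k) x) \<bullet> b"
      using pd_add[OF test_function_differentiable[OF tw] 1, of b]
        pd_mult[of "\<lambda>_. -1" x "\<psi> k" b] test_function_differentiable[OF t\<psi>] \<open>b \<in> Basis\<close>
      by (simp add: \<zeta>_def inner_diff_left grad_inner_Basis)
  qed
  note L2t = test_function_L2(1)[OF \<Omega>] test_function_grad_L2[OF \<Omega>]
  have i_sq: "integrable ?M (\<lambda>x. (norm (grad (\<eta> k) x))\<^sup>2)" for k
    using L2t(2)[OF t\<eta>[of k]] by (simp add: L2_on_def)
  have i_e: "integrable ?M (\<lambda>x. (\<psi> k x - u x)\<^sup>2)" "integrable ?M (\<lambda>x. (norm (grad (\<psi> k) x - g x))\<^sup>2)" for k
    using L2_on_add(2)[OF L2t(1)[OF t\<psi>[of k]] L2(1)] L2_on_diff_vec[OF L2t(2)[OF t\<psi>[of k]] L2(2)]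
    by (simp_all add: L2_on_def)
  have bound1: "integral\<^sup>L ?M (\<lambda>x. (norm (grad (\<eta> k) x))\<^sup>2) \<le> I k" for k
  proof -
    have ig: "integrable ?M (\<lambda>x. g x \<bullet> grad (\<eta> k) x)" "integrable ?M (\<lambda>x. grad w x \<bullet> grad (\<eta> k) x)"
      by (intro L2_on_inner_integrable L2 L2t t\<eta> tw)+
    note gr = green_test_function[OF \<Omega> tw t\<eta>[of k]]
    have i\<eta>: "integrable ?M (\<eta> k)" using test_function_L2[OF \<Omega> t\<eta>] by simp
    \<comment> \<open>By the equation for u and Green's formula for w, the difference of the two
      pairings with grad \<eta> is the integral of (1 + laplacian w) \<eta>, which has a
      sign.\<close>
    have "0 \<le> integral\<^sup>L ?M (\<lambda>x. \<eta> k x + laplacian w x * \<eta> k x)"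
    proof (rule integral_nonneg_AE, rule AE_I2)
      fix x assume "x \<in> space ?M"
      then have "0 \<le> (1 + laplacian w x) * \<eta> k x"
        using lap[of x] by (intro mult_nonneg_nonneg) (auto simp: \<eta>_def flat_simps)
      then show "0 \<le> \<eta> k x + laplacian w x * \<eta> k x" by (simp add: algebra_simps)
    qed
    also have "\<dots> = integral\<^sup>L ?M (\<lambda>x. g x \<bullet> grad (\<eta> k) x - grad w x \<bullet> grad (\<eta> k) x)"
      using ig gr weak[OF t\<eta>[of k]] i\<eta> by simp
    finally have pos: "0 \<le> integral\<^sup>L ?M (\<lambda>x. g x \<bullet> grad (\<eta> k) x - grad w x \<bullet> grad (\<eta> k) x)" .
    have "integral\<^sup>L ?M (\<lambda>x. (norm (grad (\<eta> k) x))\<^sup>2) \<le>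
      integral\<^sup>L ?M (\<lambda>x. ((\<psi> k x - u x)\<^sup>2 + (norm (grad (\<psi> k) x - g x))\<^sup>2) -
        2 * (g x \<bullet> grad (\<eta> k) x - grad w x \<bullet> grad (\<eta> k) x))"
    proof (rule integral_mono)
      fix x
      \<comment> \<open>Here g - grad w = -(v + e). Expanding a |v + e|^2 \<ge> 0 and using a^2
        \<le> a \<le> 1 bounds a^2 |v|^2, the energy density of \<eta>, by |e|^2 plus twice the
        pairing of -(v + e) and a v with the sign reversed.\<close>
      define a where "a = flat' (\<zeta> k x)"
      define v where "v = grad (\<zeta> k) x"
      define e where "e = grad (\<psi> k) x - g x"
      have a: "0 \<le> a" "a \<le> 1" by (auto simp: a_def flat'_bounds)
      have "a * a * (v \<bullet> v) \<le> a * (v \<bullet> v)"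
        using a mult_mono[of a 1 a a] by (intro mult_right_mono) auto
      moreover have "0 \<le> a * ((v + e) \<bullet> (v + e))" using a by simp
      moreover have "a * (e \<bullet> e) \<le> e \<bullet> e" using a by (simp add: mult_left_le_one_le)
      ultimately have "a * a * (v \<bullet> v) \<le> e \<bullet> e - 2 * (a * (- (v \<bullet> v) - e \<bullet> v))"
        by (simp add: inner_add_left inner_add_right algebra_simps inner_commute)
      then have 1: "a * a * (v \<bullet> v) \<le> ((\<psi> k x - u x)\<^sup>2 + e \<bullet> e) - 2 * (a * (- (v \<bullet> v) - e \<bullet> v))"
        using zero_le_power2[of "\<psi> k x - u x"] by linarith
      have 2: "g x \<bullet> v - grad w x \<bullet> v = - (v \<bullet> v) - e \<bullet> v"
        unfolding v_def e_def grad\<zeta> by (simp add: inner_diff_left inner_diff_right inner_commute)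
      have "g x \<bullet> grad (\<eta> k) x - grad w x \<bullet> grad (\<eta> k) x = a * (- (v \<bullet> v) - e \<bullet> v)"
        unfolding grad\<eta> a_def[symmetric] v_def[symmetric] 2[symmetric] by (simp add: algebra_simps)
      moreover have "(norm (grad (\<eta> k) x))\<^sup>2 = a * a * (v \<bullet> v)"
        unfolding grad\<eta> a_def[symmetric] v_def[symmetric] power2_norm_eq_inner by simp
      ultimately show "(norm (grad (\<eta> k) x))\<^sup>2 \<le> ((\<psi> k x - u x)\<^sup>2 + (norm (grad (\<psi> k) x - g x))\<^sup>2) -
        2 * (g x \<bullet> grad (\<eta> k) x - grad w x \<bullet> grad (\<eta> k) x)"
        using 1 by (simp add: e_def power2_norm_eq_inner)
    qed (use i_sq i_e ig in auto)
    also have "\<dots> = I k - 2 * integral\<^sup>L ?M (\<lambda>x. g x \<bullet> grad (\<eta> k) x - grad w x \<bullet> grad (\<eta> k) x)"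
      unfolding I_def using i_e ig by (subst Bochner_Integration.integral_diff) auto
    also have "\<dots> \<le> I k" using pos by simp
    finally show ?thesis .
  qed
  \<comment> \<open>\<open>flat\<close> is 1-Lipschitz, so v differs from \<eta> k by at most
    |\<psi> k - u|. Both are small in the L^2 norm, the former by Poincare. Thus v = 0 almost
    everywhere, and \<open>flat\<close> vanishes only on nonpositive arguments.\<close>
  define v where "v = (\<lambda>x. flat (w x - u x))"
  have mv: "v \<in> borel_measurable ?M"
  proof -
    have "(\<lambda>x. w x - u x) \<in> borel_measurable ?M" using L2 L2t(1)[OF tw] by (auto simp: L2_on_def)
    moreover have "flat \<in> borel_measurable borel"
      using smooth_on_continuous[OF smooth_on_flat] by (rule borel_measurable_continuous_onI)
    ultimately show ?thesis unfolding v_def by measurable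
  qed
  have flat_lip: "\<bar>flat s - flat t\<bar> \<le> \<bar>s - t\<bar>" for s t
  proof -
    have "\<bar>flat s - flat t\<bar> \<le> 1 * \<bar>s - t\<bar>"
      using field_differentiable_bound[of UNIV flat flat' 1 s t] flat_deriv flat'_bounds by simp
    then show ?thesis by simp
  qed
  have vle: "(v x)\<^sup>2 \<le> 2 * (\<eta> k x)\<^sup>2 + 2 * (\<psi> k x - u x)\<^sup>2" for k x
  proof -
    have "\<bar>v x - \<eta> k x\<bar>\<^sup>2 \<le> \<bar>\<psi> k x - u x\<bar>\<^sup>2"
      using flat_lip[of "w x - u x" "\<zeta> k x"] by (intro power_mono) (auto simp: v_def \<eta>_def \<zeta>_def)
    moreover have "(v x)\<^sup>2 \<le> 2 * (\<eta> k x)\<^sup>2 + 2 * (v x - \<eta> k x)\<^sup>2"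
      using zero_le_power2[of "v x - 2 * \<eta> k x"] by (simp add: power2_eq_square algebra_simps)
    ultimately show ?thesis by simp
  qed
  have i\<eta>2: "integrable ?M (\<lambda>x. (\<eta> k x)\<^sup>2)" for k
    using L2t(1)[OF t\<eta>[of k]] by (simp add: L2_on_def)
  have iv: "integrable ?M (\<lambda>x. (v x)\<^sup>2)"
    by (rule Bochner_Integration.integrable_bound[of _ "\<lambda>x. 2 * (\<eta> 0 x)\<^sup>2 + 2 * (\<psi> 0 x - u x)\<^sup>2"])
      (use vle[of _ 0] i\<eta>2 i_e mv in auto)
  have bound2: "integral\<^sup>L ?M (\<lambda>x. (v x)\<^sup>2) \<le> (8 * R\<^sup>2 + 2) * I k" for k
  proof -
    have "integral\<^sup>L ?M (\<lambda>x. (v x)\<^sup>2) \<le> integral\<^sup>L ?M (\<lambda>x. 2 * (\<eta> k x)\<^sup>2 + 2 * (\<psi> k x - u x)\<^sup>2)"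
      by (rule integral_mono) (use iv i\<eta>2 i_e vle in auto)
    also have "\<dots> = 2 * integral\<^sup>L ?M (\<lambda>x. (\<eta> k x)\<^sup>2) + 2 * integral\<^sup>L ?M (\<lambda>x. (\<psi> k x - u x)\<^sup>2)"
      using i\<eta>2 i_e by simp
    also have "integral\<^sup>L ?M (\<lambda>x. (\<eta> k x)\<^sup>2) \<le> 4 * R\<^sup>2 * I k"
      using poincare_test_function[OF \<Omega>(1) t\<eta>[of k] R] mult_left_mono[OF bound1[of k], of "4 * R\<^sup>2"] by simp
    also have "integral\<^sup>L ?M (\<lambda>x. (\<psi> k x - u x)\<^sup>2) \<le> I k"
      unfolding I_def by (rule integral_mono) (use i_e in auto)
    finally show ?thesis by (simp add: algebra_simps)
  qed
  have "(\<lambda>k. (8 * R\<^sup>2 + 2) * I k) \<longlonglongrightarrow> (8 * R\<^sup>2 + 2) * 0"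
    using lim unfolding I_def by (rule tendsto_mult_left)
  then have "integral\<^sup>L ?M (\<lambda>x. (v x)\<^sup>2) \<le> 0"
    using bound2 by (intro LIMSEQ_le_const[of _ 0]) auto
  moreover have "0 \<le> integral\<^sup>L ?M (\<lambda>x. (v x)\<^sup>2)" by (simp add: integral_nonneg_AE)
  ultimately have "AE x in ?M. (v x)\<^sup>2 = 0"
    using iv by (subst integral_nonneg_eq_0_iff_AE[symmetric]) auto
  then show ?thesis
  proof (rule AE_mp, intro AE_I2 impI)
    fix x assume "(v x)\<^sup>2 = 0"
    then show "w x \<le> u x" using flat_simps(2)[of "w x - u x"] by (force simp: v_def)
  qed
qed

section \<open>The zonal equation on the sphere\<close>

text \<open>
  In the variable \<open>s = (1 - \<omega> \<bullet> \<nu>) / 2\<close> a zonal function \<open>g(s)\<close> on the unit sphere of dimension \<open>2 c\<close> is an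
  eigenfunction with eigenvalue \<open>L\<close> iff \<open>s (1 - s) g'' + c (1 - 2 s) g' + L g = 0\<close>. The solution that is
  regular at \<open>s = 0\<close> is a hypergeometric series.
\<close>

primrec zcoeff :: "real \<Rightarrow> real \<Rightarrow> nat \<Rightarrow> real" where
  "zcoeff c L 0 = 1"
| "zcoeff c L (Suc k) =
     zcoeff c L k * ((real k * (real k - 1) + 2 * c * real k - L) / ((real k + 1) * (real k + c)))"

definition zonal :: "real \<Rightarrow> real \<Rightarrow> real \<Rightarrow> real" where
  "zonal c L s = (\<Sum>k. zcoeff c L k * s ^ k)"

definition zonal1 :: "real \<Rightarrow> real \<Rightarrow> real \<Rightarrow> real" where
  "zonal1 c L s = (\<Sum>k. diffs (zcoeff c L) k * s ^ k)"

definition zonal2 :: "real \<Rightarrow> real \<Rightarrow> real \<Rightarrow> real" where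
  "zonal2 c L s = (\<Sum>k. diffs (diffs (zcoeff c L)) k * s ^ k)"

lemma zcoeff_summable:
  assumes "c > 0" "\<bar>s\<bar> < 1"
  shows "summable (\<lambda>k. zcoeff c L k * s ^ k)"
proof -
  obtain r where r: "\<bar>s\<bar> < r" "r < 1" using assms dense by blast
  define q where "q = (\<lambda>k::nat. (real k * (real k - 1) + 2 * c * real k - L) / ((real k + 1) * (real k + c)))"
  have "q \<longlonglongrightarrow> 1" unfolding q_def using assms(1) by real_asymp
  then have "(\<lambda>k. \<bar>q k\<bar> * \<bar>s\<bar>) \<longlonglongrightarrow> \<bar>1\<bar> * \<bar>s\<bar>" by (intro tendsto_intros)
  then have "\<forall>\<^sub>F k in sequentially. \<bar>q k\<bar> * \<bar>s\<bar> < r" using r by (intro order_tendstoD(2)) auto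
  then obtain N where N: "\<And>k. k \<ge> N \<Longrightarrow> \<bar>q k\<bar> * \<bar>s\<bar> < r" by (auto simp: eventually_sequentially)
  show ?thesis
  proof (rule summable_ratio_test[of r N])
    fix k assume "N \<le> k"
    have "norm (zcoeff c L (Suc k) * s ^ Suc k) = (\<bar>q k\<bar> * \<bar>s\<bar>) * norm (zcoeff c L k * s ^ k)"
      by (simp add: q_def abs_mult power_abs)
    also have "\<dots> \<le> r * norm (zcoeff c L k * s ^ k)"
      using N[OF \<open>N \<le> k\<close>] by (intro mult_right_mono) auto
    finally show "norm (zcoeff c L (Suc k) * s ^ Suc k) \<le> r * norm (zcoeff c L k * s ^ k)" .
  qed (use r in auto)
qed

lemma diffs_summable:
  fixes a :: "nat \<Rightarrow> real"
  assumes "\<And>t. \<bar>t\<bar> < 1 \<Longrightarrow> summable (\<lambda>k. a k * t ^ k)" "\<bar>s\<bar> < 1"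
  shows "summable (\<lambda>k. diffs a k * s ^ k)"
  using termdiff_converges[of s 1 a] assms by simp

lemma smooth_on_zonal: "c > 0 \<Longrightarrow> smooth_on {-1<..<1} (zonal c L)"
  unfolding zonal_def[abs_def] by (rule smooth_on_power_series) (rule zcoeff_summable)

lemma zonal_deriv:
  assumes "c > 0" "\<bar>s\<bar> < 1"
  shows "(zonal c L has_real_derivative zonal1 c L s) (at s)"
    "(zonal1 c L has_real_derivative zonal2 c L s) (at s)"
  unfolding zonal_def[abs_def] zonal1_def[abs_def] zonal2_def
  using termdiffs_strong'[of 1 "zcoeff c L" s] termdiffs_strong'[of 1 "diffs (zcoeff c L)" s]
    zcoeff_summable[OF assms(1)] diffs_summable assms by auto

lemma diffs_sums:
  fixes a :: "nat \<Rightarrow> real"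
  assumes "summable (\<lambda>k. diffs a k * s ^ k)"
  shows "(\<lambda>k. real k * a k * s ^ k) sums (s * (\<Sum>k. diffs a k * s ^ k))"
proof -
  have "(\<lambda>k. s * (of_nat k * a k * s ^ (k - Suc 0))) sums (s * (\<Sum>k. diffs a k * s ^ k))"
    using diffs_equiv[OF assms] by (rule sums_mult)
  moreover have "s * (of_nat k * a k * s ^ (k - Suc 0)) = real k * a k * s ^ k" for k
    by (cases k) auto
  ultimately show ?thesis by simp
qed

text \<open>Each term of the equation is written as a series in s^k; the sum of the k-th
  coefficients is zero exactly by the recursion of \<open>zcoeff\<close>.\<close>

lemma zonal_ode:
  assumes c: "c > 0" and s: "\<bar>s\<bar> < 1"
  shows "s * (1 - s) * zonal2 c L s + c * (1 - 2 * s) * zonal1 c L s + L * zonal c L s = 0"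
proof -
  let ?a = "zcoeff c L"
  have sm0: "\<And>t. \<bar>t\<bar> < 1 \<Longrightarrow> summable (\<lambda>k. ?a k * t ^ k)" using zcoeff_summable[OF c] .
  have sm1: "\<And>t. \<bar>t\<bar> < 1 \<Longrightarrow> summable (\<lambda>k. diffs ?a k * t ^ k)" using diffs_summable sm0 by blast
  have sm2: "summable (\<lambda>k. diffs (diffs ?a) k * s ^ k)" using diffs_summable[of "diffs ?a"] sm1 s by blast
  have z0: "(\<lambda>k. ?a k * s ^ k) sums zonal c L s"
    unfolding zonal_def using sm0[OF s] by (rule summable_sums)
  have z1: "(\<lambda>k. real (Suc k) * ?a (Suc k) * s ^ k) sums zonal1 c L s"
    using summable_sums[OF sm1[OF s]] by (simp add: zonal1_def diffs_def)
  have z1s: "(\<lambda>k. real k * ?a k * s ^ k) sums (s * zonal1 c L s)"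
    using diffs_sums[OF sm1[OF s]] by (simp add: zonal1_def)
  have z2s: "(\<lambda>k. real k * (real (Suc k) * ?a (Suc k)) * s ^ k) sums (s * zonal2 c L s)"
    using diffs_sums[OF sm2] by (simp add: zonal2_def diffs_def)
  have z2ss: "(\<lambda>k. real k * (real k - 1) * ?a k * s ^ k) sums (s * (s * zonal2 c L s))"
  proof -
    have "(\<lambda>k. s * (real k * (real (Suc k) * ?a (Suc k)) * s ^ k)) sums (s * (s * zonal2 c L s))"
      using z2s by (rule sums_mult)
    then have "(\<lambda>k. (\<lambda>k. real k * (real k - 1) * ?a k * s ^ k) (Suc k)) sums (s * (s * zonal2 c L s))"
      by (simp add: algebra_simps)
    \<comment> \<open>The index shift is free because the term for k = 0 vanishes.\<close>
    then show ?thesis by (subst (asm) sums_Suc_iff) simp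
  qed
  have "(\<lambda>k. (real k * (real (Suc k) * ?a (Suc k)) * s ^ k) - (real k * (real k - 1) * ?a k * s ^ k)
      + c * (real (Suc k) * ?a (Suc k) * s ^ k) - 2 * c * (real k * ?a k * s ^ k) + L * (?a k * s ^ k))
    sums (s * zonal2 c L s - s * (s * zonal2 c L s) + c * zonal1 c L s - 2 * c * (s * zonal1 c L s)
      + L * zonal c L s)"
    by (intro sums_add sums_diff sums_mult z0 z1 z1s z2s z2ss)
  moreover have "(real k * (real (Suc k) * ?a (Suc k)) * s ^ k) - (real k * (real k - 1) * ?a k * s ^ k)
      + c * (real (Suc k) * ?a (Suc k) * s ^ k) - 2 * c * (real k * ?a k * s ^ k) + L * (?a k * s ^ k) = 0" for k
  proof -
    have "(real k + 1) * (real k + c) * ?a (Suc k) = ?a k * (real k * (real k - 1) + 2 * c * real k - L)"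
    proof -
      have "(real k + 1) * (real k + c) \<noteq> 0" using c by (simp add: add_nonneg_pos)
      then show ?thesis by (simp only: zcoeff.simps mult.left_commute nonzero_mult_div_cancel_left times_divide_eq_right)
          (simp add: mult.commute)
    qed
    then have "((real k + 1) * (real k + c) * ?a (Suc k)) * s ^ k
      = (?a k * (real k * (real k - 1) + 2 * c * real k - L)) * s ^ k" by simp
    then show ?thesis by (simp add: algebra_simps del: zcoeff.simps)
  qed
  ultimately have "(\<lambda>k. 0) sums (s * zonal2 c L s - s * (s * zonal2 c L s) + c * zonal1 c L s
      - 2 * c * (s * zonal1 c L s) + L * zonal c L s)" by simp
  then have "s * zonal2 c L s - s * (s * zonal2 c L s) + c * zonal1 c L s
      - 2 * c * (s * zonal1 c L s) + L * zonal c L s = 0"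
    using sums_unique2 sums_zero by blast
  then show ?thesis by (simp add: algebra_simps)
qed

section \<open>Sign, bounds and joint continuity of the zonal solutions\<close>

lemma zonal_0 [simp]: "zonal c L 0 = 1"
  by (simp add: zonal_def)

text \<open>For L \<le> 0 all factors in the recursion are nonnegative, so the constant term 1 is a
  lower bound. Zeros can therefore occur only for L > 0.\<close>

lemma zonal_ge_1:
  assumes "c > 0" "L \<le> 0" "0 \<le> s" "s < 1"
  shows "zonal c L s \<ge> 1"
proof -
  have "0 \<le> real k * (real k - 1)" for k by (cases k) auto
  then have q: "0 \<le> real k * (real k - 1) + 2 * c * real k - L" for k
    by (smt (verit) assms(1,2) mult_nonneg_nonneg of_nat_0_le_iff)
  have nn: "0 \<le> zcoeff c L k" for k
  proof (induction k)
    case (Suc k)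
    then show ?case unfolding zcoeff.simps
      using q[of k] assms by (intro mult_nonneg_nonneg divide_nonneg_nonneg) auto
  qed simp
  have "(\<Sum>k<1. zcoeff c L k * s ^ k) \<le> zonal c L s"
    unfolding zonal_def using assms nn by (intro sum_le_suminf zcoeff_summable) auto
  then show ?thesis by simp
qed

text \<open>For the parameter -M all three summands of the numerator are nonnegative, so the
  coefficients for -M majorise those for every L with |L| \<le> M.\<close>

lemma zcoeff_bound:
  assumes "c > 0" "\<bar>L\<bar> \<le> M"
  shows "\<bar>zcoeff c L k\<bar> \<le> zcoeff c (- M) k"
proof (induction k)
  case (Suc k)
  have k: "0 \<le> real k * (real k - 1)" by (cases k) auto
  have "\<bar>real k * (real k - 1) + 2 * c * real k - L\<bar> \<le> \<bar>real k * (real k - 1)\<bar> + \<bar>2 * c * real k\<bar> + \<bar>L\<bar>"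
    by linarith
  also have "\<dots> \<le> real k * (real k - 1) + 2 * c * real k + M" using k assms by simp
  finally have 1: "\<bar>real k * (real k - 1) + 2 * c * real k - L\<bar> \<le> real k * (real k - 1) + 2 * c * real k - (- M)" by simp
  have "0 < (real k + 1) * (real k + c)" using assms by simp
  then have "\<bar>(real k * (real k - 1) + 2 * c * real k - L) / ((real k + 1) * (real k + c))\<bar>
      \<le> (real k * (real k - 1) + 2 * c * real k - (- M)) / ((real k + 1) * (real k + c))"
    using 1 by (simp only: abs_divide) (simp add: divide_right_mono)
  then show ?case
    unfolding zcoeff.simps abs_mult using Suc by (intro mult_mono) auto
qed simp

text \<open>Uniform convergence by \<open>zcoeff_bound\<close>. Continuity in both variables
  together makes the set of pairs (L, s) with a nonpositive value compact, from which the first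
  eigenvalue is taken.\<close>

lemma continuous_on_zonal:
  assumes c: "c > 0" and r: "0 \<le> r" "r < 1"
  shows "continuous_on ({-M..M} \<times> {0..r}) (\<lambda>(L, s). zonal c L s)"
proof -
  let ?S = "{-M..M} \<times> {0..r}"
  have "uniform_limit ?S (\<lambda>n p. \<Sum>k<n. zcoeff c (fst p) k * snd p ^ k)
      (\<lambda>p. \<Sum>k. zcoeff c (fst p) k * snd p ^ k) sequentially"
  proof (rule Weierstrass_m_test)
    show "summable (\<lambda>k. zcoeff c (- M) k * r ^ k)" using zcoeff_summable[OF c] r by simp
    fix k and p :: "real \<times> real" assume "p \<in> ?S"
    then have p: "\<bar>fst p\<bar> \<le> M" "0 \<le> snd p" "snd p \<le> r" by auto
    have "\<bar>zcoeff c (fst p) k\<bar> * snd p ^ k \<le> zcoeff c (- M) k * r ^ k"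
      using zcoeff_bound[OF c p(1), of k] p abs_ge_zero[of "zcoeff c (fst p) k"]
      by (intro mult_mono power_mono) (auto intro: order_trans)
    then show "norm (zcoeff c (fst p) k * snd p ^ k) \<le> zcoeff c (- M) k * r ^ k"
      using p by (simp add: abs_mult)
  qed
  moreover have "continuous_on UNIV (\<lambda>L. zcoeff c L k)" for k
    using c by (induction k) (auto intro!: continuous_intros simp: add_nonneg_eq_0_iff)
  then have "continuous_on ?S (\<lambda>p. zcoeff c (fst p) k)" for k
    by (rule continuous_on_compose2) (auto intro!: continuous_intros)
  then have "\<forall>\<^sub>F n in sequentially. continuous_on ?S (\<lambda>p. \<Sum>k<n. zcoeff c (fst p) k * snd p ^ k)"
    by (intro always_eventually allI continuous_intros)
  ultimately have "continuous_on ?S (\<lambda>p. \<Sum>k. zcoeff c (fst p) k * snd p ^ k)"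
    by (intro uniform_limit_theorem) auto
  then show ?thesis by (simp add: zonal_def case_prod_beta)
qed

lemma zonal_continuous_on: "c > 0 \<Longrightarrow> continuous_on {-1<..<1} (zonal c L)"
  using smooth_on_zonal smooth_on_continuous by blast

subsection \<open>The self-adjoint form\<close>

text \<open>Multiplied by (s (1 - s))^(c - 1) the zonal equation takes Sturm-Liouville form, and
  this is the function under the outer derivative. Its vanishing at s = 0 plays the part of a
  boundary condition at the pole.\<close>

definition zflux :: "real \<Rightarrow> real \<Rightarrow> real \<Rightarrow> real" where
  "zflux c L s = s powr c * (1 - s) powr c * zonal1 c L s"

lemma zflux_0: "zflux c L 0 = 0"
  by (simp add: zflux_def)

lemma zflux_deriv:
  assumes "c > 0" "0 < s" "s < 1"
  shows "(zflux c L has_real_derivative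
    - L * (s powr (c - 1) * (1 - s) powr (c - 1)) * zonal c L s) (at s)"
proof -
  have s: "\<bar>s\<bar> < 1" using assms by simp
  have 1: "s powr c = s * s powr (c - 1)" "(1 - s) powr c = (1 - s) * (1 - s) powr (c - 1)"
    using assms by (simp_all add: powr_mult_base)
  define A B where "A = s powr (c - 1)" and "B = (1 - s) powr (c - 1)"
  have "(zflux c L has_real_derivative
      (c * A * ((1 - s) * B) - s * A * (c * B)) * zonal1 c L s + s * A * ((1 - s) * B) * zonal2 c L s) (at s)"
    unfolding zflux_def[abs_def] using assms
    by (auto intro!: derivative_eq_intros zonal_deriv[OF assms(1) s] simp: A_def B_def 1)
  also have "(c * A * ((1 - s) * B) - s * A * (c * B)) * zonal1 c L s + s * A * ((1 - s) * B) * zonal2 c L s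
      = A * B * (s * (1 - s) * zonal2 c L s + c * (1 - 2 * s) * zonal1 c L s)"
    by (simp add: algebra_simps)
  also have "s * (1 - s) * zonal2 c L s + c * (1 - 2 * s) * zonal1 c L s = - L * zonal c L s"
    using zonal_ode[OF assms(1) s, of L] by simp
  finally show ?thesis by (simp add: A_def B_def algebra_simps)
qed

lemma zflux_continuous:
  assumes "c > 0" "r < 1"
  shows "continuous_on {0..r} (zflux c L)"
proof -
  have "continuous_on {0..r} (zonal1 c L)"
    using assms(2) by (intro continuous_at_imp_continuous_on)
      (auto intro!: DERIV_isCont[OF zonal_deriv(2)[OF assms(1)]])
  moreover have "continuous_on {0..r} (\<lambda>s. s powr c)"
    using assms by (intro continuous_on_powr' continuous_intros) auto
  moreover have "continuous_on {0..r} (\<lambda>s. (1 - s) powr c)"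
    using assms by (intro continuous_on_powr' continuous_intros) auto
  ultimately show ?thesis unfolding zflux_def[abs_def] by (intro continuous_on_mult)
qed

lemma zflux_antimono:
  assumes "c > 0" "L \<ge> 0" "r < 1" "\<And>s. 0 \<le> s \<Longrightarrow> s \<le> r \<Longrightarrow> zonal c L s \<ge> 0"
    and "0 \<le> s" "s \<le> t" "t \<le> r"
  shows "zflux c L t \<le> zflux c L s"
proof (rule DERIV_nonpos_imp_decreasing_open[OF \<open>s \<le> t\<close>])
  show "continuous_on {s..t} (zflux c L)"
    using zflux_continuous[OF assms(1,3)] by (rule continuous_on_subset) (use assms in auto)
  fix x assume x: "s < x" "x < t"
  have "- L * (x powr (c - 1) * (1 - x) powr (c - 1)) * zonal c L x \<le> 0"
    using assms x by (simp add: mult_nonneg_nonneg)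
  then show "\<exists>y. (zflux c L has_real_derivative y) (at x) \<and> y \<le> 0"
    using zflux_deriv[of c x L] assms x by fastforce
qed

text \<open>The flux starts at 0, falls strictly near 0, where the solution is close to 1, and
  cannot rise afterwards as long as the solution is nonnegative.\<close>

lemma zonal1_neg:
  assumes c: "c > 0" "L > 0" "r < 1" "\<And>s. 0 \<le> s \<Longrightarrow> s \<le> r \<Longrightarrow> zonal c L s \<ge> 0"
    and s: "0 < s" "s \<le> r"
  shows "zonal1 c L s < 0"
proof -
  have "isCont (zonal c L) 0"
    using zonal_deriv(1)[OF c(1), of 0 L] by (auto intro: DERIV_isCont)
  then have "\<forall>\<^sub>F x in at 0. zonal c L x > 0"
    using order_tendstoD(1)[of "zonal c L" 1 "at 0" 0] by (simp add: isCont_def)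
  then obtain d where d: "d > 0" "\<And>x. x \<noteq> 0 \<Longrightarrow> \<bar>x\<bar> < d \<Longrightarrow> zonal c L x > 0"
    unfolding eventually_at by (auto simp: dist_real_def)
  define t where "t = min (d/2) s"
  have t: "0 < t" "t < d" "t \<le> s" "t < 1" using d s c by (auto simp: t_def)
  have "zflux c L t < zflux c L 0"
  proof (rule DERIV_neg_imp_decreasing_open[OF t(1)])
    show "continuous_on {0..t} (zflux c L)"
      using zflux_continuous[OF c(1) t(4)] .
    fix x assume x: "0 < x" "x < t"
    have "- L * (x powr (c - 1) * (1 - x) powr (c - 1)) * zonal c L x < 0"
      using c d(2)[of x] x t by (simp add: mult_pos_pos)
    then show "\<exists>y. (zflux c L has_real_derivative y) (at x) \<and> y < 0"
      using zflux_deriv[of c x L] c t x by fastforce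
  qed
  moreover have "zflux c L s \<le> zflux c L t"
    by (rule zflux_antimono[of c L r]) (use c s t in auto)
  ultimately have "zflux c L s < 0" by (simp add: zflux_0)
  then show ?thesis unfolding zflux_def using c s
    by (metis mult_nonneg_nonneg not_le powr_ge_zero)
qed

lemma zonal_strict_decreasing:
  assumes "c > 0" "L > 0" "r < 1" "\<And>s. 0 \<le> s \<Longrightarrow> s \<le> r \<Longrightarrow> zonal c L s \<ge> 0"
    and "0 \<le> s" "s < t" "t \<le> r"
  shows "zonal c L t < zonal c L s"
proof (rule DERIV_neg_imp_decreasing_open[OF \<open>s < t\<close>])
  show "continuous_on {s..t} (zonal c L)"
    using zonal_continuous_on[OF assms(1)] by (rule continuous_on_subset) (use assms in auto)
  fix x assume x: "s < x" "x < t"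
  show "\<exists>y. (zonal c L has_real_derivative y) (at x) \<and> y < 0"
    using zonal_deriv(1)[of c x L] zonal1_neg[of c L r x] assms x by force
qed

text \<open>A large L pushes the solution down to 0. If it were positive on [0, r], it would be at
  least its value at a = r/2 on [0, a], which makes the flux at a very negative; the flux stays so
  on [a, r], and the solution falls there by at least its value at a.\<close>

lemma zonal_has_zero:
  assumes c: "c > 0" and r: "0 < r" "r \<le> 1/2"
  shows "\<exists>L>0. \<exists>s\<in>{0..r}. zonal c L s \<le> 0"
proof -
  define a where "a = r / 2"
  \<comment> \<open>k bounds (1 - x)^(c - 1) from below on (0, a), K is k times the integral of x^(c
    - 1) over [0, a], and L is solved from (r - a) L K = 1, so that the fall on [a, r] is just large
    enough.\<close>
  define k where "k = (1/2::real) powr c"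
  define K where "K = k * a powr c / c"
  define L where "L = 1 / ((r - a) * K)"
  have a: "0 < a" "a < r" "r < 1" using r by (auto simp: a_def)
  have k: "0 < k" by (simp add: k_def)
  have K: "0 < K" using k a c by (simp add: K_def)
  have L: "0 < L" using K a by (simp add: L_def)
  have "zonal c L r \<le> 0" if pos: "\<And>s. 0 \<le> s \<Longrightarrow> s \<le> r \<Longrightarrow> zonal c L s > 0"
  proof -
    have nn: "\<And>s. 0 \<le> s \<Longrightarrow> s \<le> r \<Longrightarrow> zonal c L s \<ge> 0" using pos by force
    \<comment> \<open>The added term grows at most as fast as the flux falls, so H decreases from H
      0 = 0. Read at a, this is the integrated bound for the flux.\<close>
    define H where "H = (\<lambda>s. zflux c L s + L * zonal c L a * k / c * s powr c)"
    have "H a \<le> H 0"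
    proof (rule DERIV_nonpos_imp_decreasing_open[of 0 a H])
      show "0 \<le> a" using a by simp
      have "continuous_on {0..a} (\<lambda>s. s powr c)"
        using c by (intro continuous_on_powr' continuous_intros) auto
      moreover have "continuous_on {0..a} (zflux c L)"
        using zflux_continuous[OF c, of a L] a by simp
      ultimately show "continuous_on {0..a} H"
        unfolding H_def by (intro continuous_on_add continuous_on_mult continuous_on_const)
      fix x assume x: "0 < x" "x < a"
      have "(H has_real_derivative (- L * (x powr (c - 1) * (1 - x) powr (c - 1)) * zonal c L x
          + L * zonal c L a * k / c * (c * x powr (c - 1)))) (at x)"
        unfolding H_def using x a c
        by (intro derivative_intros zflux_deriv) (auto intro!: derivative_eq_intros)
      moreover have "k * zonal c L a \<le> (1 - x) powr (c - 1) * zonal c L x"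
      proof (intro mult_mono)
        have "k \<le> (1 - x) powr c" unfolding k_def using x a r c by (intro powr_mono2) (auto simp: a_def)
        also have "\<dots> = (1 - x) * (1 - x) powr (c - 1)" using x a by (simp add: powr_mult_base)
        also have "\<dots> \<le> 1 * (1 - x) powr (c - 1)" using x by (intro mult_right_mono) auto
        finally show "k \<le> (1 - x) powr (c - 1)" by simp
        show "zonal c L a \<le> zonal c L x"
          using zonal_strict_decreasing[of c L r x a] c L a nn x by (simp add: less_imp_le)
      qed (use nn a in auto)
      then have "(L * x powr (c - 1)) * (k * zonal c L a) \<le> (L * x powr (c - 1)) * ((1 - x) powr (c - 1) * zonal c L x)"
        using L by (intro mult_left_mono) auto
      then have "(- L * (x powr (c - 1) * (1 - x) powr (c - 1)) * zonal c L x
          + L * zonal c L a * k / c * (c * x powr (c - 1))) \<le> 0"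
        using c by (simp add: algebra_simps)
      ultimately show "\<exists>y. (H has_real_derivative y) (at x) \<and> y \<le> 0" by blast
    qed
    then have fa: "zflux c L a \<le> - (L * zonal c L a * K)"
      using c by (simp add: H_def zflux_0 K_def algebra_simps)
    obtain z where z: "a < z" "z < r" "zonal c L r - zonal c L a = (r - a) * zonal1 c L z"
      using MVT2[of a r "zonal c L" "zonal1 c L"] zonal_deriv(1)[OF c] a by auto
    have "zflux c L z \<le> zflux c L a"
      by (rule zflux_antimono[of c L r]) (use c L a z nn in auto)
    then have fz: "zflux c L z \<le> - (L * zonal c L a * K)" using fa by simp
    have zn: "zonal1 c L z < 0" by (rule zonal1_neg[of c L r]) (use c L a z nn in auto)
    have "z powr c * (1 - z) powr c \<le> 1 * 1"
      using z a c by (intro mult_mono powr_le1) auto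
    then have "1 * zonal1 c L z \<le> zflux c L z"
      unfolding zflux_def using zn by (intro mult_right_mono_neg) auto
    then have "zonal1 c L z \<le> - (L * zonal c L a * K)" using fz by simp
    then have "zonal c L r - zonal c L a \<le> (r - a) * - (L * zonal c L a * K)"
      unfolding z(3) using a by (intro mult_left_mono) auto
    also have "\<dots> = - zonal c L a" using a K by (simp add: L_def)
    finally show ?thesis by simp
  qed
  then show ?thesis using L r by (metis atLeastAtMost_iff less_imp_le not_le order_refl)
qed

text \<open>l is the least L \<ge> 0 for which a nonpositive value occurs on [0, r]; it exists by
  compactness. At L = l the solution is still nonnegative, hence strictly decreasing, and so its
  zero can only sit at r.\<close>

lemma first_zonal_eigenvalue:
  assumes c: "c > 0" and r: "0 < r" "r \<le> 1/2"
  obtains l where "l > 0" "zonal c l r = 0" "\<And>s. 0 \<le> s \<Longrightarrow> s < r \<Longrightarrow> zonal c l s > 0"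
    "\<And>L s. L < l \<Longrightarrow> 0 \<le> s \<Longrightarrow> s \<le> r \<Longrightarrow> zonal c L s > 0"
proof -
  obtain L0 s0 where L0: "L0 > 0" "s0 \<in> {0..r}" "zonal c L0 s0 \<le> 0"
    using zonal_has_zero[OF assms] by blast
  define J where "J = {p \<in> {0..L0} \<times> {0..r}. (\<lambda>(L, s). zonal c L s) p \<le> 0}"
  have cont: "continuous_on ({-M..M} \<times> {0..r}) (\<lambda>(L, s). zonal c L s)" for M
    using continuous_on_zonal[OF c] r by simp
  have "closed J"
    unfolding J_def by (intro continuous_on_closed_Collect_le closed_Times closed_atLeastAtMost
        continuous_on_const continuous_on_subset[OF cont[of L0]]) auto
  moreover have "bounded J"
    unfolding J_def by (rule bounded_subset[of "{0..L0} \<times> {0..r}"]) (auto intro: bounded_Times)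
  ultimately have "compact J" by (simp add: compact_eq_bounded_closed)
  then have "compact (fst ` J)" by (intro compact_continuous_image continuous_intros)
  moreover have "(L0, s0) \<in> J" using L0 by (auto simp: J_def)
  then have "fst ` J \<noteq> {}" by blast
  ultimately obtain l where l: "l \<in> fst ` J" "\<And>L. L \<in> fst ` J \<Longrightarrow> l \<le> L"
    using compact_attains_inf by metis
  then obtain s1 where s1: "(l, s1) \<in> J" by auto
  have below: "zonal c L s > 0" if "L < l" "0 \<le> s" "s \<le> r" for L s
  proof (cases "L \<le> 0")
    case True
    then show ?thesis using zonal_ge_1[OF c True that(2)] that r by simp
  next
    case False
    show ?thesis
    proof (rule ccontr)
      assume "\<not> ?thesis"
      then have "(L, s) \<in> J" using False that s1 by (auto simp: J_def)
      then show False using l(2)[of L] that by force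
    qed
  qed
  have lpos: "l > 0"
  proof (rule ccontr)
    assume "\<not> l > 0"
    then show False using zonal_ge_1[OF c, of l s1] s1 r by (auto simp: J_def)
  qed
  have nn: "zonal c l s \<ge> 0" if s: "0 \<le> s" "s \<le> r" for s
  proof (rule ccontr)
    assume "\<not> ?thesis"
    then have neg: "zonal c l s < 0" by simp
    \<comment> \<open>A negative value at L = l would persist for L slightly below l, where all
      values are positive. The maximum with 0 below keeps that L in the interval of
      continuity.\<close>
    have "continuous_on {-l..l} (\<lambda>L. (\<lambda>(L, s). zonal c L s) (L, s))"
      by (rule continuous_on_compose2[OF cont[of l]]) (use s in \<open>auto intro!: continuous_intros\<close>)
    then have "((\<lambda>L. zonal c L s) \<longlongrightarrow> zonal c l s) (at l within {-l..l})"
      using lpos by (auto simp: continuous_on)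
    then have "\<forall>\<^sub>F L in at l within {-l..l}. zonal c L s < 0"
      using neg by (rule order_tendstoD(2))
    then obtain d where d: "d > 0" "\<And>L. L \<in> {-l..l} \<Longrightarrow> L \<noteq> l \<Longrightarrow> dist L l < d \<Longrightarrow> zonal c L s < 0"
      unfolding eventually_at by auto
    define L where "L = max 0 (l - d/2)"
    have "zonal c L s < 0" using d lpos by (intro d(2)) (auto simp: L_def dist_real_def)
    moreover have "L < l" using d lpos by (auto simp: L_def)
    ultimately show False using below[of L s] s by simp
  qed
  have r1: "r < 1" using r by simp
  have "s1 = r"
  proof (rule ccontr)
    assume "s1 \<noteq> r"
    then have "zonal c l r < zonal c l s1"
      using zonal_strict_decreasing[OF c lpos r1 nn, of s1 r] s1 by (auto simp: J_def)
    then show False using nn[of r] s1 r by (auto simp: J_def)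
  qed
  then have zr: "zonal c l r = 0" using s1 nn[of r] r by (auto simp: J_def)
  have "zonal c l s > 0" if "0 \<le> s" "s < r" for s
    using zonal_strict_decreasing[OF c lpos r1 nn, of s r] that zr by simp
  then show ?thesis using that lpos zr below by blast
qed

text \<open>Sturm comparison: the Wronskian of two zonal solutions is strictly monotone before the first zero.\<close>

lemma zonal_zero_before:
  assumes c: "c > 0" and l: "0 < l" "l < L" and r: "0 < r" "r < 1"
    and pos: "\<And>s. 0 \<le> s \<Longrightarrow> s < r \<Longrightarrow> zonal c l s > 0" and zr: "zonal c l r = 0"
  obtains s where "0 < s" "s < r" "zonal c L s = 0" "\<And>t. 0 \<le> t \<Longrightarrow> t < s \<Longrightarrow> zonal c L t > 0"
proof -
  have ex: "\<exists>s\<in>{0..<r}. zonal c L s \<le> 0"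
  proof (rule ccontr)
    assume "\<not> ?thesis"
    then have posL: "\<And>s. 0 \<le> s \<Longrightarrow> s < r \<Longrightarrow> zonal c L s > 0" by force
    \<comment> \<open>Without a zero for L, W has derivative (L - l) times a positive weight times
      both solutions, so W increases from W 0 = 0. But W r is the flux for l at r, which is
      nonpositive, times a nonnegative value.\<close>
    define W where "W = (\<lambda>s. zflux c l s * zonal c L s - zonal c l s * zflux c L s)"
    have "W 0 < W r"
    proof (rule DERIV_pos_imp_increasing_open[OF r(1)])
      fix x assume x: "0 < x" "x < r"
      define Q where "Q = x powr (c - 1) * (1 - x) powr (c - 1)"
      have "(W has_real_derivative
          ((- l * Q * zonal c l x) * zonal c L x + zonal1 c L x * zflux c l x)
          - (zonal1 c l x * zflux c L x + (- L * Q * zonal c L x) * zonal c l x)) (at x)"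
        unfolding W_def Q_def using x r c
        by (intro DERIV_diff DERIV_mult zflux_deriv zonal_deriv) auto
      moreover have "((- l * Q * zonal c l x) * zonal c L x + zonal1 c L x * zflux c l x)
          - (zonal1 c l x * zflux c L x + (- L * Q * zonal c L x) * zonal c l x)
          = (L - l) * Q * (zonal c l x * zonal c L x)"
        by (simp add: zflux_def algebra_simps)
      moreover have "(L - l) * Q * (zonal c l x * zonal c L x) > 0"
        using l x r pos[of x] posL[of x] by (intro mult_pos_pos) (auto simp: Q_def)
      ultimately show "\<exists>y. (W has_real_derivative y) (at x) \<and> y > 0" by auto
    next
      have "continuous_on {0..r} (zonal c L)" for L
        using zonal_continuous_on[OF c] by (rule continuous_on_subset) (use r in auto)
      then show "continuous_on {0..r} W"
        unfolding W_def using zflux_continuous[OF c r(2)] by (intro continuous_intros) auto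
    qed
    then have W: "0 < zflux c l r * zonal c L r" by (simp add: W_def zr zflux_0)
    have "zonal c l s \<ge> 0" if "0 \<le> s" "s \<le> r" for s
      using pos[of s] zr that by (cases "s = r") auto
    then have "zonal1 c l r < 0"
      using zonal1_neg[OF c l(1) r(2), of r] r by blast
    then have f: "zflux c l r \<le> 0" unfolding zflux_def by (intro mult_nonneg_nonpos) auto
    have "zonal c L r \<ge> 0"
    proof (rule tendsto_lowerbound)
      have "isCont (zonal c L) r" using zonal_deriv(1)[OF c, of r L] r by (auto intro: DERIV_isCont)
      then show "(zonal c L \<longlongrightarrow> zonal c L r) (at_left r)"
        by (simp add: isCont_def filterlim_at_split)
      show "\<forall>\<^sub>F x in at_left r. 0 \<le> zonal c L x"
        using eventually_at_left[of 0 r] r posL by (auto intro!: exI[of _ 0] less_imp_le)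
    qed simp
    then show False using W f by (simp add: zero_less_mult_iff)
  qed
  then obtain s0 where s0: "0 \<le> s0" "s0 < r" "zonal c L s0 \<le> 0" by auto
  \<comment> \<open>The least point with a nonpositive value; positivity to its left makes the value
    there exactly 0.\<close>
  define J where "J = {s \<in> {0..s0}. zonal c L s \<le> 0}"
  have cont: "continuous_on {0..s0} (zonal c L)"
    using zonal_continuous_on[OF c] by (rule continuous_on_subset) (use s0 r in auto)
  have "closed J" unfolding J_def
    by (intro continuous_on_closed_Collect_le cont closed_atLeastAtMost continuous_on_const)
  moreover have "bounded J" unfolding J_def by (rule bounded_subset[of "{0..s0}"]) auto
  ultimately have "compact J" by (simp add: compact_eq_bounded_closed)
  moreover have "s0 \<in> J" using s0 by (simp add: J_def)
  ultimately obtain s where s: "s \<in> J" "\<And>t. t \<in> J \<Longrightarrow> s \<le> t"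
    using compact_attains_inf by (metis empty_iff)
  have s_pos: "s > 0"
  proof (rule ccontr)
    assume "\<not> s > 0"
    then have "s = 0" using s by (simp add: J_def)
    then show False using s by (simp add: J_def)
  qed
  have before: "zonal c L t > 0" if "0 \<le> t" "t < s" for t
    using s(2)[of t] s(1) that by (force simp: J_def)
  have "zonal c L s \<ge> 0"
  proof (rule tendsto_lowerbound)
    have "0 \<le> s" "s \<le> s0" using s(1) unfolding J_def by auto
    then have "\<bar>s\<bar> < 1" using s0 r by simp
    then have "isCont (zonal c L) s" using zonal_deriv(1)[OF c, of s L] DERIV_isCont by blast
    then show "(zonal c L \<longlongrightarrow> zonal c L s) (at_left s)"
      by (simp add: isCont_def filterlim_at_split)
    show "\<forall>\<^sub>F x in at_left s. 0 \<le> zonal c L x"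
      using eventually_at_left[of 0 s] s_pos before by (auto intro!: exI[of _ 0] less_imp_le)
  qed simp
  then have "zonal c L s = 0" using s by (simp add: J_def)
  moreover have "s \<le> s0" using s(1) unfolding J_def by simp
  then have "s < r" using s0 by simp
  ultimately show ?thesis using that s_pos before by blast
qed

text \<open>The numerator of the recursion vanishes at k = 1 when L = 2 c, so the series stops. On
  the sphere of dimension 2 c this is the linear function \<omega> . \<nu>, the first Dirichlet
  eigenfunction of a hemisphere.\<close>

lemma zonal_linear:
  assumes "c > 0" shows "zonal c (2 * c) s = 1 - 2 * s"
proof -
  have z: "zcoeff c (2 * c) (Suc (Suc k)) = 0" for k
  proof (induction k)
    case (Suc k)
    then show ?case by (simp only: zcoeff.simps(2)[of _ _ "Suc (Suc k)"] mult_zero_left)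
  qed simp
  have "zonal c (2 * c) s = (\<Sum>k\<in>{0, 1}. zcoeff c (2 * c) k * s ^ k)"
    unfolding zonal_def
  proof (rule suminf_finite)
    fix k :: nat assume "k \<notin> {0, 1}"
    then obtain j where "k = Suc (Suc j)" by (metis insertCI not0_implies_Suc One_nat_def)
    then show "zcoeff c (2 * c) k * s ^ k = 0" using z[of j] by (simp only: mult_zero_left)
  qed simp
  also have "\<dots> = 1 - 2 * s" using assms by simp
  finally show ?thesis .
qed

section \<open>Cones and the first cap eigenvalue\<close>

text \<open>The cosine of the angle to the axis. It is written with a power of x . x instead of the
  norm, so that smoothness and derivatives off the origin come from the chain rule for
  \<open>powr\<close>.\<close>

definition axis_cos :: "'a::euclidean_space \<Rightarrow> 'a \<Rightarrow> real" where
  "axis_cos \<nu> x = (x \<bullet> \<nu>) * (x \<bullet> x) powr (- (1/2))"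

text \<open>The variable of the zonal equation, extended to be constant along rays.\<close>

definition polar :: "'a::euclidean_space \<Rightarrow> 'a \<Rightarrow> real" where
  "polar \<nu> x = 1/2 + (- (1/2)) * axis_cos \<nu> x"

lemma axis_cos_eq: "axis_cos \<nu> x = (x \<bullet> \<nu>) / norm x"
proof -
  have "(x \<bullet> x) powr (- (1/2)) = inverse (norm x)"
    by (simp only: powr_minus powr_half_sqrt[OF inner_ge_zero] norm_eq_sqrt_inner)
  then show ?thesis unfolding axis_cos_def by (metis divide_inverse)
qed

lemma axis_cos_scale: "k > 0 \<Longrightarrow> axis_cos \<nu> (k *\<^sub>R x) = axis_cos \<nu> x"
  by (simp add: axis_cos_eq)

lemma polar_scale: "k > 0 \<Longrightarrow> polar \<nu> (k *\<^sub>R x) = polar \<nu> x"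
  by (simp add: polar_def axis_cos_scale)

lemma polar_normalize: "x \<noteq> 0 \<Longrightarrow> polar \<nu> (x /\<^sub>R norm x) = polar \<nu> x"
  by (simp add: polar_scale)

lemma axis_cos_le_1: "norm \<nu> = 1 \<Longrightarrow> \<bar>axis_cos \<nu> x\<bar> \<le> 1"
  using Cauchy_Schwarz_ineq2[of x \<nu>] by (cases "x = 0") (simp_all add: axis_cos_eq divide_le_eq)

lemma polar_bounds: assumes "norm \<nu> = 1" shows "0 \<le> polar \<nu> x" "polar \<nu> x \<le> 1"
  using axis_cos_le_1[OF assms, of x] by (auto simp: polar_def abs_le_iff)

lemma polar_less_iff: "x \<noteq> 0 \<Longrightarrow> polar \<nu> x < s \<longleftrightarrow> (1 - 2 * s) * norm x < x \<bullet> \<nu>"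
  by (auto simp: polar_def axis_cos_eq field_simps)

lemma polar_le_iff: "x \<noteq> 0 \<Longrightarrow> polar \<nu> x \<le> s \<longleftrightarrow> (1 - 2 * s) * norm x \<le> x \<bullet> \<nu>"
  by (auto simp: polar_def axis_cos_eq field_simps)

lemma polar_sphere: "norm x = 1 \<Longrightarrow> polar \<nu> x = (1 - x \<bullet> \<nu>) / 2"
  by (simp add: polar_def axis_cos_eq field_simps)

section \<open>Gradients and Laplacians of powers of the norm and of the polar variable\<close>

lemma smooth_on_inner_powr: "smooth_on (- {0}) (\<lambda>x. (x \<bullet> x) powr a)"
  by (rule smooth_on_chain[where T = "{0<..}"]) (auto intro: smooth_on_powr smooth_on_inner_self)

lemma grad_inner_powr:
  assumes "x \<noteq> 0"
  shows "grad (\<lambda>x. (x \<bullet> x) powr a) x = (2 * a * (x \<bullet> x) powr (a - 1)) *\<^sub>R x"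
proof -
  have "grad (\<lambda>x. (x \<bullet> x) powr a) x = (a * (x \<bullet> x) powr (a - 1)) *\<^sub>R grad (\<lambda>x. x \<bullet> x) x"
    using assms
    by (intro grad_chain smooth_on_differentiable[OF smooth_on_inner_self[of UNIV]])
      (auto intro!: derivative_eq_intros)
  then show ?thesis by (simp add: grad_inner_self mult_ac)
qed

lemma laplacian_inner_powr:
  assumes "(x::'a::euclidean_space) \<noteq> 0"
  shows "laplacian (\<lambda>x. (x \<bullet> x) powr a) x = 2 * a * (2 * a - 2 + real DIM('a)) * (x \<bullet> x) powr (a - 1)"
proof -
  have pos: "x \<bullet> x > 0" using assms by simp
  have e: "(x \<bullet> x) powr (a - 1) = (x \<bullet> x) * (x \<bullet> x) powr (a - 2)"
    using pos powr_mult_base[of "x \<bullet> x" "a - 2"] by simp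
  have "laplacian (\<lambda>x. (x \<bullet> x) powr a) x =
    (a * ((a - 1) * (x \<bullet> x) powr (a - 2))) * (grad (\<lambda>x. x \<bullet> x) x \<bullet> grad (\<lambda>x. x \<bullet> x) x)
    + a * (x \<bullet> x) powr (a - 1) * laplacian (\<lambda>x. x \<bullet> x) x"
  proof (rule laplacian_chain[where S = "- {0}" and T = "{0<..}" and f = "\<lambda>x. x \<bullet> x"
        and h = "\<lambda>t. t powr a" and h' = "\<lambda>t. a * t powr (a - 1)"])
    show "Ck_on 2 (\<lambda>x::'a. x \<bullet> x) (- {0})" by (intro smooth_on_C2 smooth_on_inner_self) auto
    show "((\<lambda>t. a * t powr (a - 1)) has_real_derivative a * ((a - 1) * (x \<bullet> x) powr (a - 2))) (at (x \<bullet> x))"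
      using pos by (auto intro!: derivative_eq_intros)
    show "((\<lambda>t. t powr a) has_real_derivative a * t powr (a - 1)) (at t)" if "t \<in> {0<..}" for t
      using that by (auto intro!: derivative_eq_intros)
  qed (use assms in auto)
  then show ?thesis by (simp add: grad_inner_self laplacian_inner_self e algebra_simps)
qed

lemma smooth_on_polar: "smooth_on (- {0}) (polar \<nu>)"
  unfolding polar_def[abs_def] axis_cos_def[abs_def]
  by (intro smooth_on_add smooth_on_cmult smooth_on_mult smooth_on_const smooth_on_inner
      smooth_on_inner_powr open_Compl closed_singleton)

lemma grad_polar:
  assumes "x \<noteq> 0"
  shows "grad (polar \<nu>) x =
    (- (1/2) * (x \<bullet> x) powr (- (1/2))) *\<^sub>R (\<nu> - ((x \<bullet> \<nu>) / (x \<bullet> x)) *\<^sub>R x)"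
proof -
  have pos: "x \<bullet> x > 0" using assms by simp
  have e: "(x \<bullet> x) powr (- (3/2)) = (x \<bullet> x) powr (- (1/2)) / (x \<bullet> x)"
    using pos powr_mult_base[of "x \<bullet> x" "- (3/2)"] by (simp add: field_simps)
  note d = smooth_on_differentiable[OF smooth_on_inner_powr] smooth_on_differentiable[OF smooth_on_inner[of UNIV]]
  have "grad (\<lambda>x. (x \<bullet> \<nu>) * (x \<bullet> x) powr (- (1/2))) x =
      (x \<bullet> \<nu>) *\<^sub>R grad (\<lambda>x. (x \<bullet> x) powr (- (1/2))) x + (x \<bullet> x) powr (- (1/2)) *\<^sub>R grad (\<lambda>x. x \<bullet> \<nu>) x"
    using assms by (intro grad_mult d) auto
  then have g: "grad (axis_cos \<nu>) x = (x \<bullet> x) powr (- (1/2)) *\<^sub>R (\<nu> - ((x \<bullet> \<nu>) / (x \<bullet> x)) *\<^sub>R x)"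
    by (simp add: axis_cos_def[abs_def] grad_inner_powr[OF assms] grad_inner e algebra_simps)
  have dc: "axis_cos \<nu> differentiable (at x)"
    unfolding axis_cos_def[abs_def] using assms by (intro differentiable_mult d) auto
  have "grad (polar \<nu>) x = grad (\<lambda>x. (- (1/2)) * axis_cos \<nu> x) x"
    unfolding polar_def[abs_def] using dc by (subst grad_add) auto
  also have "\<dots> = (- (1/2)) *\<^sub>R grad (axis_cos \<nu>) x"
    using grad_mult[of "\<lambda>_. - (1/2)" x "axis_cos \<nu>"] dc by simp
  finally show ?thesis by (simp add: g)
qed

text \<open>The polar variable is constant along rays. In the product of a radial power with a zonal
  function this removes the mixed term of the Laplacian.\<close>

lemma grad_polar_radial: "x \<noteq> 0 \<Longrightarrow> x \<bullet> grad (polar \<nu>) x = 0"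
  by (simp add: grad_polar inner_diff_right)

lemma inner_powr_half: "x \<noteq> 0 \<Longrightarrow> (x \<bullet> x) powr (- (1/2)) * (x \<bullet> x) powr (- (1/2)) = 1 / (x \<bullet> x)"
proof -
  assume "x \<noteq> 0"
  have "(x \<bullet> x) powr (- (1/2)) * (x \<bullet> x) powr (- (1/2)) = (x \<bullet> x) powr (- 1)"
    by (subst powr_add[symmetric]) simp
  then show ?thesis by (simp add: powr_minus_divide)
qed

text \<open>Up to the factor 1 / |x|^2 this supplies the coefficient s (1 - s) of the zonal
  equation, and \<open>laplacian_polar\<close> supplies c (1 - 2 s).\<close>

lemma grad_polar_square:
  assumes "x \<noteq> 0" "norm \<nu> = 1"
  shows "grad (polar \<nu>) x \<bullet> grad (polar \<nu>) x = polar \<nu> x * (1 - polar \<nu> x) / (x \<bullet> x)"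
proof -
  let ?r = "(x \<bullet> x) powr (- (1/2))"
  have nz: "x \<bullet> x \<noteq> 0" using assms by simp
  have \<nu>: "\<nu> \<bullet> \<nu> = 1" using assms(2) by (simp add: norm_eq_1)
  have c: "axis_cos \<nu> x * axis_cos \<nu> x = (x \<bullet> \<nu>)\<^sup>2 / (x \<bullet> x)"
  proof -
    have "axis_cos \<nu> x * axis_cos \<nu> x = (x \<bullet> \<nu>)\<^sup>2 * (?r * ?r)"
      by (simp add: axis_cos_def power2_eq_square mult_ac)
    then show ?thesis by (simp only: inner_powr_half[OF assms(1)]) simp
  qed
  have "grad (polar \<nu>) x \<bullet> grad (polar \<nu>) x = (1/4) * (?r * ?r) *
      ((\<nu> - ((x \<bullet> \<nu>) / (x \<bullet> x)) *\<^sub>R x) \<bullet> (\<nu> - ((x \<bullet> \<nu>) / (x \<bullet> x)) *\<^sub>R x))"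
    by (simp add: grad_polar[OF assms(1)])
  also have "(\<nu> - ((x \<bullet> \<nu>) / (x \<bullet> x)) *\<^sub>R x) \<bullet> (\<nu> - ((x \<bullet> \<nu>) / (x \<bullet> x)) *\<^sub>R x) = 1 - (x \<bullet> \<nu>)\<^sup>2 / (x \<bullet> x)"
    using nz by (simp add: inner_diff_left inner_diff_right \<nu> inner_commute power2_eq_square)
  also have "\<dots> = 1 - axis_cos \<nu> x * axis_cos \<nu> x" by (simp add: c)
  also have "(1/4) * (?r * ?r) * (1 - axis_cos \<nu> x * axis_cos \<nu> x) = polar \<nu> x * (1 - polar \<nu> x) / (x \<bullet> x)"
    unfolding inner_powr_half[OF assms(1)] polar_def using nz by (simp add: field_simps)
  finally show ?thesis .
qed

lemma laplacian_polar:
  assumes "(x::'a::euclidean_space) \<noteq> 0"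
  shows "laplacian (polar \<nu>) x = (real DIM('a) - 1) / 2 * (1 - 2 * polar \<nu> x) / (x \<bullet> x)"
proof -
  let ?S = "- {0::'a}"
  have S: "open ?S" "x \<in> ?S" using assms by auto
  have pos: "x \<bullet> x > 0" using assms by simp
  have e: "(x \<bullet> x) powr (- (3/2)) = (x \<bullet> x) powr (- (1/2)) / (x \<bullet> x)"
    using pos powr_mult_base[of "x \<bullet> x" "- (3/2)"] by (simp add: field_simps)
  have C: "Ck_on 2 (\<lambda>x. x \<bullet> \<nu>) ?S" "Ck_on 2 (\<lambda>x. (x \<bullet> x) powr a) ?S" for a
    by (intro smooth_on_C2 smooth_on_inner smooth_on_inner_powr)+
  have "laplacian (axis_cos \<nu>) x = (x \<bullet> \<nu>) * ((3 - real DIM('a)) * (x \<bullet> x) powr (- (3/2)))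
      + 2 * (\<nu> \<bullet> ((- ((x \<bullet> x) powr (- (3/2)))) *\<^sub>R x))"
    unfolding axis_cos_def[abs_def]
    using laplacian_mult[OF S C(1) C(2)[of "- (1/2)"]]
    by (simp add: laplacian_inner grad_inner laplacian_inner_powr[OF assms] grad_inner_powr[OF assms] algebra_simps)
  also have "\<dots> = (1 - real DIM('a)) * axis_cos \<nu> x / (x \<bullet> x)"
    by (simp add: e axis_cos_def inner_commute algebra_simps add_divide_distrib diff_divide_distrib)
  finally have l: "laplacian (axis_cos \<nu>) x = (1 - real DIM('a)) * axis_cos \<nu> x / (x \<bullet> x)" .
  have Cc: "Ck_on 2 (axis_cos \<nu>) ?S"
    unfolding axis_cos_def[abs_def] by (intro Ck_on_mult C) auto
  have "laplacian (polar \<nu>) x = laplacian (\<lambda>x. (- (1/2)) * axis_cos \<nu> x) x"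
    unfolding polar_def[abs_def]
    by (simp only: laplacian_add[OF S Ck_on_const Ck_on_mult[OF S(1) Ck_on_const Cc]] laplacian_const add_0)
  also have "\<dots> = (- (1/2)) * laplacian (axis_cos \<nu>) x" by (rule laplacian_cmult[OF S Cc])
  finally show ?thesis unfolding l polar_def using pos by (simp add: divide_simps) (simp add: algebra_simps)
qed

definition half_dim :: "'a::euclidean_space itself \<Rightarrow> real" where
  "half_dim _ = (real DIM('a) - 1) / 2"

text \<open>The cosine of the half-angle is 1 - 2 s: a half-space for s = 1/2, and for s = 1
  everything except the closed ray opposite to a unit vector \<nu>.\<close>

definition open_cone :: "'a::euclidean_space \<Rightarrow> real \<Rightarrow> 'a set" where
  "open_cone \<nu> s = {x. x \<noteq> 0 \<and> polar \<nu> x < s}"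

lemma open_open_cone: "open (open_cone \<nu> s)"
proof -
  have "open_cone \<nu> s = {x. (1 - 2 * s) * norm x < x \<bullet> \<nu>} \<inter> (- {0})"
    by (auto simp: open_cone_def polar_less_iff)
  moreover have "open {x. (1 - 2 * s) * norm x < x \<bullet> \<nu>}"
    by (intro open_Collect_less continuous_intros)
  ultimately show ?thesis by auto
qed

lemma zonal_polar:
  fixes \<nu> :: "'a::euclidean_space"
  assumes "DIM('a) \<ge> 2" "norm \<nu> = 1" and x: "x \<in> open_cone \<nu> 1"
  defines "c \<equiv> half_dim TYPE('a)"
  shows "smooth_on (open_cone \<nu> 1) (\<lambda>x. zonal c L (polar \<nu> x))"
    "laplacian (\<lambda>x. zonal c L (polar \<nu> x)) x = - L * zonal c L (polar \<nu> x) / (x \<bullet> x)"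
    "grad (\<lambda>x. zonal c L (polar \<nu> x)) x = zonal1 c L (polar \<nu> x) *\<^sub>R grad (polar \<nu>) x"
proof -
  have c: "c > 0" using assms(1) by (simp add: c_def half_dim_def)
  have r: "polar \<nu> y \<in> {-1<..<1}" if "y \<in> open_cone \<nu> 1" for y
    using polar_bounds(1)[OF assms(2), of y] that by (auto simp: open_cone_def)
  have sm: "smooth_on (open_cone \<nu> 1) (polar \<nu>)"
    using smooth_on_polar by (rule smooth_on_subset) (auto simp: open_cone_def)
  show "smooth_on (open_cone \<nu> 1) (\<lambda>x. zonal c L (polar \<nu> x))"
    by (rule smooth_on_chain[of "open_cone \<nu> 1" "{-1<..<1}" "polar \<nu>" "zonal c L",
          OF open_open_cone open_greaterThanLessThan r sm smooth_on_zonal[OF c]])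
  have x0: "x \<noteq> 0" using x by (simp add: open_cone_def)
  have p: "\<bar>polar \<nu> x\<bar> < 1" using r[OF x] by auto
  have "laplacian (\<lambda>x. zonal c L (polar \<nu> x)) x =
      zonal2 c L (polar \<nu> x) * (grad (polar \<nu>) x \<bullet> grad (polar \<nu>) x) + zonal1 c L (polar \<nu> x) * laplacian (polar \<nu>) x"
  proof (rule laplacian_chain[where S = "open_cone \<nu> 1" and T = "{-1<..<1}" and f = "polar \<nu>"
        and h = "zonal c L" and h' = "zonal1 c L", OF open_open_cone x smooth_on_C2[OF sm]])
    show "polar \<nu> y \<in> {-1<..<1}" if "y \<in> open_cone \<nu> 1" for y using r that .
    show "(zonal c L has_real_derivative zonal1 c L t) (at t)" if "t \<in> {-1<..<1}" for t
      using that by (intro zonal_deriv(1)[OF c]) auto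
    show "(zonal1 c L has_real_derivative zonal2 c L (polar \<nu> x)) (at (polar \<nu> x))"
      by (rule zonal_deriv(2)[OF c p])
  qed
  also have "\<dots> = (polar \<nu> x * (1 - polar \<nu> x) * zonal2 c L (polar \<nu> x)
      + c * (1 - 2 * polar \<nu> x) * zonal1 c L (polar \<nu> x)) / (x \<bullet> x)"
    by (simp add: grad_polar_square[OF x0 assms(2)] laplacian_polar[OF x0] c_def half_dim_def add_divide_distrib mult_ac)
  also have "polar \<nu> x * (1 - polar \<nu> x) * zonal2 c L (polar \<nu> x)
      + c * (1 - 2 * polar \<nu> x) * zonal1 c L (polar \<nu> x) = - L * zonal c L (polar \<nu> x)"
    using zonal_ode[OF c p, of L] by simp
  finally show "laplacian (\<lambda>x. zonal c L (polar \<nu> x)) x = - L * zonal c L (polar \<nu> x) / (x \<bullet> x)" .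
  show "grad (\<lambda>x. zonal c L (polar \<nu> x)) x = zonal1 c L (polar \<nu> x) *\<^sub>R grad (polar \<nu>) x"
    by (rule grad_chain[where f = "polar \<nu>" and h = "zonal c L",
          OF smooth_on_differentiable[OF sm x] zonal_deriv(1)[OF c p]])
qed

section \<open>The first Dirichlet eigenvalue of a spherical cap\<close>

lemma laplacian_le_0_at_max:
  assumes S: "open S" "x \<in> S" and h: "Ck_on 2 h S" and max: "\<And>y. y \<in> S \<Longrightarrow> h y \<le> h x"
  shows "laplacian h x \<le> 0"
proof -
  have "pd b (pd b h) x \<le> 0" if b: "b \<in> Basis" for b
  proof (rule ccontr)
    assume "\<not> ?thesis"
    then have pos: "0 < pd b (pd b h) x" by simp
    obtain e where e: "e > 0" "ball x e \<subseteq> S" using S openE by blast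
    have line: "x + t *\<^sub>R b \<in> S" if "\<bar>t\<bar> < e" for t
      using e(2) that b by (auto simp: dist_norm)
    have d1: "((\<lambda>t. h (x + t *\<^sub>R b)) has_real_derivative pd b h (x + t *\<^sub>R b)) (at t)" if "\<bar>t\<bar> < e" for t
      using Ck_on_2D(1)[OF h line[OF that]] by (rule directional_has_real_derivative)
    have d2: "((\<lambda>t. pd b h (x + t *\<^sub>R b)) has_real_derivative pd b (pd b h) x) (at 0)"
      using directional_has_real_derivative[of "pd b h" x 0 b] Ck_on_2D(2)[OF h S(2) b] by simp
    have z: "pd b h x = 0"
      using DERIV_local_max[OF d1[of 0], of e] e line max by simp
    obtain d where d: "d > 0" "\<And>t. 0 < t \<Longrightarrow> t < d \<Longrightarrow> 0 < pd b h (x + t *\<^sub>R b)"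
      using DERIV_pos_inc_right[OF d2 pos] z by auto
    define t where "t = min d e / 2"
    have t: "0 < t" "t < d" "t < e" using d e by (auto simp: t_def)
    obtain \<xi> where "0 < \<xi>" "\<xi> < t" "h (x + t *\<^sub>R b) - h (x + 0 *\<^sub>R b) = (t - 0) * pd b h (x + \<xi> *\<^sub>R b)"
      using MVT2[OF t(1), of "\<lambda>t. h (x + t *\<^sub>R b)" "\<lambda>t. pd b h (x + t *\<^sub>R b)"] d1 t by auto
    then have "h (x + t *\<^sub>R b) > h x" using mult_pos_pos[OF t(1) d(2)[of \<xi>]] t by simp
    then show False using t max[OF line[of t]] by simp
  qed
  then show ?thesis by (simp add: laplacian_def sum_nonpos)
qed

text \<open>The zonal solution for l is an eigenfunction. That no eigenvalue lies below l is Barta's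
  argument: the quotient of a smaller eigenfunction and a positive zonal solution would have an
  interior maximum that contradicts the second derivative test.\<close>

lemma first_dirichlet_eigenvalue_cap:
  fixes \<nu> :: "'a::euclidean_space"
  assumes n: "DIM('a) \<ge> 2" and \<nu>: "norm \<nu> = 1" and r: "0 < r" "r < 1"
  defines "c \<equiv> half_dim TYPE('a)"
  assumes l: "zonal c l r = 0" "\<And>L s. L < l \<Longrightarrow> 0 \<le> s \<Longrightarrow> s \<le> r \<Longrightarrow> zonal c L s > 0"
  shows "first_dirichlet_eigenvalue {\<omega> \<in> sphere 0 1. \<omega> \<bullet> \<nu> > 1 - 2 * r} = l"
proof -
  define U where "U = {\<omega> \<in> sphere 0 1. \<omega> \<bullet> \<nu> > 1 - 2 * r}"
  have c: "c > 0" using n by (simp add: c_def half_dim_def)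
  have U: "\<omega> \<in> U \<longleftrightarrow> norm \<omega> = 1 \<and> polar \<nu> \<omega> < r" for \<omega>
    by (auto simp: U_def polar_sphere)
  have cone: "{x. x \<noteq> 0 \<and> x /\<^sub>R norm x \<in> U} = open_cone \<nu> r"
    by (auto simp: U open_cone_def polar_normalize)
  have clU: "norm \<omega> = 1" "polar \<nu> \<omega> \<le> r" if "\<omega> \<in> closure U" for \<omega>
  proof -
    have "closure U \<subseteq> {\<omega>. norm \<omega> = 1 \<and> 1 - 2 * r \<le> \<omega> \<bullet> \<nu>}"
      by (intro closure_minimal closed_Collect_conj closed_Collect_eq closed_Collect_le continuous_intros)
        (auto simp: U_def)
    then show "norm \<omega> = 1" "polar \<nu> \<omega> \<le> r" using that by (auto simp: polar_sphere)
  qed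
  have sub: "open_cone \<nu> r \<subseteq> open_cone \<nu> 1" using r by (auto simp: open_cone_def)
  have Z: "smooth_on (open_cone \<nu> 1) (\<lambda>x. zonal c L (polar \<nu> x))" for L
  proof -
    have "\<nu> \<in> open_cone \<nu> 1" using \<nu> by (auto simp: open_cone_def polar_sphere norm_eq_1)
    then show ?thesis unfolding c_def by (rule zonal_polar(1)[OF n \<nu>])
  qed
  have Z2: "Ck_on 2 (\<lambda>x. zonal c L (polar \<nu> x)) (open_cone \<nu> r)" for L
    using smooth_on_subset[OF Z sub] by (rule smooth_on_C2)
  have lapZ: "laplacian (\<lambda>x. zonal c L (polar \<nu> x)) \<omega> = - L * zonal c L (polar \<nu> \<omega>)" if "\<omega> \<in> U" for L \<omega>
  proof -
    have "\<omega> \<in> open_cone \<nu> 1" "\<omega> \<bullet> \<omega> = 1" using that r by (auto simp: U open_cone_def norm_eq_1)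
    then show ?thesis using zonal_polar(2)[OF n \<nu>, of \<omega> L] by (simp add: c_def)
  qed
  have contZ: "continuous_on (closure U) (\<lambda>\<omega>. zonal c L (polar \<nu> \<omega>))" for L
    using smooth_on_continuous[OF Z] by (rule continuous_on_subset) (use clU r in \<open>fastforce simp: open_cone_def\<close>)
  have Ucone: "\<omega> \<in> open_cone \<nu> r" if "\<omega> \<in> U" for \<omega> using that by (auto simp: U open_cone_def)
  have radial: "radial_extension (\<lambda>\<omega>. zonal c L (polar \<nu> \<omega>)) x = zonal c L (polar \<nu> x)"
    if "x \<in> open_cone \<nu> r" for x L
    using that by (simp add: radial_extension_def polar_normalize open_cone_def)
  have "sphere_dirichlet_eigenvalue U l"
    unfolding sphere_dirichlet_eigenvalue_def cone
  proof (intro exI[of _ "\<lambda>\<omega>. zonal c l (polar \<nu> \<omega>)"] conjI ballI)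
    show "Ck_on 2 (radial_extension (\<lambda>\<omega>. zonal c l (polar \<nu> \<omega>))) (open_cone \<nu> r)"
      by (rule Ck_on_cong[OF open_open_cone _ Z2[of l]]) (simp add: radial)
    show "continuous_on (closure U) (\<lambda>\<omega>. zonal c l (polar \<nu> \<omega>))" by (rule contZ)
    show "zonal c l (polar \<nu> \<omega>) = 0" if "\<omega> \<in> closure U - U" for \<omega>
    proof -
      have "polar \<nu> \<omega> = r" using that clU[of \<omega>] U[of \<omega>] by force
      then show ?thesis using l(1) by simp
    qed
    show "\<exists>\<omega>\<in>U. zonal c l (polar \<nu> \<omega>) \<noteq> 0"
      using \<nu> r by (intro bexI[of _ \<nu>]) (auto simp: U polar_sphere norm_eq_1)
    show "- sphere_laplacian (\<lambda>\<omega>. zonal c l (polar \<nu> \<omega>)) \<omega> = l * zonal c l (polar \<nu> \<omega>)" if "\<omega> \<in> U" for \<omega>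
    proof -
      have "laplacian (\<lambda>x. zonal c l (polar \<nu> x)) \<omega> = laplacian (radial_extension (\<lambda>\<omega>. zonal c l (polar \<nu> \<omega>))) \<omega>"
        by (rule laplacian_transform[OF open_open_cone Ucone[OF that] Z2]) (simp add: radial)
      then show ?thesis using lapZ[OF that, of l] by (simp add: sphere_laplacian_def)
    qed
  qed
  moreover have "l \<le> \<mu>" if "sphere_dirichlet_eigenvalue U \<mu>" for \<mu>
  proof (rule ccontr)
    assume "\<not> l \<le> \<mu>"
    \<comment> \<open>The solution for l itself vanishes on the boundary of the cap. An intermediate
      L gives a comparison function that is positive on the closed cap, so one may divide by
      it.\<close>
    then obtain L where L: "\<mu> < L" "L < l" using dense not_le by metis
    from that obtain f \<omega>0 where f: "Ck_on 2 (radial_extension f) (open_cone \<nu> r)"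
      "continuous_on (closure U) f" "\<And>\<omega>. \<omega> \<in> closure U - U \<Longrightarrow> f \<omega> = 0" "\<omega>0 \<in> U" "f \<omega>0 \<noteq> 0"
      "\<And>\<omega>. \<omega> \<in> U \<Longrightarrow> - sphere_laplacian f \<omega> = \<mu> * f \<omega>"
      unfolding sphere_dirichlet_eigenvalue_def cone by blast
    \<comment> \<open>The sign makes the quotient positive somewhere; since f vanishes on the
      relative boundary, the maximum is attained inside.\<close>
    define \<sigma> where "\<sigma> = sgn (f \<omega>0)"
    define \<phi> where "\<phi> = (\<lambda>\<omega>. zonal c L (polar \<nu> \<omega>))"
    have \<phi>: "\<phi> \<omega> > 0" if "\<omega> \<in> closure U" for \<omega>
      unfolding \<phi>_def using clU[OF that] polar_bounds(1)[OF \<nu>] L by (intro l(2)) auto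
    have U_cl: "U \<subseteq> closure U" by (rule closure_subset)
    have "bounded U" by (rule bounded_subset[of "sphere 0 1"]) (auto simp: U_def)
    then have "compact (closure U)" by (simp add: compact_closure)
    moreover have "continuous_on (closure U) (\<lambda>\<omega>. \<sigma> * f \<omega> / \<phi> \<omega>)"
      using f(2) contZ[of L] \<phi> unfolding \<phi>_def by (intro continuous_intros) force+
    moreover have "closure U \<noteq> {}" using f(4) U_cl by auto
    ultimately obtain \<omega>1 where \<omega>1: "\<omega>1 \<in> closure U"
      "\<And>\<omega>. \<omega> \<in> closure U \<Longrightarrow> \<sigma> * f \<omega> / \<phi> \<omega> \<le> \<sigma> * f \<omega>1 / \<phi> \<omega>1"
      using continuous_attains_sup[of "closure U" "\<lambda>\<omega>. \<sigma> * f \<omega> / \<phi> \<omega>"] by blast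
    define M where "M = \<sigma> * f \<omega>1 / \<phi> \<omega>1"
    have "0 < \<sigma> * f \<omega>0 / \<phi> \<omega>0"
      using f(4,5) \<phi> U_cl by (intro divide_pos_pos) (auto simp: \<sigma>_def sgn_if)
    then have M: "0 < M" using \<omega>1(2)[of \<omega>0] f(4) U_cl unfolding M_def by fastforce
    then have \<omega>1U: "\<omega>1 \<in> U" using f(3)[of \<omega>1] \<omega>1(1) unfolding M_def by fastforce
    have le: "\<sigma> * f \<omega> \<le> M * \<phi> \<omega>" if "\<omega> \<in> U" for \<omega>
      using \<omega>1(2)[of \<omega>] \<phi>[of \<omega>] that U_cl by (auto simp: M_def[symmetric] pos_divide_le_eq)
    have eq: "\<sigma> * f \<omega>1 = M * \<phi> \<omega>1" using \<phi>[OF \<omega>1(1)] by (simp add: M_def)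
    \<comment> \<open>Both terms are constant along rays, so the maximum of the quotient over the
      cap makes D maximal, with value 0, at \<omega>1 in the whole open cone, where the Euclidean
      second derivative test applies.\<close>
    define D where "D = (\<lambda>x. \<sigma> * radial_extension f x + (- M) * \<phi> x)"
    have \<phi>2: "Ck_on 2 \<phi> (open_cone \<nu> r)" unfolding \<phi>_def by (rule Z2)
    note S = open_open_cone Ucone[OF \<omega>1U]
    have rf: "radial_extension f \<omega>1 = f \<omega>1" using \<omega>1U by (simp add: radial_extension_def U)
    have D2: "Ck_on 2 D (open_cone \<nu> r)"
      unfolding D_def by (intro Ck_on_add Ck_on_mult Ck_on_const f(1) \<phi>2 open_open_cone)
    have "laplacian D \<omega>1 \<le> 0"
    proof (rule laplacian_le_0_at_max[OF S D2])
      fix y assume y: "y \<in> open_cone \<nu> r"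
      then have "y /\<^sub>R norm y \<in> U" using cone by blast
      from le[OF this] have "D y \<le> 0"
        using y by (simp add: D_def radial_extension_def \<phi>_def polar_normalize open_cone_def)
      then show "D y \<le> D \<omega>1" using eq rf by (simp add: D_def)
    qed
    moreover have "laplacian D \<omega>1 = \<sigma> * laplacian (radial_extension f) \<omega>1 + (- M) * laplacian \<phi> \<omega>1"
      unfolding D_def
      by (simp only: laplacian_add[OF S Ck_on_mult[OF S(1) Ck_on_const f(1)] Ck_on_mult[OF S(1) Ck_on_const \<phi>2]]
          laplacian_cmult[OF S f(1)] laplacian_cmult[OF S \<phi>2])
    moreover have "laplacian (radial_extension f) \<omega>1 = - \<mu> * f \<omega>1"
      using f(6)[OF \<omega>1U] by (simp add: sphere_laplacian_def)
    moreover have "laplacian \<phi> \<omega>1 = - L * \<phi> \<omega>1" unfolding \<phi>_def by (rule lapZ[OF \<omega>1U])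
    ultimately have "(L - \<mu>) * (M * \<phi> \<omega>1) \<le> 0" using eq by (simp add: algebra_simps)
    moreover have "0 < (L - \<mu>) * (M * \<phi> \<omega>1)" using L M \<phi>[OF \<omega>1(1)] by simp
    ultimately show False by simp
  qed
  ultimately show ?thesis
    unfolding first_dirichlet_eigenvalue_def U_def[symmetric] by (rule Least_equality)
qed

section \<open>The barrier\<close>

lemma pd_shift:
  fixes f :: "'a::euclidean_space \<Rightarrow> real"
  assumes "\<And>x. f differentiable (at x)"
  shows "(\<lambda>x. f (x - y)) differentiable (at x)" "pd b (\<lambda>x. f (x - y)) x = pd b f (x - y)"
proof -
  have 1: "((\<lambda>x. x - y) has_derivative (\<lambda>v. v)) (at x)" by (auto intro!: derivative_eq_intros)
  have 2: "(f has_derivative frechet_derivative f (at (x - y))) (at (x - y))"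
    using assms frechet_derivative_works by blast
  from has_derivative_compose[OF 1 2]
  have 3: "((\<lambda>x. f (x - y)) has_derivative frechet_derivative f (at (x - y))) (at x)" by simp
  show "(\<lambda>x. f (x - y)) differentiable (at x)" using 3 differentiable_def by blast
  show "pd b (\<lambda>x. f (x - y)) x = pd b f (x - y)" using frechet_derivative_at[OF 3] by metis
qed

lemma Ck_on_shift:
  fixes f :: "'a::euclidean_space \<Rightarrow> real"
  shows "Ck_on k f UNIV \<Longrightarrow> Ck_on k (\<lambda>x. f (x - y)) UNIV"
proof (induction k arbitrary: f)
  case 0
  have "continuous_on UNIV (\<lambda>x. f (x - y))"
    by (rule continuous_on_compose2[of UNIV f]) (use 0 in \<open>auto intro!: continuous_intros\<close>)
  then show ?case by simp
next
  case (Suc k)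
  then have d: "\<And>x. f differentiable (at x)" by simp
  have "Ck_on k (\<lambda>x. pd b f (x - y)) UNIV" if "b \<in> Basis" for b
    by (rule Suc.IH[of "pd b f"]) (use Suc.prems that in simp)
  then show ?case using pd_shift[OF d] by simp
qed

lemma smooth_on_shift: "smooth_on UNIV f \<Longrightarrow> smooth_on UNIV (\<lambda>x. f (x - y))"
  by (simp add: smooth_on_def Ck_on_shift)

lemma laplacian_shift:
  assumes "smooth_on UNIV f" shows "laplacian (\<lambda>x. f (x - y)) x = laplacian f (x - y)"
proof -
  have "pd b (pd b (\<lambda>x. f (x - y))) x = pd b (pd b f) (x - y)" if b: "b \<in> Basis" for b
  proof -
    have "pd b (\<lambda>x. f (x - y)) = (\<lambda>x. pd b f (x - y))"
      using pd_shift(2)[OF smooth_on_differentiable[OF assms UNIV_I]] by blast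
    then show ?thesis
      using pd_shift(2)[OF smooth_on_differentiable[OF smooth_on_pd[OF assms b] UNIV_I]] by simp
  qed
  then show ?thesis by (simp add: laplacian_def)
qed

text \<open>At the origin \<open>polar\<close> takes the default value 1/2, so the apex is excluded
  explicitly.\<close>

definition closed_sector :: "'a::euclidean_space \<Rightarrow> real \<Rightarrow> real \<Rightarrow> 'a set" where
  "closed_sector \<nu> s R = {z. z \<noteq> 0 \<and> norm z \<le> R \<and> polar \<nu> z \<le> s}"

text \<open>
  With the first zero \<open>s\<close> of the zonal solution, \<open>\<bar>x\<bar>\<^sup>\<alpha> zonal(polar x)\<close> is harmonic in the cone
  \<open>polar x < s\<close> and vanishes on its boundary. Subtracting a multiple of \<open>\<bar>x\<bar>\<^bsup>\<alpha>+2\<^esup>\<close> makes it negative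
  outside a ball, at the cost of a bounded negative Laplacian; a convex cut-off makes the support compact.
\<close>

lemma cone_barrier:
  fixes \<nu> :: "'a::euclidean_space"
  assumes n: "DIM('a) \<ge> 2" and \<nu>: "norm \<nu> = 1" and \<alpha>: "\<alpha> > 0" and s: "0 < s" "s < 1" and R: "R > 0"
  defines "c \<equiv> half_dim TYPE('a)" and "L \<equiv> \<alpha> * (\<alpha> + real DIM('a) - 2)"
  assumes zs: "zonal c L s = 0" "\<And>t. 0 \<le> t \<Longrightarrow> t < s \<Longrightarrow> zonal c L t > 0"
  obtains k where "k > 0"
    "\<And>t. 0 < t \<Longrightarrow> t \<le> R / 2 \<Longrightarrow> \<exists>w. test_function (closed_sector \<nu> s R) w \<and>
        (\<forall>x. laplacian w x \<ge> -1) \<and> w (t *\<^sub>R \<nu>) \<ge> k * t powr \<alpha>"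
proof -
  \<comment> \<open>m is half of \<alpha> because powers are taken of x . x. K makes Z - K |x|^2
    negative for |x| > R, as Z \<le> 1 in the cone. C bounds the negative Laplacian of V within
    radius R.\<close>
  define m where "m = \<alpha> / 2"
  define K where "K = 1 / R\<^sup>2"
  define C where "C = K * (\<alpha> + 2) * (\<alpha> + real DIM('a)) * R powr \<alpha>"
  define A where "A = open_cone \<nu> s"
  define Z where "Z = (\<lambda>x. zonal c L (polar \<nu> x))"
  define V where "V = (\<lambda>x. (x \<bullet> x) powr m * Z x + (- K) * (x \<bullet> x) powr (m + 1))"
  have c: "c > 0" using n by (simp add: c_def half_dim_def)
  have Lp: "L > 0" using n \<alpha> by (simp add: L_def)
  have K: "K > 0" and C: "C > 0" using R \<alpha> n by (auto simp: K_def C_def)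
  have oA: "open A" unfolding A_def by (rule open_open_cone)
  have A1: "A \<subseteq> open_cone \<nu> 1" "A \<subseteq> - {0}" using s by (auto simp: A_def open_cone_def)
  have nn: "zonal c L t \<ge> 0" if "0 \<le> t" "t \<le> s" for t
    using zs(1) zs(2)[of t] that by (cases "t = s") auto
  have z_le: "zonal c L t \<le> 1" if "0 \<le> t" "t \<le> s" for t
    using zonal_strict_decreasing[OF c Lp s(2) nn, of 0 t] that by (cases "t = 0") auto
  have p0: "0 \<le> polar \<nu> x" for x by (rule polar_bounds(1)[OF \<nu>])
  have powr_norm: "(x \<bullet> x) powr m = norm x powr \<alpha>" for x :: 'a
  proof -
    have "(x \<bullet> x) powr m = (norm x powr 2) powr m"
      by (cases "x = 0") (simp_all add: dot_square_norm powr_numeral)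
    also have "\<dots> = norm x powr (2 * m)" by (rule powr_powr)
    finally show ?thesis by (simp add: m_def)
  qed
  have V_eq: "V x = norm x powr \<alpha> * (Z x - K * (norm x)\<^sup>2)" if "x \<noteq> 0" for x
  proof -
    have "(x \<bullet> x) powr (m + 1) = (x \<bullet> x) powr m * (norm x)\<^sup>2"
      using that by (simp add: powr_add dot_square_norm)
    then show ?thesis by (simp add: V_def powr_norm algebra_simps)
  qed
  have sm: "smooth_on A Z" "smooth_on A (\<lambda>x. (x \<bullet> x) powr a)" for a
  proof -
    have "\<nu> \<in> open_cone \<nu> 1" using \<nu> by (auto simp: open_cone_def polar_sphere norm_eq_1)
    then have "smooth_on (open_cone \<nu> 1) Z" unfolding Z_def c_def by (rule zonal_polar(1)[OF n \<nu>])
    then show "smooth_on A Z" using A1(1) by (rule smooth_on_subset)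
    show "smooth_on A (\<lambda>x. (x \<bullet> x) powr a)"
      using smooth_on_inner_powr A1(2) by (rule smooth_on_subset)
  qed
  have smV: "smooth_on A V"
    unfolding V_def by (intro smooth_on_add smooth_on_mult smooth_on_cmult sm oA)
  have lapV: "laplacian V x = - K * (\<alpha> + 2) * (\<alpha> + real DIM('a)) * norm x powr \<alpha>" if x: "x \<in> A" for x
  proof -
    have x0: "x \<noteq> 0" and x1: "x \<in> open_cone \<nu> 1" using x A1 by auto
    have pos: "x \<bullet> x > 0" using x0 by simp
    note S = oA x
    have \<alpha>m: "\<alpha> = 2 * m" by (simp add: m_def)
    have e: "(x \<bullet> x) powr m = (x \<bullet> x) * (x \<bullet> x) powr (m - 1)"
      using pos powr_mult_base[of "x \<bullet> x" "m - 1"] by simp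
    have lZ: "laplacian Z x = - L * Z x / (x \<bullet> x)" "grad Z x = zonal1 c L (polar \<nu> x) *\<^sub>R grad (polar \<nu>) x"
      using zonal_polar(2,3)[OF n \<nu> x1] by (simp_all add: Z_def c_def)
    have "laplacian (\<lambda>x. (x \<bullet> x) powr m * Z x) x = (x \<bullet> x) powr m * laplacian Z x +
        2 * (grad (\<lambda>x. (x \<bullet> x) powr m) x \<bullet> grad Z x) + Z x * laplacian (\<lambda>x. (x \<bullet> x) powr m) x"
      by (intro laplacian_mult[OF S] smooth_on_C2 sm)
    \<comment> \<open>The radial power contributes \<alpha> (\<alpha> + n - 2) and the angular part
      -L, with the same factor; the mixed term is zero by \<open>grad_polar_radial\<close>.\<close>
    also have "\<dots> = 0"
      unfolding lZ laplacian_inner_powr[OF x0] grad_inner_powr[OF x0] e L_def \<alpha>m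
      using pos by (simp add: grad_polar_radial x0)
    finally have l1: "laplacian (\<lambda>x. (x \<bullet> x) powr m * Z x) x = 0" .
    have l2: "laplacian (\<lambda>x. (- K) * (x \<bullet> x) powr (m + 1)) x = - K * (\<alpha> + 2) * (\<alpha> + real DIM('a)) * norm x powr \<alpha>"
    proof -
      have "laplacian (\<lambda>x. (- K) * (x \<bullet> x) powr (m + 1)) x = (- K) * laplacian (\<lambda>x. (x \<bullet> x) powr (m + 1)) x"
        by (intro laplacian_cmult[OF S] smooth_on_C2 sm)
      then show ?thesis using powr_norm[of x] by (simp add: laplacian_inner_powr[OF x0] m_def algebra_simps)
    qed
    have "laplacian V x = laplacian (\<lambda>x. (x \<bullet> x) powr m * Z x) x + laplacian (\<lambda>x. (- K) * (x \<bullet> x) powr (m + 1)) x"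
      unfolding V_def by (intro laplacian_add[OF S] smooth_on_C2 smooth_on_mult smooth_on_cmult sm oA)
    then show ?thesis by (simp only: l1 l2 add_0)
  qed
  have V_bounds: "V x \<le> norm x powr \<alpha>" "0 < V x \<Longrightarrow> norm x < R" if "x \<noteq> 0" "polar \<nu> x \<le> s" for x
  proof -
    have Z: "Z x \<le> 1" using z_le[OF p0 that(2)] by (simp add: Z_def)
    have q: "0 < norm x powr \<alpha>" using that by simp
    have "V x \<le> norm x powr \<alpha> * 1"
      unfolding V_eq[OF that(1)] using Z mult_nonneg_nonneg[OF less_imp_le[OF K] zero_le_power2[of "norm x"]]
      by (intro mult_left_mono) auto
    then show "V x \<le> norm x powr \<alpha>" by simp
    assume "0 < V x"
    then have "K * (norm x)\<^sup>2 < Z x" unfolding V_eq[OF that(1)] using q by (simp add: zero_less_mult_iff)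
    then have "K * (norm x)\<^sup>2 < 1" using Z by linarith
    then have "(norm x)\<^sup>2 < R\<^sup>2" using R by (simp add: K_def field_simps)
    then show "norm x < R" using R power2_less_imp_less[of "norm x" R] by simp
  qed
  \<comment> \<open>On the axis, t \<le> R/2 leaves V at least 3/4 of t^\<alpha>, and the level
    \<epsilon> is half of V there, hence 3/8. The factor exp(-1) is the value of
    \<open>soft_pos\<close> at 1.\<close>
  define k where "k = 3/8 * exp (-1) / C"
  have "\<exists>w. test_function (closed_sector \<nu> s R) w \<and> (\<forall>x. laplacian w x \<ge> -1) \<and> w (t *\<^sub>R \<nu>) \<ge> k * t powr \<alpha>"
    if t: "0 < t" "t \<le> R / 2" for t
  proof -
    define \<epsilon> where "\<epsilon> = V (t *\<^sub>R \<nu>) / 2"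
    have \<nu>0: "\<nu> \<noteq> 0" using \<nu> by auto
    have pt: "polar \<nu> (t *\<^sub>R \<nu>) = 0" using t \<nu> by (simp add: polar_scale polar_sphere norm_eq_1)
    have "K * t\<^sup>2 \<le> K * (R / 2)\<^sup>2" using K t by (intro mult_left_mono power_mono) auto
    also have "\<dots> = 1/4" using R by (simp add: K_def power_divide)
    finally have "t powr \<alpha> * (3/4) \<le> t powr \<alpha> * (1 - K * t\<^sup>2)" by (intro mult_left_mono) auto
    also have "\<dots> = V (t *\<^sub>R \<nu>)" using t \<nu> \<nu>0 pt by (simp add: V_eq Z_def)
    finally have \<epsilon>t: "3/8 * t powr \<alpha> \<le> \<epsilon>" by (simp add: \<epsilon>_def)
    then have \<epsilon>: "\<epsilon> > 0" using t by (auto intro: less_le_trans[of 0 "3/8 * t powr \<alpha>"])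
    \<comment> \<open>A cut at the level \<epsilon>: w vanishes where V \<le> \<epsilon> and has
      slope at most 1/C as a function of V above. The set where V \<ge> \<epsilon> is compact inside
      the open cone, so w extends by 0 across the sides and the apex.\<close>
    define w where "w = (\<lambda>x. if x \<in> A then (\<epsilon> / C) * soft_pos (V x / \<epsilon> - 1) else 0)"
    \<comment> \<open>In the closed cone V \<le> |x|^\<alpha>, so V \<ge> \<epsilon> forces |x|
      \<ge> \<delta>. This confines the support to D, which avoids the apex and on which V is
      continuous.\<close>
    define \<delta> where "\<delta> = \<epsilon> powr (1/\<alpha>)"
    define D where "D = {x. \<delta> \<le> norm x \<and> (1 - 2 * s) * norm x \<le> x \<bullet> \<nu>}"
    define K' where "K' = {x \<in> D. \<epsilon> \<le> V x}"
    have \<delta>: "\<delta> > 0" using \<epsilon> by (simp add: \<delta>_def)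
    have D: "x \<noteq> 0" "polar \<nu> x \<le> s" if "x \<in> D" for x
    proof -
      show "x \<noteq> 0" using that \<delta> by (auto simp: D_def)
      then show "polar \<nu> x \<le> s" using that by (simp add: D_def polar_le_iff)
    qed
    have polar_D: "-1 < polar \<nu> x" "polar \<nu> x < 1" if "x \<in> D" for x
      using D(2)[OF that] p0[of x] s by auto
    have "continuous_on D V"
    proof -
      have "continuous_on D (\<lambda>x. (x \<bullet> x) powr a)" for a
        using smooth_on_continuous[OF smooth_on_inner_powr] by (rule continuous_on_subset) (use D in auto)
      moreover have "continuous_on D (polar \<nu>)"
        using smooth_on_continuous[OF smooth_on_polar] by (rule continuous_on_subset) (use D in auto)
      then have "continuous_on D Z"
        unfolding Z_def by (rule continuous_on_compose2[OF zonal_continuous_on[OF c]])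
          (use polar_D in auto)
      ultimately show ?thesis unfolding V_def by (intro continuous_on_add continuous_on_mult continuous_on_const)
    qed
    moreover have "closed D"
      unfolding D_def by (intro closed_Collect_conj closed_Collect_le continuous_intros)
    ultimately have "closed K'"
      unfolding K'_def by (intro continuous_on_closed_Collect_le continuous_on_const)
    moreover have KR: "norm x < R" if "x \<in> K'" for x
      using V_bounds(2)[of x] that \<epsilon> D[of x] by (simp add: K'_def)
    then have "bounded K'" by (intro boundedI[of K' R]) (auto intro: less_imp_le)
    ultimately have cK': "compact K'" by (simp add: compact_eq_bounded_closed)
    have K'S: "K' \<subseteq> closed_sector \<nu> s R"
      using KR D by (auto simp: closed_sector_def K'_def intro: less_imp_le)
    have K'A: "K' \<subseteq> A"
    proof
      fix x assume x: "x \<in> K'"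
      then have xD: "x \<noteq> 0" "polar \<nu> x \<le> s" using D by (auto simp: K'_def)
      have "polar \<nu> x \<noteq> s"
      proof
        assume "polar \<nu> x = s"
        then have "V x = - (norm x powr \<alpha> * (K * (norm x)\<^sup>2))" using V_eq[OF xD(1)] zs(1) by (simp add: Z_def)
        moreover have "0 \<le> norm x powr \<alpha> * (K * (norm x)\<^sup>2)" using K by simp
        ultimately show False using x \<epsilon> by (simp add: K'_def)
      qed
      then show "x \<in> A" using xD by (simp add: A_def open_cone_def)
    qed
    have V_small: "V x < \<epsilon>" if "x \<in> A" "x \<notin> K'" for x
    proof (rule ccontr)
      assume "\<not> V x < \<epsilon>"
      then have e: "\<epsilon> \<le> V x" by simp
      have x: "x \<noteq> 0" "polar \<nu> x \<le> s" using that by (auto simp: A_def open_cone_def)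
      have "\<epsilon> \<le> norm x powr \<alpha>" using V_bounds(1)[OF x] e by simp
      then have "\<delta> \<le> (norm x powr \<alpha>) powr (1/\<alpha>)" unfolding \<delta>_def using \<epsilon> \<alpha> by (intro powr_mono2) auto
      also have "\<dots> = norm x" using \<alpha> x by (simp add: powr_powr)
      finally have "x \<in> D" using x by (simp add: D_def polar_le_iff)
      then show False using that e by (simp add: K'_def)
    qed
    have w0: "w x = 0" if "x \<notin> K'" for x
    proof (cases "x \<in> A")
      case True
      then have "V x / \<epsilon> - 1 \<le> 0" using V_small[OF True that] \<epsilon> by (simp add: field_simps)
      then show ?thesis by (simp add: w_def soft_pos_def flat_simps(1))
    qed (simp add: w_def)
    define h where "h = (\<lambda>v. (\<epsilon> / C) * soft_pos (v / \<epsilon> - 1))"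
    define h' where "h' = (\<lambda>v. (1 / C) * soft_pos' (v / \<epsilon> - 1))"
    define h'' where "h'' = (\<lambda>v. (1 / (C * \<epsilon>)) * soft_pos'' (v / \<epsilon> - 1))"
    have wA: "w x = h (V x)" if "x \<in> A" for x using that by (simp add: w_def h_def)
    have aff: "((\<lambda>v. v / \<epsilon> - 1) has_real_derivative 1 / \<epsilon>) (at v)" for v
      using \<epsilon> by (auto intro!: derivative_eq_intros)
    have dh: "(h has_real_derivative h' v) (at v)" for v
    proof -
      have "((\<lambda>v. soft_pos (v / \<epsilon> - 1)) has_real_derivative soft_pos' (v / \<epsilon> - 1) * (1 / \<epsilon>)) (at v)"
        by (rule DERIV_chain2[OF soft_pos_deriv aff])
      then have "(h has_real_derivative (\<epsilon> / C) * (soft_pos' (v / \<epsilon> - 1) * (1 / \<epsilon>))) (at v)"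
        unfolding h_def by (rule DERIV_cmult)
      then show ?thesis using \<epsilon> by (simp add: h'_def)
    qed
    have dh': "(h' has_real_derivative h'' v) (at v)" for v
    proof -
      have "((\<lambda>v. soft_pos' (v / \<epsilon> - 1)) has_real_derivative soft_pos'' (v / \<epsilon> - 1) * (1 / \<epsilon>)) (at v)"
        by (rule DERIV_chain2[OF soft_pos'_deriv aff])
      then have "(h' has_real_derivative (1 / C) * (soft_pos'' (v / \<epsilon> - 1) * (1 / \<epsilon>))) (at v)"
        unfolding h'_def by (rule DERIV_cmult)
      then show ?thesis by (simp add: h''_def)
    qed
    have "smooth_on UNIV (\<lambda>v. (1 / \<epsilon>) * v + (-1))"
      by (intro smooth_on_add smooth_on_cmult smooth_on_const smooth_on_bounded_linear bounded_linear_ident open_UNIV)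
    then have "smooth_on UNIV (\<lambda>v. v / \<epsilon> - 1)" by simp
    then have "smooth_on UNIV (\<lambda>v. soft_pos (v / \<epsilon> - 1))"
      using smooth_on_chain[of UNIV UNIV "\<lambda>v. v / \<epsilon> - 1" soft_pos] smooth_on_soft_pos by simp
    then have smh: "smooth_on UNIV h" unfolding h_def by (intro smooth_on_cmult open_UNIV)
    have "smooth_on A (\<lambda>x. h (V x))"
      using smooth_on_chain[OF oA open_UNIV _ smV smh] by simp
    then have smw_A: "smooth_on A w" by (rule smooth_on_cong[OF oA]) (simp add: wA)
    have oK': "open (- K')" using cK' compact_imp_closed by auto
    have smw_K: "smooth_on (- K') w"
      by (rule smooth_on_cong[OF oK' smooth_on_const[of _ 0]]) (simp add: w0)
    \<comment> \<open>Smoothness holds on the open cone by composition and off the compact set K'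
      because w is 0 there; as K' lies in the cone, the two open sets cover the space.\<close>
    have UN: "A \<union> (- K') = UNIV" using K'A by blast
    have smw: "smooth_on UNIV w" using smooth_on_Un[OF oA oK' smw_A smw_K] UN by simp
    have lapw: "laplacian w x \<ge> -1" for x
    proof (cases "x \<in> A")
      case False
      then have x: "x \<in> - K'" using K'A by blast
      have "laplacian (\<lambda>_. 0) x = laplacian w x"
        by (rule laplacian_transform[OF oK' x Ck_on_const]) (simp add: w0)
      then show ?thesis by simp
    next
      case True
      have "laplacian w x = laplacian (\<lambda>x. h (V x)) x"
        by (rule laplacian_transform[OF oA True smooth_on_C2[OF smw_A]]) (simp add: wA)
      also have "\<dots> = h'' (V x) * (grad V x \<bullet> grad V x) + h' (V x) * laplacian V x"
        by (rule laplacian_chain[OF oA True smooth_on_C2[OF smV], where T = UNIV and h = h and h' = h']) (use dh dh' in auto)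
      \<comment> \<open>The discarded term is nonnegative by convexity. What remains matters only
        where V > \<epsilon>; there |x| < R, so the Laplacian of V is at least -C, while h' \<le>
        1/C.\<close>
      also have "\<dots> \<ge> h' (V x) * laplacian V x"
        using soft_pos''_nonneg \<epsilon> C by (simp add: h''_def)
      finally have 1: "h' (V x) * laplacian V x \<le> laplacian w x" .
      have h'b: "0 \<le> h' (V x)" "h' (V x) \<le> 1 / C"
        using soft_pos'_bounds[of "V x / \<epsilon> - 1"] C by (auto simp: h'_def divide_right_mono)
      show ?thesis
      proof (cases "V x \<le> \<epsilon>")
        case True
        then have "h' (V x) = 0" using \<epsilon> by (simp add: h'_def soft_pos'_def field_simps)
        then show ?thesis using 1 by simp
      next
        case False
        then have "norm x < R" using V_bounds(2)[of x] \<epsilon> \<open>x \<in> A\<close> by (auto simp: A_def open_cone_def)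
        then have "norm x powr \<alpha> \<le> R powr \<alpha>" using \<alpha> by (intro powr_mono2) auto
        then have "(K * (\<alpha> + 2) * (\<alpha> + real DIM('a))) * norm x powr \<alpha> \<le> C"
          unfolding C_def using K \<alpha> by (intro mult_left_mono) auto
        then have "- C \<le> laplacian V x" using lapV[OF \<open>x \<in> A\<close>] by simp
        then have "h' (V x) * (- C) \<le> h' (V x) * laplacian V x" using h'b by (intro mult_left_mono) auto
        moreover have "(1 / C) * (- C) \<le> h' (V x) * (- C)" using h'b C by (intro mult_right_mono_neg) auto
        ultimately show ?thesis using 1 C by simp
      qed
    qed
    have "t *\<^sub>R \<nu> \<in> A" using t s \<nu>0 pt by (simp add: A_def open_cone_def)
    then have "w (t *\<^sub>R \<nu>) = (\<epsilon> / C) * exp (-1)"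
      using \<epsilon> by (simp add: w_def \<epsilon>_def soft_pos_def flat_def)
    also have "\<dots> \<ge> (3/8 * t powr \<alpha> / C) * exp (-1)"
      using \<epsilon>t C by (intro mult_right_mono divide_right_mono) auto
    finally have "w (t *\<^sub>R \<nu>) \<ge> k * t powr \<alpha>" by (simp add: k_def mult_ac)
    moreover have "test_function (closed_sector \<nu> s R) w"
      unfolding test_function_iff using smw cK' K'S w0 by blast
    ultimately show ?thesis using lapw by blast
  qed
  moreover have "k > 0" using C by (simp add: k_def)
  ultimately show ?thesis using that by blast
qed

section \<open>Translated barriers and barriers at interior points\<close>

lemma test_function_shift:
  assumes "test_function S w" "\<And>z. z \<in> S \<Longrightarrow> y + z \<in> \<Omega>"
  shows "test_function \<Omega> (\<lambda>x. w (x - y))"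
proof -
  obtain K where K: "smooth_on UNIV w" "compact K" "K \<subseteq> S" "\<And>x. x \<notin> K \<Longrightarrow> w x = 0"
    using test_functionE[OF assms(1)] by metis
  have "compact ((+) y ` K)" using K(2) by (rule compact_translation)
  moreover have "(+) y ` K \<subseteq> \<Omega>" using K assms(2) by auto
  moreover have "w (x - y) = 0" if "x \<notin> (+) y ` K" for x
    using K(4)[of "x - y"] that by (metis add.commute diff_add_cancel image_eqI)
  ultimately show ?thesis
    unfolding test_function_iff using smooth_on_shift[OF K(1)] by blast
qed

text \<open>A bump function divided by a bound for its Laplacian: away from the boundary any
  positive lower bound for u is good enough.\<close>

lemma interior_barrier:
  assumes "open \<Omega>" "x \<in> \<Omega>"
  obtains w where "test_function \<Omega> w" "\<And>x. laplacian w x \<ge> -1" "w x > 0"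
proof -
  obtain e where e: "e > 0" "cball x e \<subseteq> \<Omega>" using assms open_contains_cball by blast
  define f where "f = (\<lambda>z::'a. flat (e\<^sup>2 - z \<bullet> z))"
  have "smooth_on UNIV (\<lambda>z::'a. e\<^sup>2 - z \<bullet> z)"
    by (intro smooth_on_diff smooth_on_const smooth_on_inner_self open_UNIV)
  then have sf: "smooth_on UNIV f"
    unfolding f_def using smooth_on_chain[of UNIV UNIV "\<lambda>z::'a. e\<^sup>2 - z \<bullet> z" flat] smooth_on_flat by simp
  have f0: "f z = 0" if "z \<notin> cball 0 e" for z
  proof -
    have "e\<^sup>2 \<le> (norm z)\<^sup>2" using that e by (intro power_mono) auto
    then have "e\<^sup>2 - z \<bullet> z \<le> 0" by (simp add: dot_square_norm)
    then show ?thesis unfolding f_def by (rule flat_simps(1))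
  qed
  have tf: "test_function (cball 0 e) f" unfolding test_function_iff
    using sf f0 by (intro conjI exI[of _ "cball 0 e"] compact_cball order_refl allI impI)
  have "f 0 > 0" using e by (simp add: f_def flat_simps)
  have "continuous_on UNIV (\<lambda>x. laplacian f x)"
    unfolding laplacian_def
    by (intro continuous_on_sum smooth_on_continuous smooth_on_pd sf)
  then have "compact ((\<lambda>x. laplacian f x) ` cball 0 e)"
    by (intro compact_continuous_image compact_cball) (auto intro: continuous_on_subset)
  then obtain B where "\<forall>v\<in>(\<lambda>x. laplacian f x) ` cball 0 e. norm v \<le> B"
    using compact_imp_bounded[of "(\<lambda>x. laplacian f x) ` cball 0 e"] unfolding bounded_iff by blast
  then have B: "\<bar>laplacian f x\<bar> \<le> B" if "x \<in> cball 0 e" for x using that by simp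
  define C where "C = max B 1"
  have C: "C > 0" by (simp add: C_def)
  have lf: "\<bar>laplacian f x\<bar> \<le> C" for x
  proof (cases "x \<in> cball 0 e")
    case False
    have "laplacian (\<lambda>_. 0) x = laplacian f x"
      by (rule laplacian_transform[of "- cball 0 e"]) (use False f0 in \<open>auto simp: Ck_on_const\<close>)
    then show ?thesis using C by simp
  qed (use B in \<open>auto simp: C_def intro: max.coboundedI1\<close>)
  define w where "w = (\<lambda>z. f (z - x) * (1 / C))"
  have ts: "test_function \<Omega> (\<lambda>z. f (z - x))"
    by (rule test_function_shift[OF tf]) (use e in \<open>auto simp: dist_norm\<close>)
  have tw: "test_function \<Omega> w" unfolding w_def by (rule test_function_mult[OF ts smooth_on_const])
  have "laplacian w z \<ge> -1" for z
  proof -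
    have "laplacian w z = laplacian (\<lambda>z. (1 / C) * f (z - x)) z" by (simp add: w_def mult.commute)
    also have "\<dots> = (1 / C) * laplacian f (z - x)"
      using laplacian_cmult[OF open_UNIV UNIV_I smooth_on_C2[OF smooth_on_shift[OF sf]], of "1/C" x z]
        laplacian_shift[OF sf, of x z] by simp
    also have "\<dots> \<ge> (1 / C) * (- C)"
      using lf[of "z - x"] C by (intro mult_left_mono) auto
    finally show ?thesis using C by simp
  qed
  moreover have "w x > 0" using \<open>f 0 > 0\<close> C by (simp add: w_def)
  ultimately show ?thesis using that tw by blast
qed

section \<open>Rademacher's theorem\<close>

subsection \<open>Lipschitz functions of one variable\<close>

lemma emeasure_cball_real: "0 \<le> r \<Longrightarrow> emeasure lborel (cball (a::real) r) = ennreal (2 * r)"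
  by (simp add: cball_eq_atLeastAtMost)

lemma strict_mono_image_cball:
  fixes h :: "real \<Rightarrow> real"
  assumes "strict_mono h" "continuous_on UNIV h" "0 \<le> r"
  shows "h ` cball a r = {h (a - r)..h (a + r)}"
proof -
  have "h ` {a - r..a + r} = {h (a - r)..h (a + r)}"
  proof (intro equalityI subsetI)
    fix y assume "y \<in> {h (a - r)..h (a + r)}"
    then obtain x where "a - r \<le> x" "x \<le> a + r" "h x = y"
      using IVT'[of h "a - r" y "a + r"] assms continuous_on_subset by fastforce
    then show "y \<in> h ` {a - r..a + r}" by auto
  qed (use assms in \<open>auto simp: strict_mono_less_eq\<close>)
  then show ?thesis by (simp add: cball_eq_atLeastAtMost)
qed

lemma emeasure_image_cball:
  fixes h :: "real \<Rightarrow> real"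
  assumes "strict_mono h" "continuous_on UNIV h" "0 \<le> r"
  shows "emeasure lborel (h ` cball a r) = ennreal (h (a + r) - h (a - r))"
    "h ` cball a r \<in> sets lborel"
proof -
  have "h (a - r) \<le> h (a + r)" using assms by (simp add: strict_mono_less_eq)
  then show "emeasure lborel (h ` cball a r) = ennreal (h (a + r) - h (a - r))"
    "h ` cball a r \<in> sets lborel"
    using strict_mono_image_cball[OF assms, of a] by simp_all
qed

text \<open>
  If near every point of \<open>E\<close> there are small intervals on which the mean slope of \<open>h\<close> is at most \<open>p\<close> and
  others on which it is at least \<open>q\<close>, Vitali's theorem shrinks the measure of an open superset by \<open>p / q\<close>.
\<close>

lemma slope_vitali_step:
  fixes h :: "real \<Rightarrow> real"
  assumes h: "strict_mono h" "continuous_on UNIV h" and pq: "0 \<le> p" "0 \<le> q"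
    and low: "\<And>x d. x \<in> E \<Longrightarrow> d > 0 \<Longrightarrow> \<exists>a r. 0 < r \<and> r < d \<and> x \<in> cball a r \<and> h (a + r) - h (a - r) \<le> p * (2 * r)"
    and high: "\<And>x d. x \<in> E \<Longrightarrow> d > 0 \<Longrightarrow> \<exists>a r. 0 < r \<and> r < d \<and> x \<in> cball a r \<and> h (a + r) - h (a - r) \<ge> q * (2 * r)"
    and G: "open G" "E \<subseteq> G"
  obtains B N where "B \<in> sets lborel" "negligible N" "E \<subseteq> B \<union> N"
    "ennreal q * emeasure lborel B \<le> ennreal p * emeasure lborel G"
proof -
  let ?I = "\<lambda>i. cball (fst i) (snd i) :: real set"
  let ?m = "emeasure lborel :: real set \<Rightarrow> ennreal"
  have fine: "\<exists>i\<in>{(a, r). 0 < r \<and> cball a r \<subseteq> U \<and> P a r}. x \<in> ?I i \<and> snd i < d"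
    if U: "open U" "x \<in> U" "d > 0" and ex: "\<And>d. d > 0 \<Longrightarrow> \<exists>a r. 0 < r \<and> r < d \<and> x \<in> cball a r \<and> P a r"
    for U x d and P :: "real \<Rightarrow> real \<Rightarrow> bool"
  proof -
    obtain e where e: "e > 0" "ball x e \<subseteq> U" using U openE by blast
    obtain a r where ar: "0 < r" "r < min d (e / 2)" "x \<in> cball a r" "P a r"
      using ex[of "min d (e / 2)"] e U by auto
    have "cball a r \<subseteq> ball x e"
    proof
      fix y assume "y \<in> cball a r"
      then have "dist x y \<le> r + r" using ar(3) dist_triangle[of x y a] by (simp add: dist_commute)
      then show "y \<in> ball x e" using ar by simp
    qed
    then show ?thesis using ar e by (intro bexI[of _ "(a, r)"]) simp_all
  qed
  define K1 where "K1 = {(a, r). 0 < r \<and> cball a r \<subseteq> G \<and> h (a + r) - h (a - r) \<le> p * (2 * r)}"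
  have v1: "\<exists>i. i \<in> K1 \<and> x \<in> ?I i \<and> snd i < d" if "x \<in> E" "d > 0" for x d
    using fine[OF G(1) subsetD[OF G(2) that(1)] that(2) low[OF that(1)]] by (simp only: K1_def Bex_def)
  have pos1: "0 < snd i" if "i \<in> K1" for i using that by (auto simp: K1_def)
  obtain C1 where C1: "countable C1" "C1 \<subseteq> K1" "pairwise (\<lambda>i j. disjnt (?I i) (?I j)) C1"
    "negligible (E - (\<Union>i\<in>C1. ?I i))"
  proof -
    show thesis
      by (rule Vitali_covering_theorem_cballs[of K1 snd E fst, OF pos1 v1]) (assumption+, rule that)
  qed
  \<comment> \<open>Open intervals, so that the second covering can be carried out inside the first.
    The lost end points are countably many and go into N.\<close>
  define G1 where "G1 = (\<Union>i\<in>C1. ball (fst i) (snd i))"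
  have oG1: "open G1" unfolding G1_def by auto
  define K2 where "K2 = {(a, r). 0 < r \<and> cball a r \<subseteq> G1 \<and> h (a + r) - h (a - r) \<ge> q * (2 * r)}"
  have v2: "\<exists>i. i \<in> K2 \<and> x \<in> ?I i \<and> snd i < d" if "x \<in> E \<inter> G1" "d > 0" for x d
    using fine[OF oG1 IntD2[OF that(1)] that(2) high[OF IntD1[OF that(1)]]] by (simp only: K2_def Bex_def)
  have pos2: "0 < snd i" if "i \<in> K2" for i using that by (auto simp: K2_def)
  obtain C2 where C2: "countable C2" "C2 \<subseteq> K2" "pairwise (\<lambda>i j. disjnt (?I i) (?I j)) C2"
    "negligible (E \<inter> G1 - (\<Union>i\<in>C2. ?I i))"
  proof -
    show thesis
      by (rule Vitali_covering_theorem_cballs[of K2 snd "E \<inter> G1" fst, OF pos2 v2]) (assumption+, rule that)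
  qed
  define B where "B = (\<Union>i\<in>C2. ?I i)"
  define N where "N = (E - (\<Union>i\<in>C1. ?I i)) \<union> (\<Union>i\<in>C1. sphere (fst i) (snd i)) \<union> (E \<inter> G1 - B)"
  have "negligible (\<Union>i\<in>C1. sphere (fst i) (snd i))"
    by (auto intro: negligible_sphere C1)
  then have N: "negligible N" unfolding N_def B_def using C1 C2 by (intro negligible_Un)
  have cover: "E \<subseteq> B \<union> N"
    unfolding N_def G1_def by (force simp: sphere_def)
  have inj: "inj h" using h(1) by (simp add: strict_mono_imp_inj_on)
  have r: "0 \<le> snd i" if "i \<in> C1 \<union> C2" for i
    using that C1(2) C2(2) by (auto simp: K1_def K2_def)
  have sums: "?m (\<Union>i\<in>C. ?I i) = (\<integral>\<^sup>+i. ennreal (2 * snd i) \<partial>count_space C)"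
    "?m (\<Union>i\<in>C. h ` ?I i) = (\<integral>\<^sup>+i. ennreal (h (fst i + snd i) - h (fst i - snd i)) \<partial>count_space C)"
    if C: "countable C" "pairwise (\<lambda>i j. disjnt (?I i) (?I j)) C" "C \<subseteq> C1 \<union> C2" for C
  proof -
    have dj: "disjoint_family_on ?I C"
      using C(2) by (auto simp: disjoint_family_on_def pairwise_def disjnt_def)
    have dj': "disjoint_family_on (\<lambda>i. h ` ?I i) C"
      unfolding disjoint_family_on_def
    proof (intro ballI impI)
      fix m n assume "m \<in> C" "n \<in> C" "m \<noteq> n"
      then have "?I m \<inter> ?I n = {}" using dj by (auto simp: disjoint_family_on_def)
      then show "h ` ?I m \<inter> h ` ?I n = {}" using inj by (metis image_Int image_empty)
    qed
    have "?m (\<Union>i\<in>C. ?I i) = (\<integral>\<^sup>+i. ?m (?I i) \<partial>count_space C)"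
      using C(1) dj by (intro emeasure_UN_countable) auto
    also have "\<dots> = (\<integral>\<^sup>+i. ennreal (2 * snd i) \<partial>count_space C)"
      using r C(3) by (intro nn_integral_cong) (auto intro!: emeasure_cball_real)
    finally show "?m (\<Union>i\<in>C. ?I i) = (\<integral>\<^sup>+i. ennreal (2 * snd i) \<partial>count_space C)" .
    have "?m (\<Union>i\<in>C. h ` ?I i) = (\<integral>\<^sup>+i. ?m (h ` ?I i) \<partial>count_space C)"
    proof (rule emeasure_UN_countable[OF _ C(1) dj'])
      show "h ` ?I i \<in> sets lborel" if "i \<in> C" for i
        using r[of i] that C(3) by (intro emeasure_image_cball(2)[OF h]) auto
    qed
    also have "\<dots> = (\<integral>\<^sup>+i. ennreal (h (fst i + snd i) - h (fst i - snd i)) \<partial>count_space C)"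
      using r C(3) by (intro nn_integral_cong) (auto intro!: emeasure_image_cball(1)[OF h])
    finally show "?m (\<Union>i\<in>C. h ` ?I i) = (\<integral>\<^sup>+i. ennreal (h (fst i + snd i) - h (fst i - snd i)) \<partial>count_space C)" .
  qed
  \<comment> \<open>The chain is q |B| \<le> |h(B)| \<le> |h(first cover)| \<le> p |G|. As h is
    increasing and continuous, disjoint intervals have disjoint interval images whose lengths are
    the increments of h.\<close>
  have "ennreal q * ?m B = (\<integral>\<^sup>+i. ennreal q * ennreal (2 * snd i) \<partial>count_space C2)"
    unfolding B_def by (subst sums(1)[OF C2(1,3)]) (auto simp: nn_integral_cmult)
  also have "\<dots> \<le> (\<integral>\<^sup>+i. ennreal (h (fst i + snd i) - h (fst i - snd i)) \<partial>count_space C2)"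
    using C2(2) pq by (intro nn_integral_mono) (auto simp: K2_def ennreal_mult[symmetric] intro!: ennreal_leI)
  also have "\<dots> = ?m (\<Union>i\<in>C2. h ` ?I i)" by (rule sums(2)[OF C2(1,3), symmetric]) simp
  also have "\<dots> \<le> ?m (\<Union>i\<in>C1. h ` ?I i)"
  proof (rule emeasure_mono)
    have "(\<Union>i\<in>C2. ?I i) \<subseteq> G1" using C2(2) by (force simp: K2_def)
    also have "\<dots> \<subseteq> (\<Union>i\<in>C1. ?I i)" unfolding G1_def by (intro UN_mono) auto
    finally show "(\<Union>i\<in>C2. h ` ?I i) \<subseteq> (\<Union>i\<in>C1. h ` ?I i)" by blast
    show "(\<Union>i\<in>C1. h ` ?I i) \<in> sets lborel"
      using emeasure_image_cball(2)[OF h] r C1(1) by (intro sets.countable_UN') auto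
  qed
  also have "\<dots> = (\<integral>\<^sup>+i. ennreal (h (fst i + snd i) - h (fst i - snd i)) \<partial>count_space C1)"
    by (rule sums(2)[OF C1(1,3)]) simp
  also have "\<dots> \<le> (\<integral>\<^sup>+i. ennreal p * ennreal (2 * snd i) \<partial>count_space C1)"
    using C1(2) pq by (intro nn_integral_mono) (auto simp: K1_def ennreal_mult[symmetric] intro!: ennreal_leI)
  also have "\<dots> = ennreal p * ?m (\<Union>i\<in>C1. ?I i)"
    by (subst sums(1)[OF C1(1,3)]) (auto simp: nn_integral_cmult)
  also have "\<dots> \<le> ennreal p * ?m G"
  proof (intro mult_left_mono emeasure_mono)
    show "(\<Union>i\<in>C1. ?I i) \<subseteq> G" using C1(2) by (force simp: K1_def)
  qed (use G in auto)
  finally have "ennreal q * ?m B \<le> ennreal p * ?m G" .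
  moreover have "B \<in> sets lborel" unfolding B_def using C2(1) by (intro sets.countable_UN') auto
  ultimately show ?thesis using that N cover by blast
qed

text \<open>Each application of \<open>slope_vitali_step\<close> leads to an open superset of E with
  a measure bound smaller by the factor \<rho>, chosen strictly between p/q and 1; iteration drives
  the outer measure to 0.\<close>

lemma slope_oscillation_negligible:
  fixes h :: "real \<Rightarrow> real"
  assumes h: "strict_mono h" "continuous_on UNIV h" and pq: "0 < p" "p < q" and E: "bounded E"
    and low: "\<And>x d. x \<in> E \<Longrightarrow> d > 0 \<Longrightarrow> \<exists>a r. 0 < r \<and> r < d \<and> x \<in> cball a r \<and> h (a + r) - h (a - r) \<le> p * (2 * r)"
    and high: "\<And>x d. x \<in> E \<Longrightarrow> d > 0 \<Longrightarrow> \<exists>a r. 0 < r \<and> r < d \<and> x \<in> cball a r \<and> h (a + r) - h (a - r) \<ge> q * (2 * r)"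
  shows "negligible E"
proof -
  obtain M where M: "M > 0" "E \<subseteq> ball 0 M"
    using E bounded_subset_ballD by metis
  define \<rho> where "\<rho> = (p / q + 1) / 2"
  have \<rho>: "0 < \<rho>" "\<rho> < 1" "p / q < \<rho>" using pq by (auto simp: \<rho>_def field_simps)
  have step: "\<exists>G. open G \<and> E \<subseteq> G \<and> emeasure lborel G \<le> ennreal (\<rho> ^ k * (2 * M))" for k
  proof (induction k)
    case 0
    have "emeasure lborel (ball (0::real) M) = ennreal (2 * M)"
      using M by (simp add: ball_eq_greaterThanLessThan)
    then show ?case using M by (intro exI[of _ "ball 0 M"]) auto
  next
    case (Suc k)
    define m where "m = \<rho> ^ k * (2 * M)"
    have m: "m > 0" using \<rho> M by (simp add: m_def)
    obtain G where G: "open G" "E \<subseteq> G" "emeasure lborel G \<le> ennreal m" using Suc unfolding m_def by blast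
    obtain B N where BN: "B \<in> sets lborel" "negligible N" "E \<subseteq> B \<union> N"
      "ennreal q * emeasure lborel B \<le> ennreal p * emeasure lborel G"
      by (rule slope_vitali_step[OF h _ _ low high G(1,2)]) (use pq in auto)
    have "ennreal q * emeasure lborel B \<le> ennreal p * ennreal m"
      using BN(4) G(3) by (meson mult_left_mono order_trans zero_le)
    then have "ennreal (1 / q) * (ennreal q * emeasure lborel B) \<le> ennreal (1 / q) * (ennreal p * ennreal m)"
      by (intro mult_left_mono) auto
    then have B: "emeasure lborel B \<le> ennreal (p / q * m)"
      using pq m by (simp add: mult.assoc[symmetric] ennreal_mult[symmetric])
    have BNs: "B \<union> N \<in> sets lebesgue"
      using BN(1,2) by (intro sets.Un) (auto intro: negligible_imp_sets)
    \<comment> \<open>The gap between \<rho> and p/q pays for enlarging B \<union> N to an open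
      set.\<close>
    define e where "e = (\<rho> - p / q) * m"
    have e: "e > 0" using \<rho> m by (simp add: e_def)
    obtain T where T: "open T" "B \<union> N \<subseteq> T" "T - (B \<union> N) \<in> lmeasurable"
      "emeasure lebesgue (T - (B \<union> N)) < ennreal e"
      using sets_lebesgue_outer_open[OF BNs e] by blast
    have "emeasure lborel T = emeasure lebesgue T" using T(1) by simp
    also have "\<dots> = emeasure lebesgue ((B \<union> N) \<union> (T - (B \<union> N)))" using T(2) by (simp add: Un_absorb1)
    also have "\<dots> \<le> emeasure lebesgue (B \<union> N) + emeasure lebesgue (T - (B \<union> N))"
      using BNs T(3) by (intro emeasure_subadditive) auto
    also have "emeasure lebesgue (B \<union> N) \<le> emeasure lebesgue B + emeasure lebesgue N"
      using BN(1,2) by (intro emeasure_subadditive) (auto intro: negligible_imp_sets)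
    also have "emeasure lebesgue N = 0" using BN(2) negligible_iff_null_sets by blast
    also have "emeasure lebesgue B = emeasure lborel B" using BN(1) by simp
    finally have "emeasure lborel T \<le> emeasure lborel B + emeasure lebesgue (T - (B \<union> N))"
      by (simp add: add_right_mono)
    also have "\<dots> \<le> ennreal (p / q * m) + ennreal e" using B T(4) by (intro add_mono) auto
    also have "\<dots> = ennreal (\<rho> * m)" using pq m e by (subst ennreal_plus[symmetric]) (auto simp: e_def algebra_simps)
    finally show ?case using T BN(3) unfolding m_def by (intro exI[of _ T]) (auto simp: mult.assoc)
  qed
  show ?thesis
    unfolding negligible_outer_le
  proof (intro allI impI)
    fix e :: real assume e: "e > 0"
    have "(\<lambda>k. \<rho> ^ k * (2 * M)) \<longlonglongrightarrow> 0 * (2 * M)"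
      using \<rho> by (intro tendsto_intros LIMSEQ_power_zero) auto
    then have "\<forall>\<^sub>F k in sequentially. \<rho> ^ k * (2 * M) < e" using e by (intro order_tendstoD(2)) auto
    then obtain k where k: "\<rho> ^ k * (2 * M) < e" using eventually_sequentially by auto
    obtain G where G: "open G" "E \<subseteq> G" "emeasure lborel G \<le> ennreal (\<rho> ^ k * (2 * M))" using step by blast
    have m0: "0 \<le> \<rho> ^ k * (2 * M)" using \<rho> M by simp
    have "emeasure lebesgue G \<le> ennreal (\<rho> ^ k * (2 * M))" using G by simp
    then have "emeasure lebesgue G < \<infinity>" "measure lebesgue G \<le> \<rho> ^ k * (2 * M)"
      using m0 le_less_trans[OF _ ennreal_less_top] enn2real_leI unfolding measure_def by auto
    moreover from this have "G \<in> lmeasurable" using G(1) by (intro fmeasurableI) auto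
    ultimately show "\<exists>T. E \<subseteq> T \<and> T \<in> lmeasurable \<and> measure lebesgue T \<le> e"
      using G k by (intro exI[of _ G]) auto
  qed
qed

text \<open>Adding (L + 1) t makes the function strictly increasing with slopes in [1, 2 L + 1].
  Where it is not differentiable, the lower and upper derivates differ and are separated by positive
  rationals p < q; for each of the countably many choices the exceptional set is negligible.\<close>

lemma lipschitz_real_differentiable_ae:
  fixes g :: "real \<Rightarrow> real"
  assumes lip: "\<And>s t. \<bar>g s - g t\<bar> \<le> L * \<bar>s - t\<bar>" and L: "L \<ge> 0"
  shows "negligible {t. \<not> g differentiable (at t)}"
proof -
  define h where "h = (\<lambda>t. g t + (L + 1) * t)"
  have hd: "t - s \<le> h t - h s" "h t - h s \<le> (2 * L + 1) * (t - s)" if "s \<le> t" for s t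
    using lip[of t s] that by (auto simp: h_def algebra_simps abs_le_iff)
  have sm: "strict_mono h"
  proof (rule strict_monoI)
    show "h s < h t" if "s < t" for s t using hd(1)[of s t] that by simp
  qed
  have ch: "continuous_on UNIV h"
  proof -
    have "L-lipschitz_on UNIV g" using lip L by (auto simp: lipschitz_on_def dist_real_def)
    then show ?thesis unfolding h_def by (intro continuous_intros lipschitz_on_continuous_on)
  qed
  define Q where "Q = (\<lambda>x y. (h y - h x) / (y - x))"
  have Qb: "1 \<le> Q x y" "Q x y \<le> 2 * L + 1" if "y \<noteq> x" for x y
  proof -
    have "Q x y = Q y x" unfolding Q_def by (metis minus_diff_eq minus_divide_divide)
    moreover have "1 \<le> Q s t" "Q s t \<le> 2 * L + 1" if "s < t" for s t
      using hd[of s t] that by (auto simp: Q_def field_simps)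
    ultimately show "1 \<le> Q x y" "Q x y \<le> 2 * L + 1" using that by (metis linorder_neqE)+
  qed
  define E where "E = (\<lambda>p q (n::nat). {x. \<bar>x\<bar> \<le> real n \<and> frequently (\<lambda>y. Q x y < p) (at x) \<and> frequently (\<lambda>y. q < Q x y) (at x)})"
  have ineq: "\<exists>a r. 0 < r \<and> r < d \<and> x \<in> cball a r \<and> P ((h (a + r) - h (a - r)) / (2 * r))"
    if fr: "frequently (\<lambda>y. P (Q x y)) (at x)" and d: "d > 0" for x d P
  proof -
    obtain y where y: "P (Q x y)" "dist y x < d" "y \<noteq> x"
      using fr d unfolding frequently_at by blast
    have *: "Q x y = (h (max x y) - h (min x y)) / (max x y - min x y)"
      by (simp add: Q_def max_def min_def) (metis minus_diff_eq minus_divide_divide)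
    \<comment> \<open>The interval between x and y, described by midpoint and radius, so that x is
      one of its end points.\<close>
    define a r where "a = (x + y) / 2" and "r = \<bar>y - x\<bar> / 2"
    have "a + r = max x y" "a - r = min x y" "2 * r = max x y - min x y" "x \<in> cball a r" "0 < r" "r < d"
      using y by (auto simp: a_def r_def dist_real_def max_def min_def abs_if field_simps)
    then show ?thesis using y(1) * by metis
  qed
  have negE: "negligible (E p q n)" if "0 < p" "p < q" for p q n
  proof (rule slope_oscillation_negligible[OF sm ch that])
    show "bounded (E p q n)"
      by (rule bounded_subset[of "cball 0 (real n)"]) (auto simp: E_def)
    fix x d assume x: "x \<in> E p q n" and d: "d > (0::real)"
    show "\<exists>a r. 0 < r \<and> r < d \<and> x \<in> cball a r \<and> h (a + r) - h (a - r) \<le> p * (2 * r)"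
      using ineq[of "\<lambda>z. z < p" x d] x d by (force simp: E_def divide_less_eq intro: less_imp_le)
    show "\<exists>a r. 0 < r \<and> r < d \<and> x \<in> cball a r \<and> h (a + r) - h (a - r) \<ge> q * (2 * r)"
      using ineq[of "\<lambda>z. q < z" x d] x d by (force simp: E_def less_divide_eq intro: less_imp_le)
  qed
  have sub: "{t. \<not> g differentiable (at t)} \<subseteq> (\<Union>(p, q, n) \<in> {(p, q, n). p \<in> \<rat> \<and> q \<in> \<rat> \<and> 0 < p \<and> p < q}. E p q n)"
  proof
    fix x assume "x \<in> {t. \<not> g differentiable (at t)}"
    then have nd: "\<not> g differentiable (at x)" by simp
    let ?F = "\<lambda>y. ereal (Q x y)"
    have ev: "\<forall>\<^sub>F y in at x. 1 \<le> Q x y \<and> Q x y \<le> 2 * L + 1"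
      using Qb by (auto simp: eventually_at intro!: exI[of _ 1])
    have lo: "1 \<le> Liminf (at x) ?F" and hi: "Limsup (at x) ?F \<le> ereal (2 * L + 1)"
      using ev by (auto intro!: Liminf_bounded Limsup_bounded elim!: eventually_mono)
    have le: "Liminf (at x) ?F \<le> Limsup (at x) ?F" by (rule Liminf_le_Limsup) simp
    have "Liminf (at x) ?F \<noteq> Limsup (at x) ?F"
    proof
      assume eq: "Liminf (at x) ?F = Limsup (at x) ?F"
      obtain l where l: "Liminf (at x) ?F = ereal l"
        using lo hi le by (cases "Liminf (at x) ?F") auto
      have "(?F \<longlongrightarrow> ereal l) (at x)" using eq l by (simp add: tendsto_iff_Liminf_eq_Limsup)
      then have "(Q x \<longlongrightarrow> l) (at x)" by simp
      then have "(h has_real_derivative l) (at x)" by (simp add: has_field_derivative_iff Q_def)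
      then have "((\<lambda>t. h t - (L + 1) * t) has_real_derivative (l - (L + 1))) (at x)"
        by (auto intro!: derivative_eq_intros)
      then have "g differentiable (at x)"
        by (simp add: h_def real_differentiable_def) blast
      then show False using nd by simp
    qed
    then have lt: "Liminf (at x) ?F < Limsup (at x) ?F" using le by simp
    obtain m where m: "Liminf (at x) ?F < m" "m < Limsup (at x) ?F" using dense[OF lt] by blast
    obtain p where p: "Liminf (at x) ?F < ereal p" "ereal p < m" "p \<in> \<rat>"
      using ereal_dense3[OF m(1)] by (metis Rats_of_rat of_rat_def Rats_def rangeI)
    obtain q where q: "m < ereal q" "ereal q < Limsup (at x) ?F" "q \<in> \<rat>"
      using ereal_dense3[OF m(2)] by (metis Rats_of_rat)
    have "frequently (\<lambda>y. Q x y < p) (at x)"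
    proof (rule ccontr)
      assume "\<not> ?thesis"
      then have "\<forall>\<^sub>F y in at x. ereal p \<le> ?F y" by (simp add: not_frequently not_less)
      then show False using p(1) Liminf_bounded by (metis not_less)
    qed
    moreover have "frequently (\<lambda>y. q < Q x y) (at x)"
    proof (rule ccontr)
      assume "\<not> ?thesis"
      then have "\<forall>\<^sub>F y in at x. ?F y \<le> ereal q" by (simp add: not_frequently not_less)
      then show False using q(2) Limsup_bounded by (metis not_less)
    qed
    moreover have "p < q" using p q by (metis less_ereal.simps(1) order_less_trans)
    moreover have "0 < p" using lo p(1) by (metis ereal_less(2) less_ereal.simps(1) not_one_less_zero one_ereal_def order_le_less_trans order_less_trans zero_less_one zero_ereal_def)
    moreover have "\<bar>x\<bar> \<le> real (nat \<lceil>\<bar>x\<bar>\<rceil>)" by linarith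
    ultimately show "x \<in> (\<Union>(p, q, n) \<in> {(p, q, n). p \<in> \<rat> \<and> q \<in> \<rat> \<and> 0 < p \<and> p < q}. E p q n)"
      using p(3) q(3) by (intro UN_I[of "(p, q, nat \<lceil>\<bar>x\<bar>\<rceil>)"]) (auto simp: E_def)
  qed
  have "countable {(p, q, n::nat). p \<in> \<rat> \<and> q \<in> \<rat> \<and> 0 < p \<and> p < (q::real)}"
    by (rule countable_subset[of _ "\<rat> \<times> \<rat> \<times> UNIV"]) (auto intro: countable_SIGMA countable_rat)
  then have "negligible (\<Union>(p, q, n) \<in> {(p, q, n). p \<in> \<rat> \<and> q \<in> \<rat> \<and> 0 < p \<and> p < q}. E p q n)"
    using negE by (intro negligible_countable_Union) auto
  then show ?thesis using sub negligible_subset by blast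
qed

subsection \<open>Directional derivatives\<close>

text \<open>Fubini for the indicator of N at x + t v. Integrating over t first gives 0; integrating
  over x first gives |N| for every t by translation invariance. So |N| times the infinite length of
  the line is 0. This treats all directions v alike, without a change of coordinates.\<close>

lemma null_sets_if_null_on_lines:
  fixes v :: "'a::euclidean_space"
  assumes N: "N \<in> sets borel" and lines: "\<And>x. negligible {t. x + t *\<^sub>R v \<in> N}"
  shows "N \<in> null_sets lborel"
proof -
  have meas: "(\<lambda>(x, t). indicator N (x + t *\<^sub>R v) :: ennreal) \<in> borel_measurable (lborel \<Otimes>\<^sub>M lborel)"
    using N by measurable
  have 1: "(\<integral>\<^sup>+t. indicator N (x + t *\<^sub>R v) \<partial>lborel) = 0" for x
  proof -
    have b: "{t. x + t *\<^sub>R v \<in> N} \<in> sets borel"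
      using measurable_sets[of "\<lambda>t. x + t *\<^sub>R v" borel borel N] N by (simp add: vimage_def)
    then have "emeasure lborel {t. x + t *\<^sub>R v \<in> N} = 0"
      using lines[of x] unfolding negligible_iff_null_sets by (auto simp: null_sets_def)
    moreover have "(\<integral>\<^sup>+t. indicator N (x + t *\<^sub>R v) \<partial>lborel) = (\<integral>\<^sup>+t. indicator {t. x + t *\<^sub>R v \<in> N} t \<partial>lborel)"
      by (rule nn_integral_cong) (simp add: indicator_def)
    ultimately show ?thesis using b by simp
  qed
  have 2: "(\<integral>\<^sup>+x. indicator N (x + t *\<^sub>R v) \<partial>lborel) = emeasure lborel N" for t
  proof -
    have "emeasure lborel N = (\<integral>\<^sup>+x. indicator N x \<partial>(distr lborel borel ((+) (t *\<^sub>R v))))"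
      using N by (simp add: lborel_distr_plus)
    also have "\<dots> = (\<integral>\<^sup>+x. indicator N (t *\<^sub>R v + x) \<partial>lborel)"
      using N by (intro nn_integral_distr) auto
    finally show ?thesis by (simp add: add.commute)
  qed
  have "(\<integral>\<^sup>+(t::real). emeasure lborel N \<partial>lborel) = (\<integral>\<^sup>+t. (\<integral>\<^sup>+x. indicator N (x + t *\<^sub>R v) \<partial>lborel) \<partial>lborel)"
    by (simp add: 2)
  also have "\<dots> = (\<integral>\<^sup>+x. (\<integral>\<^sup>+t. indicator N (x + t *\<^sub>R v) \<partial>lborel) \<partial>lborel)"
    using lborel_pair.Fubini[OF meas] by simp
  also have "\<dots> = 0" by (simp add: 1)
  finally have "emeasure lborel N * \<infinity> = 0" by simp
  then have "emeasure lborel N = 0" by (simp add: ennreal_mult_eq_top_iff mult_eq_0_iff)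
  then show ?thesis using N by (simp add: null_sets_def)
qed

lemma pd_eq_grad_inner:
  fixes f :: "'a::euclidean_space \<Rightarrow> real"
  assumes "f differentiable (at x)"
  shows "pd v f x = grad f x \<bullet> v"
proof -
  have 1: "(f has_derivative frechet_derivative f (at x)) (at x)"
    using assms frechet_derivative_works by blast
  have lin: "linear (frechet_derivative f (at x))" using 1 by (rule has_derivative_linear)
  have "frechet_derivative f (at x) v = frechet_derivative f (at x) (\<Sum>b\<in>Basis. (v \<bullet> b) *\<^sub>R b)"
    by (simp add: euclidean_representation)
  also have "\<dots> = (\<Sum>b\<in>Basis. (v \<bullet> b) * pd b f x)"
    using lin by (simp add: linear_sum linear_cmul)
  also have "\<dots> = grad f x \<bullet> v"
    unfolding grad_def inner_sum_left by (intro sum.cong) (simp_all add: inner_commute)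
  finally show ?thesis .
qed

definition dquot :: "('a::euclidean_space \<Rightarrow> real) \<Rightarrow> 'a \<Rightarrow> 'a \<Rightarrow> real \<Rightarrow> real" where
  "dquot f v x t = (f (x + t *\<^sub>R v) - f x) / t"

definition dir_diff :: "('a::euclidean_space \<Rightarrow> real) \<Rightarrow> 'a \<Rightarrow> 'a \<Rightarrow> bool" where
  "dir_diff f v x \<longleftrightarrow> (\<exists>l. (dquot f v x \<longlongrightarrow> l) (at 0))"

definition dir_deriv :: "('a::euclidean_space \<Rightarrow> real) \<Rightarrow> 'a \<Rightarrow> 'a \<Rightarrow> real" where
  "dir_deriv f v x = (SOME l. (dquot f v x \<longlongrightarrow> l) (at 0))"

lemma dir_deriv_tendsto: "dir_diff f v x \<Longrightarrow> (dquot f v x \<longlongrightarrow> dir_deriv f v x) (at 0)"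
  unfolding dir_diff_def dir_deriv_def by (rule someI_ex)

lemma dir_deriv_eq: "(dquot f v x \<longlongrightarrow> l) (at 0) \<Longrightarrow> dir_deriv f v x = l"
  by (rule tendsto_unique[OF _ dir_deriv_tendsto]) (auto simp: dir_diff_def)

lemma dquot_tendsto_iff: "(dquot f v x \<longlongrightarrow> l) (at 0) \<longleftrightarrow> ((\<lambda>t. f (x + t *\<^sub>R v)) has_real_derivative l) (at 0)"
  by (simp add: DERIV_def dquot_def[abs_def])

lemma dir_diff_scale:
  assumes "dir_diff f v x" shows "dir_deriv f (c *\<^sub>R v) x = c * dir_deriv f v x"
proof -
  have "((\<lambda>t. f (x + t *\<^sub>R v)) has_real_derivative dir_deriv f v x) (at (0 * c))"
    using dir_deriv_tendsto[OF assms] by (simp add: dquot_tendsto_iff)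
  moreover have "((\<lambda>t. t * c) has_real_derivative c) (at 0)" by (auto intro!: derivative_eq_intros)
  ultimately have "((\<lambda>t. f (x + (t * c) *\<^sub>R v)) has_real_derivative dir_deriv f v x * c) (at 0)"
    by (rule DERIV_chain2)
  then show ?thesis by (intro dir_deriv_eq) (simp add: dquot_tendsto_iff mult.commute)
qed

context
  fixes f :: "'a::euclidean_space \<Rightarrow> real" and L :: real
  assumes lip: "\<And>x y. \<bar>f x - f y\<bar> \<le> L * norm (x - y)" and L: "L \<ge> 0"
begin

lemma lip_continuous: "continuous_on S f"
proof -
  have "L-lipschitz_on UNIV f" using lip L by (auto simp: lipschitz_on_def dist_norm)
  then show ?thesis using lipschitz_on_continuous_on continuous_on_subset by blast
qed

lemma dquot_continuous: "continuous_on UNIV (\<lambda>x. dquot f v x t)"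
proof -
  have "continuous_on UNIV (\<lambda>x. f (x + t *\<^sub>R v))"
    by (rule continuous_on_compose2[OF lip_continuous[of UNIV]]) (auto intro!: continuous_intros)
  then show ?thesis unfolding dquot_def divide_inverse
    by (intro continuous_on_mult continuous_on_diff lip_continuous continuous_on_const)
qed

lemma dquot_bound: "\<bar>dquot f v x t\<bar> \<le> L * norm v"
proof (cases "t = 0")
  case False
  have "\<bar>f (x + t *\<^sub>R v) - f x\<bar> \<le> L * (\<bar>t\<bar> * norm v)" using lip[of "x + t *\<^sub>R v" x] by simp
  then show ?thesis using False by (simp add: dquot_def divide_le_eq mult_ac)
qed (use L in \<open>simp add: dquot_def\<close>)

text \<open>The Cauchy criterion with only countable outer quantifiers: for fixed k and n the
  condition defines a closed set of x, which gives Borel measurability.\<close>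

lemma dir_diff_iff_Cauchy:
  "dir_diff f v x \<longleftrightarrow> (\<forall>k::nat. \<exists>n::nat. \<forall>s t. s \<noteq> 0 \<and> t \<noteq> 0 \<and> \<bar>s\<bar> < inverse (Suc n) \<and> \<bar>t\<bar> < inverse (Suc n)
      \<longrightarrow> \<bar>dquot f v x s - dquot f v x t\<bar> \<le> inverse (Suc k))" (is "_ \<longleftrightarrow> ?C")
proof
  assume "dir_diff f v x"
  then obtain l where l: "(dquot f v x \<longlongrightarrow> l) (at 0)" by (auto simp: dir_diff_def)
  show ?C
  proof
    fix k :: nat
    have "\<forall>\<^sub>F t in at 0. dist (dquot f v x t) l < inverse (Suc k) / 2"
      using l by (rule tendstoD) simp
    then obtain d where d: "d > 0" "\<And>t. t \<noteq> 0 \<Longrightarrow> \<bar>t\<bar> < d \<Longrightarrow> \<bar>dquot f v x t - l\<bar> < inverse (Suc k) / 2"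
      by (auto simp: eventually_at dist_real_def)
    obtain n where n: "inverse (real (Suc n)) < d" using reals_Archimedean[OF d(1)] by blast
    have "\<bar>dquot f v x s - dquot f v x t\<bar> \<le> inverse (Suc k)"
      if "s \<noteq> 0" "t \<noteq> 0" "\<bar>s\<bar> < inverse (Suc n)" "\<bar>t\<bar> < inverse (Suc n)" for s t
      using d(2)[of s] d(2)[of t] n that by linarith
    then show "\<exists>n::nat. \<forall>s t. s \<noteq> 0 \<and> t \<noteq> 0 \<and> \<bar>s\<bar> < inverse (Suc n) \<and> \<bar>t\<bar> < inverse (Suc n)
      \<longrightarrow> \<bar>dquot f v x s - dquot f v x t\<bar> \<le> inverse (Suc k)" by blast
  qed
next
  assume C: ?C
  \<comment> \<open>The double successor puts the m-th point strictly below the threshold for n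
    already when m = n.\<close>
  define X where "X = (\<lambda>m. dquot f v x (inverse (real (Suc (Suc m)))))"
  have small: "\<bar>inverse (real (Suc (Suc m)))\<bar> < inverse (Suc n)" if "n \<le> m" for m n
    using that by (simp add: field_simps)
  have "Cauchy X"
  proof (rule metric_CauchyI)
    fix e :: real assume "e > 0"
    then obtain k where k: "inverse (real (Suc k)) < e" using reals_Archimedean by blast
    obtain n where n: "\<And>s t. s \<noteq> 0 \<Longrightarrow> t \<noteq> 0 \<Longrightarrow> \<bar>s\<bar> < inverse (Suc n) \<Longrightarrow> \<bar>t\<bar> < inverse (Suc n)
      \<Longrightarrow> \<bar>dquot f v x s - dquot f v x t\<bar> \<le> inverse (Suc k)" using C by blast
    have "dist (X i) (X j) < e" if "n \<le> i" "n \<le> j" for i j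
      using n[OF _ _ small[OF that(1)] small[OF that(2)]] k by (simp add: X_def dist_real_def)
    then show "\<exists>M. \<forall>m\<ge>M. \<forall>n\<ge>M. dist (X m) (X n) < e" by blast
  qed
  then obtain l where l: "X \<longlonglongrightarrow> l" using real_Cauchy_convergent convergent_def by blast
  have "(dquot f v x \<longlongrightarrow> l) (at 0)"
  proof (rule tendstoI)
    fix e :: real assume "e > 0"
    then obtain k where k: "inverse (real (Suc k)) < e" using reals_Archimedean by blast
    obtain n where n: "\<And>s t. s \<noteq> 0 \<Longrightarrow> t \<noteq> 0 \<Longrightarrow> \<bar>s\<bar> < inverse (Suc n) \<Longrightarrow> \<bar>t\<bar> < inverse (Suc n)
      \<Longrightarrow> \<bar>dquot f v x s - dquot f v x t\<bar> \<le> inverse (Suc k)" using C by blast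
    have "\<bar>dquot f v x s - l\<bar> \<le> inverse (Suc k)" if s: "s \<noteq> 0" "\<bar>s\<bar> < inverse (Suc n)" for s
    proof (rule tendsto_upperbound)
      show "(\<lambda>m. \<bar>dquot f v x s - X m\<bar>) \<longlonglongrightarrow> \<bar>dquot f v x s - l\<bar>" by (intro tendsto_intros l)
      show "\<forall>\<^sub>F m in sequentially. \<bar>dquot f v x s - X m\<bar> \<le> inverse (Suc k)"
        unfolding eventually_sequentially X_def using n[OF s(1) _ s(2) small] by auto
    qed simp
    then show "\<forall>\<^sub>F s in at 0. dist (dquot f v x s) l < e"
      unfolding eventually_at using k by (intro exI[of _ "inverse (Suc n)"]) (force simp: dist_real_def)
  qed
  then show "dir_diff f v x" by (auto simp: dir_diff_def)
qed

lemma dir_diff_borel: "{x. dir_diff f v x} \<in> sets borel"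
proof -
  define A where "A = (\<lambda>(k::nat) (n::nat). {x. \<forall>s t. s \<noteq> 0 \<and> t \<noteq> 0 \<and> \<bar>s\<bar> < inverse (Suc n) \<and> \<bar>t\<bar> < inverse (Suc n)
      \<longrightarrow> \<bar>dquot f v x s - dquot f v x t\<bar> \<le> inverse (Suc k)})"
  have "closed (A k n)" for k n
    unfolding A_def
    by (intro closed_Collect_all closed_Collect_imp closed_Collect_le continuous_intros dquot_continuous) auto
  then have [measurable]: "A k n \<in> sets borel" for k n by simp
  have "{x. dir_diff f v x} = (\<Inter>k. \<Union>n. A k n)"
    unfolding A_def by (auto simp: dir_diff_iff_Cauchy)
  also have "\<dots> \<in> sets borel" by measurable
  finally show ?thesis .
qed

lemma dir_diff_AE: "AE x in lborel. dir_diff f v x"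
proof -
  have "{x. \<not> dir_diff f v x} \<in> null_sets lborel"
  proof (rule null_sets_if_null_on_lines[of _ v])
    show "{x. \<not> dir_diff f v x} \<in> sets borel"
      using dir_diff_borel[of v] by (metis Collect_neg_eq borel_comp)
    fix x
    define g where "g = (\<lambda>t. f (x + t *\<^sub>R v))"
    have "\<bar>g s - g t\<bar> \<le> (L * norm v) * \<bar>s - t\<bar>" for s t
    proof -
      have "x + s *\<^sub>R v - (x + t *\<^sub>R v) = (s - t) *\<^sub>R v" by (simp add: algebra_simps)
      then show ?thesis using lip[of "x + s *\<^sub>R v" "x + t *\<^sub>R v"] by (simp add: g_def mult_ac)
    qed
    then have neg: "negligible {t. \<not> g differentiable (at t)}"
      using L by (intro lipschitz_real_differentiable_ae[of g "L * norm v"]) auto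
    have "dir_diff f v (x + t *\<^sub>R v)" if "g differentiable (at t)" for t
    proof -
      obtain l where "(g has_real_derivative l) (at t)"
        using \<open>g differentiable (at t)\<close> unfolding real_differentiable_def by blast
      then have "(g has_real_derivative l) (at (0 + t))" by simp
      then have "((\<lambda>s. g (s + t)) has_real_derivative l) (at 0)" by (subst (asm) DERIV_shift)
      moreover have "(\<lambda>s. g (s + t)) = (\<lambda>s. f (x + t *\<^sub>R v + s *\<^sub>R v))"
        by (auto simp: g_def algebra_simps)
      ultimately show ?thesis unfolding dir_diff_def dquot_tendsto_iff by auto
    qed
    then have "{t. x + t *\<^sub>R v \<in> {x. \<not> dir_diff f v x}} \<subseteq> {t. \<not> g differentiable (at t)}" by auto
    then show "negligible {t. x + t *\<^sub>R v \<in> {x. \<not> dir_diff f v x}}" using neg negligible_subset by blast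
  qed
  then show ?thesis by (rule AE_I') auto
qed

text \<open>
  Nekvinda and Zajicek: a line in direction \<open>u\<close> meets the set below in isolated points only, since moving
  by \<open>t u\<close> and then by \<open>t v\<close> is moving by \<open>t (u + v)\<close>.
\<close>

lemma additivity_failure_null:
  fixes u v :: 'a and m :: nat
  assumes PQR: "\<bar>P + Q - R\<bar> > 3 * \<epsilon>"
  defines "A \<equiv> {x. \<forall>t. t \<noteq> 0 \<and> \<bar>t\<bar> < inverse (Suc m) \<longrightarrow>
    \<bar>dquot f u x t - P\<bar> \<le> \<epsilon> \<and> \<bar>dquot f v x t - Q\<bar> \<le> \<epsilon> \<and> \<bar>dquot f (u + v) x t - R\<bar> \<le> \<epsilon>}"
  shows "A \<in> null_sets lborel"
proof (rule null_sets_if_null_on_lines[of _ u])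
  have "closed A" unfolding A_def
    by (intro closed_Collect_all closed_Collect_imp closed_Collect_conj closed_Collect_le continuous_intros dquot_continuous) auto
  then show "A \<in> sets borel" by simp
  fix x
  define T where "T = {t. x + t *\<^sub>R u \<in> A}"
  have apart: "inverse (Suc m) \<le> \<bar>t - s\<bar>" if "s \<in> T" "t \<in> T" "s \<noteq> t" for s t
  proof (rule ccontr)
    assume "\<not> ?thesis"
    then have d: "t - s \<noteq> 0" "\<bar>t - s\<bar> < inverse (Suc m)" using that by auto
    define d where "d = t - s"
    define y where "y = x + s *\<^sub>R u"
    have yA: "y \<in> A" and zA: "y + d *\<^sub>R u \<in> A" using that by (auto simp: T_def y_def d_def algebra_simps)
    have 1: "\<bar>dquot f u y d - P\<bar> \<le> \<epsilon>" "\<bar>dquot f (u + v) y d - R\<bar> \<le> \<epsilon>" "\<bar>dquot f v (y + d *\<^sub>R u) d - Q\<bar> \<le> \<epsilon>"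
      using yA zA d unfolding A_def d_def by auto
    have "dquot f u y d + dquot f v (y + d *\<^sub>R u) d = dquot f (u + v) y d"
      by (simp add: dquot_def add_divide_distrib[symmetric] algebra_simps)
    then show False using 1 PQR by linarith
  qed
  \<comment> \<open>Distinct points of T are at least 1/(m + 1) apart, so after scaling by m + 1 no
    two share an integer cell, and T is countable.\<close>
  have "inj_on (\<lambda>t. \<lfloor>t * Suc m\<rfloor>) T"
  proof (rule inj_onI, rule ccontr)
    fix s t assume st: "s \<in> T" "t \<in> T" "\<lfloor>s * Suc m\<rfloor> = \<lfloor>t * Suc m\<rfloor>" "s \<noteq> t"
    have "\<bar>t * Suc m - s * Suc m\<bar> < 1" using st(3) by linarith
    then have "\<bar>t - s\<bar> * Suc m < 1" by (simp add: abs_mult flip: left_diff_distrib)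
    then show False using apart[OF st(1,2,4)] by (simp add: field_simps)
  qed
  then have "countable T" by (rule countable_image_inj_on[rotated]) simp
  then show "negligible {t. x + t *\<^sub>R u \<in> A}" unfolding T_def negligible_iff_null_sets
    using countable_imp_null_set_lborel null_sets_completionI by blast
qed

text \<open>If additivity fails at a point where the three derivatives exist, rational
  approximations P, Q, R of them and a rational \<epsilon> place the point in one of countably many
  sets that are null by \<open>additivity_failure_null\<close>.\<close>

lemma dir_deriv_add_AE:
  "AE x in lborel. dir_deriv f (u + v) x = dir_deriv f u x + dir_deriv f v x"
proof -
  define A where "A = (\<lambda>(m::nat, P, Q, R, \<epsilon>). {x. \<forall>t. t \<noteq> 0 \<and> \<bar>t\<bar> < inverse (Suc m) \<longrightarrow>
    \<bar>dquot f u x t - P\<bar> \<le> \<epsilon> \<and> \<bar>dquot f v x t - Q\<bar> \<le> \<epsilon> \<and> \<bar>dquot f (u + v) x t - R\<bar> \<le> \<epsilon>})"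
  define I where "I = {(m::nat, P, Q, R, \<epsilon>). P \<in> \<rat> \<and> Q \<in> \<rat> \<and> R \<in> \<rat> \<and> \<epsilon> \<in> \<rat> \<and> \<bar>P + Q - R\<bar> > 3 * (\<epsilon>::real)}"
  have cI: "countable I"
    by (rule countable_subset[of _ "UNIV \<times> \<rat> \<times> \<rat> \<times> \<rat> \<times> \<rat>"]) (auto simp: I_def intro!: countable_SIGMA countable_rat)
  have "A i \<in> null_sets lborel" if "i \<in> I" for i
    using that additivity_failure_null by (auto simp: A_def I_def)
  then have null: "(\<Union>i\<in>I. A i) \<in> null_sets lborel" using cI by (intro null_sets_UN') auto
  have AE1: "AE x in lborel. x \<notin> (\<Union>i\<in>I. A i)" using AE_not_in[OF null] .
  show ?thesis
    using AE1 dir_diff_AE[of u] dir_diff_AE[of v] dir_diff_AE[of "u + v"]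
  proof eventually_elim
    case (elim x)
    show ?case
    proof (rule ccontr)
      define a b c where "a = dir_deriv f u x" and "b = dir_deriv f v x" and "c = dir_deriv f (u + v) x"
      assume "dir_deriv f (u + v) x \<noteq> dir_deriv f u x + dir_deriv f v x"
      then have pos: "\<bar>a + b - c\<bar> > 0" by (simp add: a_def b_def c_def)
      \<comment> \<open>The defect exceeds 5 \<epsilon>, and the three approximations cost less than
        3 \<epsilon> / 2, so more than 3 \<epsilon> is left for P + Q - R.\<close>
      obtain \<epsilon> where \<epsilon>: "\<epsilon> \<in> \<rat>" "0 < \<epsilon>" "\<epsilon> < \<bar>a + b - c\<bar> / 5"
        using Rats_dense_in_real[of 0 "\<bar>a + b - c\<bar> / 5"] pos by auto
      obtain P where P: "P \<in> \<rat>" "\<bar>a - P\<bar> < \<epsilon> / 2"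
        using Rats_dense_in_real[of a "a + \<epsilon> / 2"] \<epsilon> by force
      obtain Q where Q: "Q \<in> \<rat>" "\<bar>b - Q\<bar> < \<epsilon> / 2"
        using Rats_dense_in_real[of b "b + \<epsilon> / 2"] \<epsilon> by force
      obtain R where R: "R \<in> \<rat>" "\<bar>c - R\<bar> < \<epsilon> / 2"
        using Rats_dense_in_real[of c "c + \<epsilon> / 2"] \<epsilon> by force
      have "\<bar>a + b - c\<bar> \<le> \<bar>P + Q - R\<bar> + \<bar>a - P\<bar> + \<bar>b - Q\<bar> + \<bar>c - R\<bar>" by linarith
      moreover have "5 * \<epsilon> < \<bar>a + b - c\<bar>" using \<epsilon>(3) by simp
      ultimately have "\<bar>P + Q - R\<bar> > 3 * \<epsilon>" using P(2) Q(2) R(2) by linarith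
      have ev: "\<forall>\<^sub>F t in at 0. \<bar>dquot f w x t - dir_deriv f w x\<bar> < \<epsilon> / 2" if "dir_diff f w x" for w
        using tendstoD[OF dir_deriv_tendsto[OF that], of "\<epsilon> / 2"] \<epsilon> by (simp add: dist_real_def)
      have "\<forall>\<^sub>F t in at 0. \<bar>dquot f u x t - P\<bar> \<le> \<epsilon> \<and> \<bar>dquot f v x t - Q\<bar> \<le> \<epsilon> \<and> \<bar>dquot f (u + v) x t - R\<bar> \<le> \<epsilon>"
        using ev[OF elim(2)] ev[OF elim(3)] ev[OF elim(4)]
      proof eventually_elim
        case (elim t)
        have tri: "\<bar>y - p\<bar> \<le> \<epsilon>" if "\<bar>y - z\<bar> < \<epsilon> / 2" "\<bar>z - p\<bar> < \<epsilon> / 2" for y z p using that by linarith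
        show ?case
          using tri[OF elim(1) P(2)[unfolded a_def]] tri[OF elim(2) Q(2)[unfolded b_def]]
            tri[OF elim(3) R(2)[unfolded c_def]] by blast
      qed
      then obtain d where d: "d > 0" "\<And>t. t \<noteq> 0 \<Longrightarrow> \<bar>t\<bar> < d \<Longrightarrow>
        \<bar>dquot f u x t - P\<bar> \<le> \<epsilon> \<and> \<bar>dquot f v x t - Q\<bar> \<le> \<epsilon> \<and> \<bar>dquot f (u + v) x t - R\<bar> \<le> \<epsilon>"
        by (auto simp: eventually_at dist_real_def)
      obtain m where m: "inverse (real (Suc m)) < d" using reals_Archimedean[OF d(1)] by blast
      have "x \<in> A (m, P, Q, R, \<epsilon>)" unfolding A_def using d(2) m by auto
      moreover have "(m, P, Q, R, \<epsilon>) \<in> I"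
        using P Q R \<epsilon> \<open>\<bar>P + Q - R\<bar> > 3 * \<epsilon>\<close> by (simp add: I_def)
      ultimately show False using elim(1) by blast
    qed
  qed
qed

text \<open>Finitely many directions of V approximate the compact unit sphere, and for finitely many
  the quotients converge uniformly. The Lipschitz bound transfers the estimate to neighbouring
  directions.\<close>

lemma differentiable_if_dir_deriv_linear:
  assumes V: "\<And>w. w \<in> closure V" and dd: "\<And>v. v \<in> V \<Longrightarrow> dir_diff f v x \<and> dir_deriv f v x = v \<bullet> G"
  shows "f differentiable (at x)"
proof -
  have "(f has_derivative (\<lambda>w. w \<bullet> G)) (at x)"
    unfolding has_derivative_at_alt
  proof (intro conjI allI impI)
    show "bounded_linear (\<lambda>w. w \<bullet> G)" by (rule bounded_linear_inner_left)
    fix e :: real assume e: "e > 0"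
    \<comment> \<open>The denominator collects three errors: L for moving the argument of f, 1 for
      the quotient in a direction of the finite net, and |G| for the linear part.\<close>
    define \<epsilon> where "\<epsilon> = e / (L + 1 + norm G)"
    have den: "L + 1 + norm G > 0" using L norm_ge_zero[of G] by linarith
    have \<epsilon>: "\<epsilon> > 0" "\<epsilon> * (L + 1 + norm G) = e" using e den by (auto simp: \<epsilon>_def)
    have "sphere (0::'a) 1 \<subseteq> (\<Union>v\<in>V. ball v \<epsilon>)"
    proof
      fix w :: 'a
      obtain v where "v \<in> V" "dist v w < \<epsilon>" using V[of w] \<epsilon>(1) closure_approachable by blast
      then show "w \<in> (\<Union>v\<in>V. ball v \<epsilon>)" by auto
    qed
    then obtain C where C: "C \<subseteq> V" "finite C" "sphere (0::'a) 1 \<subseteq> (\<Union>v\<in>C. ball v \<epsilon>)"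
      using compactE_image[of "sphere 0 1" V "\<lambda>v. ball v \<epsilon>"] compact_sphere by (metis open_ball)
    have "\<forall>\<^sub>F t in at 0. \<bar>dquot f v x t - v \<bullet> G\<bar> < \<epsilon>" if "v \<in> C" for v
      using tendstoD[OF dir_deriv_tendsto, of f v x \<epsilon>] dd[of v] C(1) that \<epsilon> by (auto simp: dist_real_def)
    then have "\<forall>\<^sub>F t in at 0. \<forall>v\<in>C. \<bar>dquot f v x t - v \<bullet> G\<bar> < \<epsilon>"
      using C(2) by (simp add: eventually_ball_finite_distrib)
    then obtain d where d: "d > 0" "\<And>t v. t \<noteq> 0 \<Longrightarrow> \<bar>t\<bar> < d \<Longrightarrow> v \<in> C \<Longrightarrow> \<bar>dquot f v x t - v \<bullet> G\<bar> < \<epsilon>"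
      by (auto simp: eventually_at dist_real_def)
    show "\<exists>d>0. \<forall>y. norm (y - x) < d \<longrightarrow> norm (f y - f x - (y - x) \<bullet> G) \<le> e * norm (y - x)"
    proof (intro exI[of _ d] conjI d(1) allI impI)
      fix y assume yd: "norm (y - x) < d"
      show "norm (f y - f x - (y - x) \<bullet> G) \<le> e * norm (y - x)"
      proof (cases "y = x")
        case False
        define t where "t = norm (y - x)"
        define w where "w = (y - x) /\<^sub>R t"
        have t: "t > 0" "t < d" using False yd by (auto simp: t_def)
        have y: "y = x + t *\<^sub>R w" and nw: "norm w = 1" using t False by (auto simp: w_def t_def)
        obtain v where v: "v \<in> C" "norm (w - v) < \<epsilon>"
          using C(3) nw by (force simp: dist_norm norm_minus_commute)
        have "\<bar>f (x + t *\<^sub>R w) - f (x + t *\<^sub>R v)\<bar> \<le> L * (t * norm (w - v))"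
          using lip[of "x + t *\<^sub>R w" "x + t *\<^sub>R v"] t by (simp add: scaleR_diff_right[symmetric])
        also have "\<dots> \<le> L * (t * \<epsilon>)" using v L t by (intro mult_left_mono) auto
        finally have 1: "\<bar>f (x + t *\<^sub>R w) - f (x + t *\<^sub>R v)\<bar> \<le> t * (\<epsilon> * L)" by (simp add: mult_ac)
        have "f (x + t *\<^sub>R v) - f x - t * (v \<bullet> G) = t * (dquot f v x t - v \<bullet> G)"
        proof -
          have "t * dquot f v x t = f (x + t *\<^sub>R v) - f x" using t by (simp add: dquot_def)
          then show ?thesis by (simp add: right_diff_distrib)
        qed
        then have "\<bar>f (x + t *\<^sub>R v) - f x - t * (v \<bullet> G)\<bar> = t * \<bar>dquot f v x t - v \<bullet> G\<bar>"
          using t by (simp add: abs_mult)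
        also have "\<dots> \<le> t * \<epsilon>" using d(2)[of t v] t v by (intro mult_left_mono) auto
        finally have 2: "\<bar>f (x + t *\<^sub>R v) - f x - t * (v \<bullet> G)\<bar> \<le> t * \<epsilon>" .
        have "\<bar>(v - w) \<bullet> G\<bar> \<le> norm (v - w) * norm G" by (rule Cauchy_Schwarz_ineq2)
        also have "\<dots> \<le> \<epsilon> * norm G" using v by (intro mult_right_mono) (auto simp: norm_minus_commute)
        finally have "t * \<bar>(v - w) \<bullet> G\<bar> \<le> t * (\<epsilon> * norm G)" using t by (intro mult_left_mono) auto
        then have 3: "\<bar>t * (v \<bullet> G) - t * (w \<bullet> G)\<bar> \<le> t * (\<epsilon> * norm G)"
          using t by (simp add: abs_mult inner_diff_left flip: right_diff_distrib)
        have "\<bar>f y - f x - t * (w \<bullet> G)\<bar> \<le> t * (\<epsilon> * L) + t * \<epsilon> + t * (\<epsilon> * norm G)"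
          using 1 2 3 unfolding y by linarith
        also have "\<dots> = e * t" unfolding \<epsilon>(2)[symmetric] by (simp add: algebra_simps)
        finally show ?thesis by (simp add: y t_def[symmetric])
          (use nw t in simp)
      qed simp
    qed
  qed
  then show ?thesis unfolding differentiable_def by blast
qed

text \<open>V consists of the vectors with rational coordinates. It is countable, so one null set
  settles all directions and all sums; it is closed under the sums that express a vector in
  coordinates; and it is dense.\<close>

theorem rademacher: "AE x in lborel. f differentiable (at x)"
proof -
  define V where "V = {v::'a. \<forall>b\<in>Basis. v \<bullet> b \<in> \<rat>}"
  have "V \<subseteq> (\<lambda>g. \<Sum>b\<in>Basis. g b *\<^sub>R b) ` (Pi\<^sub>E Basis (\<lambda>_. \<rat>))"
  proof
    fix v assume "v \<in> V"
    then have "v = (\<Sum>b\<in>Basis. (restrict (\<lambda>b. v \<bullet> b) Basis) b *\<^sub>R b)" "restrict (\<lambda>b. v \<bullet> b) Basis \<in> Pi\<^sub>E Basis (\<lambda>_. \<rat>)"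
      by (auto simp: V_def euclidean_representation)
    then show "v \<in> (\<lambda>g. \<Sum>b\<in>Basis. g b *\<^sub>R b) ` (Pi\<^sub>E Basis (\<lambda>_. \<rat>))" by blast
  qed
  moreover have "countable (Pi\<^sub>E Basis (\<lambda>_. \<rat>) :: ('a \<Rightarrow> real) set)"
    by (intro countable_PiE countable_rat) auto
  ultimately have cV: "countable V" using countable_image countable_subset by blast
  have "(\<Union>g \<in> Basis \<rightarrow> \<rat>. {\<Sum>i::'a \<in> Basis. g i *\<^sub>R i}) \<subseteq> V"
    by (auto simp: V_def)
  then have clV: "w \<in> closure V" for w
    using closure_mono closure_rational_coordinates by blast
  have "AE x in lborel. \<forall>v\<in>V. dir_diff f v x"
    using cV dir_diff_AE by (simp add: AE_ball_countable)
  moreover have "AE x in lborel. \<forall>u\<in>V. \<forall>v\<in>V. dir_deriv f (u + v) x = dir_deriv f u x + dir_deriv f v x"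
    using cV dir_deriv_add_AE by (simp add: AE_ball_countable)
  ultimately show ?thesis
  proof eventually_elim
    case (elim x)
    define G where "G = (\<Sum>b\<in>Basis. dir_deriv f b x *\<^sub>R b)"
    have zero: "dir_deriv f 0 x = 0"
      by (rule dir_deriv_eq) (simp add: dquot_def[abs_def])
    have "dir_deriv f v x = v \<bullet> G" if v: "v \<in> V" for v
    proof -
      \<comment> \<open>Coordinates are added one at a time, so that every partial sum stays in V,
        where additivity is available.\<close>
      have "dir_deriv f (\<Sum>b\<in>S. (v \<bullet> b) *\<^sub>R b) x = (\<Sum>b\<in>S. (v \<bullet> b) * dir_deriv f b x)" if "finite S" "S \<subseteq> Basis" for S
        using that
      proof (induction S rule: finite_induct)
        case (insert b S)
        have b: "b \<in> Basis" using insert by simp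
        have inV: "(\<Sum>b\<in>S. (v \<bullet> b) *\<^sub>R b) \<in> V" "(v \<bullet> b) *\<^sub>R b \<in> V" "b \<in> V"
          using insert.prems v b unfolding V_def
          by (auto simp: inner_sum_left inner_Basis intro!: Rats_sum Rats_mult)
        have "dir_deriv f ((v \<bullet> b) *\<^sub>R b + (\<Sum>b\<in>S. (v \<bullet> b) *\<^sub>R b)) x =
            dir_deriv f ((v \<bullet> b) *\<^sub>R b) x + dir_deriv f (\<Sum>b\<in>S. (v \<bullet> b) *\<^sub>R b) x"
          using elim(2) inV by blast
        also have "dir_deriv f ((v \<bullet> b) *\<^sub>R b) x = (v \<bullet> b) * dir_deriv f b x"
          using elim(1) inV by (intro dir_diff_scale) blast
        finally show ?case using insert by simp
      qed (simp add: zero)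
      from this[of Basis] show ?thesis
        by (simp add: euclidean_representation G_def inner_sum_right mult.commute)
    qed
    then show ?case using differentiable_if_dir_deriv_linear[OF clV] elim(1) by blast
  qed
qed

section \<open>From a bound on the gradient to a Lipschitz bound\<close>

lemma dquot_grad_tendsto:
  assumes "f differentiable (at x)"
  shows "(dquot f v x \<longlongrightarrow> grad f x \<bullet> v) (at 0)"
  using directional_has_real_derivative[of f x 0 v] assms
  by (simp add: dquot_tendsto_iff pd_eq_grad_inner)

text \<open>The segment from x0 to x0 + v may lie in the exceptional null set, so the increment is
  averaged over a ball B of starting points. A violation at x0 persists on a small B by continuity,
  whereas the average F over B + s v is differentiable in s with derivative at most \<kappa> |v|
  |B|.\<close>

lemma lipschitz_if_grad_bound:
  assumes AE: "AE x in lborel. f differentiable (at x) \<and> norm (grad f x) \<le> \<kappa>"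
  shows "f (x0 + v) - f x0 \<le> \<kappa> * norm v"
proof (rule ccontr)
  assume "\<not> ?thesis"
  then have gt: "f (x0 + v) - f x0 > \<kappa> * norm v" by simp
  define m where "m = (f (x0 + v) - f x0 + \<kappa> * norm v) / 2"
  have m: "\<kappa> * norm v < m" "m < f (x0 + v) - f x0" using gt by (auto simp: m_def)
  have cs: "continuous_on S (\<lambda>x. f (x + w))" for w S
    by (rule continuous_on_compose2[OF lip_continuous[of UNIV]]) (auto intro!: continuous_intros)
  have "open {x. m < f (x + v) - f x}"
    using cs lip_continuous by (intro open_Collect_less continuous_intros) auto
  moreover have "x0 \<in> {x. m < f (x + v) - f x}" using m by simp
  ultimately obtain r where r: "r > 0" "cball x0 r \<subseteq> {x. m < f (x + v) - f x}"
    using open_contains_cball by blast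
  define B where "B = cball x0 r"
  have iB: "integrable lborel (\<lambda>x. indicator B x * g x)" if "continuous_on B g" for g :: "'a \<Rightarrow> real"
    using borel_integrable_compact[of B g] that by (simp add: B_def)
  define F where "F = (\<lambda>s. integral\<^sup>L lborel (\<lambda>x. indicator B x * f (x + s *\<^sub>R v)))"
  \<comment> \<open>A Borel function that equals grad f . v wherever f is differentiable; the
    derivative itself has unspecified values elsewhere.\<close>
  define G where "G = (\<lambda>x. lim (\<lambda>n. dquot f v x (inverse (real (Suc n)))))"
  have md: "(\<lambda>x. dquot f v x t) \<in> borel_measurable borel" for t
    using dquot_continuous by (rule borel_measurable_continuous_onI)
  have mG: "G \<in> borel_measurable borel"
    unfolding G_def using md by (intro borel_measurable_lim_metric) auto
  have Ggrad: "G x = grad f x \<bullet> v" if "f differentiable (at x)" for x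
  proof -
    have "filterlim (\<lambda>n. inverse (real (Suc n))) (at 0) sequentially"
      unfolding filterlim_at using LIMSEQ_inverse_real_of_nat by auto
    then have "(\<lambda>n. dquot f v x (inverse (real (Suc n)))) \<longlonglongrightarrow> grad f x \<bullet> v"
      by (rule filterlim_compose[OF dquot_grad_tendsto[OF that]])
    then show ?thesis unfolding G_def by (rule limI)
  qed
  have AE_shift: "AE x in lborel. f differentiable (at (x + w)) \<and> norm (grad f (x + w)) \<le> \<kappa>" for w
  proof -
    obtain N where "{x \<in> space lborel. \<not> (f differentiable (at x) \<and> norm (grad f x) \<le> \<kappa>)} \<subseteq> N"
      "emeasure lborel N = 0" "N \<in> sets lborel"
      using AE_E[OF AE] by blast
    then have N: "N \<in> null_sets lborel" "{x. \<not> (f differentiable (at x) \<and> norm (grad f x) \<le> \<kappa>)} \<subseteq> N"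
      by (auto simp: null_sets_def)
    have "emeasure lborel ((\<lambda>x. w + x) -` N) = emeasure (distr lborel borel ((+) w)) N"
      using N(1) by (subst emeasure_distr) auto
    also have "\<dots> = 0" using N(1) by (simp add: lborel_distr_plus null_sets_def)
    finally have "(\<lambda>x. w + x) -` N \<in> null_sets lborel"
      using N(1) measurable_sets[of "\<lambda>x. w + x" borel borel N] by (auto simp: null_sets_def)
    then show ?thesis by (rule AE_I') (use N(2) in \<open>auto simp: add.commute\<close>)
  qed
  define D where "D = (\<lambda>s. integral\<^sup>L lborel (\<lambda>x. indicator B x * G (x + s *\<^sub>R v)))"
  have mI: "(\<lambda>x. indicator B x :: real) \<in> borel_measurable borel"
    by (rule borel_measurable_indicator) (simp add: B_def)
  have intI: "integrable lborel (\<lambda>x. indicator B x * (c::real))" for c by (intro iB continuous_on_const)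
  have mGs: "(\<lambda>x. indicator B x * G (x + s *\<^sub>R v)) \<in> borel_measurable lborel" for s
    using mG mI by measurable
  have Gbound: "AE x in lborel. \<bar>G (x + s *\<^sub>R v)\<bar> \<le> \<kappa> * norm v" for s
    using AE_shift[of "s *\<^sub>R v"]
  proof eventually_elim
    case (elim x)
    have "\<bar>grad f (x + s *\<^sub>R v) \<bullet> v\<bar> \<le> norm (grad f (x + s *\<^sub>R v)) * norm v" by (rule Cauchy_Schwarz_ineq2)
    also have "\<dots> \<le> \<kappa> * norm v" using elim by (intro mult_right_mono) auto
    finally show ?case using Ggrad elim by simp
  qed
  have der: "(F has_real_derivative D s) (at s)" for s
    unfolding DERIV_def tendsto_at_iff_sequentially
  proof (intro allI impI)
    fix X :: "nat \<Rightarrow> real" assume X: "\<forall>i. X i \<in> UNIV - {0}" "X \<longlonglongrightarrow> 0"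
    have eq: "((\<lambda>h. (F (s + h) - F s) / h) \<circ> X) n = integral\<^sup>L lborel (\<lambda>x. indicator B x * dquot f v (x + s *\<^sub>R v) (X n))" for n
    proof -
      have "integral\<^sup>L lborel (\<lambda>x. indicator B x * dquot f v (x + s *\<^sub>R v) (X n)) =
          integral\<^sup>L lborel (\<lambda>x. (indicator B x * f (x + (s + X n) *\<^sub>R v) - indicator B x * f (x + s *\<^sub>R v)) / X n)"
        by (intro Bochner_Integration.integral_cong) (auto simp: dquot_def algebra_simps diff_divide_distrib)
      also have "\<dots> = (F (s + X n) - F s) / X n"
        unfolding F_def by (simp add: Bochner_Integration.integral_diff iB cs)
      finally show ?thesis by simp
    qed
    have Xat: "filterlim X (at 0) sequentially"
      using X unfolding filterlim_at by auto
    have "(\<lambda>n. integral\<^sup>L lborel (\<lambda>x. indicator B x * dquot f v (x + s *\<^sub>R v) (X n))) \<longlonglongrightarrow> D s"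
      unfolding D_def
    proof (rule integral_dominated_convergence[where w = "\<lambda>x. indicator B x * (L * norm v)"])
      show "(\<lambda>x. indicator B x * G (x + s *\<^sub>R v)) \<in> borel_measurable lborel" by (rule mGs)
      show "(\<lambda>x. indicator B x * dquot f v (x + s *\<^sub>R v) (X n)) \<in> borel_measurable lborel" for n
        using md[of "X n"] mI by measurable
      show "integrable lborel (\<lambda>x. indicator B x * (L * norm v))" by (rule intI)
      show "AE x in lborel. (\<lambda>n. indicator B x * dquot f v (x + s *\<^sub>R v) (X n)) \<longlonglongrightarrow> indicator B x * G (x + s *\<^sub>R v)"
        using AE_shift[of "s *\<^sub>R v"]
      proof eventually_elim
        case (elim x)
        then have "(dquot f v (x + s *\<^sub>R v) \<longlongrightarrow> G (x + s *\<^sub>R v)) (at 0)"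
          using dquot_grad_tendsto Ggrad by simp
        from filterlim_compose[OF this Xat] show ?case by (intro tendsto_intros)
      qed
      show "AE x in lborel. norm (indicator B x * dquot f v (x + s *\<^sub>R v) (X n)) \<le> indicator B x * (L * norm v)" for n
        using dquot_bound[of v _ "X n"] by (auto simp: indicator_def)
    qed
    moreover have "((\<lambda>h. (F (s + h) - F s) / h) \<circ> X) =
        (\<lambda>n. integral\<^sup>L lborel (\<lambda>x. indicator B x * dquot f v (x + s *\<^sub>R v) (X n)))"
      using eq by (rule ext)
    ultimately show "((\<lambda>h. (F (s + h) - F s) / h) \<circ> X) \<longlonglongrightarrow> D s" by (simp only:)
  qed
  obtain \<xi> where \<xi>: "F 1 - F 0 = (1 - 0) * D \<xi>"
    using MVT2[of 0 1 F D] der by auto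
  have "D \<xi> \<le> integral\<^sup>L lborel (\<lambda>x. indicator B x * (\<kappa> * norm v))"
    unfolding D_def
  proof (rule integral_mono_AE)
    show "integrable lborel (\<lambda>x. indicator B x * G (x + \<xi> *\<^sub>R v))"
    proof (rule Bochner_Integration.integrable_bound[OF intI mGs])
      show "AE x in lborel. norm (indicator B x * G (x + \<xi> *\<^sub>R v)) \<le> norm (indicator B x * (\<kappa> * norm v))"
        using Gbound[of \<xi>] by eventually_elim (auto simp: indicator_def)
    qed
    show "AE x in lborel. indicator B x * G (x + \<xi> *\<^sub>R v) \<le> indicator B x * (\<kappa> * norm v)"
      using Gbound[of \<xi>] by eventually_elim (auto simp: indicator_def)
  qed (rule intI)
  moreover have "integral\<^sup>L lborel (\<lambda>x. indicator B x * m) \<le> F 1 - F 0"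
  proof -
    have "F 1 - F 0 = integral\<^sup>L lborel (\<lambda>x. indicator B x * (f (x + v) - f x))"
      unfolding F_def using iB[OF cs[of B v]] iB[OF lip_continuous[of B]] by (simp add: right_diff_distrib)
    moreover have "integral\<^sup>L lborel (\<lambda>x. indicator B x * m) \<le> integral\<^sup>L lborel (\<lambda>x. indicator B x * (f (x + v) - f x))"
      using r(2) by (intro integral_mono intI iB continuous_intros cs lip_continuous)
        (auto simp: B_def indicator_def subset_eq intro: less_imp_le)
    ultimately show ?thesis by simp
  qed
  ultimately have "measure lborel B * m \<le> measure lborel B * (\<kappa> * norm v)"
    using \<xi> by (simp add: B_def)
  moreover have "measure lborel B > 0" using r(1) content_cball_pos[of r x0] by (simp add: B_def)
  ultimately show False using m(1) by simp
qed

text \<open>\<open>real_of_ereal\<close> sends infinite values to 0, so the essential supremum is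
  first shown to lie between 0 and L. The norm of the gradient is measurable because it agrees
  almost everywhere with that of a limit of difference quotients and Lebesgue measure is
  complete.\<close>

lemma grad_Linf_AE:
  "AE x in lborel. f differentiable (at x) \<and> norm (grad f x) \<le> grad_Linf f" "0 \<le> grad_Linf f"
proof -
  let ?g = "\<lambda>x. ereal (norm (grad f x))"
  have grad_L: "norm (grad f x) \<le> L" if "f differentiable (at x)" for x
  proof -
    have "\<bar>grad f x \<bullet> grad f x\<bar> \<le> L * norm (grad f x)"
      by (rule tendsto_upperbound[OF tendsto_rabs[OF dquot_grad_tendsto[OF that]]]) (auto simp: dquot_bound)
    then have "norm (grad f x) * norm (grad f x) \<le> L * norm (grad f x)" by (simp add: dot_square_norm power2_eq_square)
    then show ?thesis using L by (cases "grad f x = 0") auto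
  qed
  define G where "G = (\<lambda>x. \<Sum>b\<in>Basis. lim (\<lambda>n. dquot f b x (inverse (real (Suc n)))) *\<^sub>R b)"
  have mG: "G \<in> borel_measurable borel"
    unfolding G_def
    by (intro borel_measurable_sum borel_measurable_scaleR borel_measurable_lim_metric
        borel_measurable_continuous_onI[OF dquot_continuous] borel_measurable_const)
  have Ggrad: "grad f x = G x" if "f differentiable (at x)" for x
  proof -
    have "lim (\<lambda>n. dquot f b x (inverse (real (Suc n)))) = grad f x \<bullet> b" for b
    proof -
      have "filterlim (\<lambda>n. inverse (real (Suc n))) (at 0) sequentially"
        unfolding filterlim_at using LIMSEQ_inverse_real_of_nat by auto
      then have "(\<lambda>n. dquot f b x (inverse (real (Suc n)))) \<longlonglongrightarrow> grad f x \<bullet> b"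
        by (rule filterlim_compose[OF dquot_grad_tendsto[OF that]])
      then show ?thesis by (rule limI)
    qed
    then show ?thesis unfolding G_def by (simp add: euclidean_representation)
  qed
  have rad: "AE x in lebesgue. f differentiable (at x)" using rademacher by (rule AE_completion)
  have mg: "?g \<in> borel_measurable lebesgue"
  proof (rule measurableI)
    fix A :: "ereal set" assume A: "A \<in> sets borel"
    have mG': "(\<lambda>x. ereal (norm (G x))) \<in> borel_measurable lebesgue"
      using mG by (intro borel_measurable_ereal borel_measurable_norm measurable_completion) simp
    show "?g -` A \<inter> space lebesgue \<in> sets lebesgue"
    proof (rule complete_measure.in_sets_AE)
      show "complete_measure (lebesgue :: 'a measure)" ..
      show "AE x in lebesgue. (x \<in> (\<lambda>x. ereal (norm (G x))) -` A \<inter> space lebesgue) = (x \<in> ?g -` A \<inter> space lebesgue)"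
        using rad by eventually_elim (simp add: Ggrad)
      show "(\<lambda>x. ereal (norm (G x))) -` A \<inter> space lebesgue \<in> sets lebesgue"
        using measurable_sets[OF mG' A] .
    qed simp
  qed simp
  define e where "e = esssup lebesgue ?g"
  have e: "grad_Linf f = real_of_ereal e" by (simp add: grad_Linf_def e_def)
  have "AE x in lebesgue. ?g x \<le> ereal L" using rad by eventually_elim (simp add: grad_L)
  then have eL: "e \<le> ereal L" unfolding e_def using mg by (intro esssup_I)
  have AEe: "AE x in lebesgue. ?g x \<le> e" unfolding e_def by (rule esssup_AE)
  have "0 \<le> e"
  proof (rule ccontr)
    assume "\<not> 0 \<le> e"
    have "AE x in (lebesgue :: 'a measure). False"
      using AEe
    proof eventually_elim
      case (elim x)
      have "0 \<le> ?g x" by simp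
      then show ?case using elim \<open>\<not> 0 \<le> e\<close> order_trans by blast
    qed
    then have "emeasure (lebesgue :: 'a measure) UNIV = 0" by (simp add: ae_filter_eq_bot_iff eventually_False)
    then show False by simp
  qed
  then obtain a where a: "e = ereal a" "0 \<le> a" using eL by (cases e) auto
  show "0 \<le> grad_Linf f" using e a by simp
  have "AE x in lebesgue. f differentiable (at x) \<and> norm (grad f x) \<le> grad_Linf f"
    using rad AEe by eventually_elim (simp add: e a)
  then show "AE x in lborel. f differentiable (at x) \<and> norm (grad f x) \<le> grad_Linf f"
    by (simp only: AE_completion_iff)
qed

end

text \<open>Turns the essential bounds from which \<open>lipschitz_constant\<close> is formed into a
  bound for all pairs of points, which is what fitting a cone above a graph requires.\<close>

theorem grad_Linf_lipschitz:
  fixes f :: "'a::euclidean_space \<Rightarrow> real"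
  assumes "\<exists>L. L-lipschitz_on UNIV f"
  shows "\<bar>f x - f y\<bar> \<le> grad_Linf f * norm (x - y)" "0 \<le> grad_Linf f"
proof -
  obtain L where L: "L-lipschitz_on UNIV f" using assms by blast
  have lip: "\<bar>f x - f y\<bar> \<le> L * norm (x - y)" for x y
    using lipschitz_onD[OF L, of x y] by (simp add: dist_norm)
  have L0: "L \<ge> 0" using L by (rule lipschitz_on_nonneg)
  note b = lipschitz_if_grad_bound[OF lip L0 grad_Linf_AE(1)[OF lip L0]]
  show "\<bar>f x - f y\<bar> \<le> grad_Linf f * norm (x - y)"
    using b[of y "x - y"] b[of x "y - x"] by (simp add: norm_minus_commute abs_le_iff)
  show "0 \<le> grad_Linf f" by (rule grad_Linf_AE(2)[OF lip L0])
qed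

section \<open>Integrability of powers of the height\<close>

lemma emeasure_lborel_shift:
  fixes c :: "'a::euclidean_space"
  assumes "A \<in> sets borel"
  shows "emeasure lborel ((\<lambda>x. c + x) -` A) = emeasure lborel A" "(\<lambda>x. c + x) -` A \<in> sets borel"
proof -
  have "emeasure lborel ((\<lambda>x. c + x) -` A) = emeasure (distr lborel borel ((+) c)) A"
    using assms by (subst emeasure_distr) auto
  then show "emeasure lborel ((\<lambda>x. c + x) -` A) = emeasure lborel A" by (simp add: lborel_distr_plus)
  show "(\<lambda>x. c + x) -` A \<in> sets borel"
    using measurable_sets[of "\<lambda>x. c + x" borel borel A] assms by simp
qed

text \<open>The translates of a slab by multiples of its height are disjoint.\<close>

lemma slab_emeasure:
  fixes T :: "'a::euclidean_space \<Rightarrow> real" and R :: real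
  assumes T: "continuous_on UNIV T" "\<And>x t. T (x + t *\<^sub>R e) = T x + t"
  defines "A \<equiv> \<lambda>k::nat. {x \<in> ball 0 R. (1/2) ^ Suc k < T x \<and> T x \<le> (1/2) ^ k}"
  shows "emeasure lborel (A k) \<le> ennreal ((1/2) ^ k) * emeasure lborel (ball (0::'a) (R + norm e))"
    "A k \<in> sets borel"
proof -
  have mT: "T \<in> borel_measurable borel" using T(1) by (rule borel_measurable_continuous_onI)
  have "A k = ball 0 R \<inter> {x. (1/2) ^ Suc k < T x} \<inter> {x. T x \<le> (1/2) ^ k}" by (auto simp: A_def)
  moreover have "{x. (1/2) ^ Suc k < T x} \<in> sets borel"
    using T(1) by (intro borel_open open_Collect_less) auto
  moreover have "{x. T x \<le> (1/2) ^ k} \<in> sets borel"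
    using T(1) by (intro borel_closed closed_Collect_le) auto
  ultimately show A: "A k \<in> sets borel" by auto
  define d where "d = ((1/2) ^ k :: real)"
  have d: "d > 0" "2 ^ k * d = 1" by (auto simp: d_def power_mult_distrib[symmetric])
  \<comment> \<open>The translate of A k by j d e. Its heights lie between j d + d/2 and j d + d,
    which separates different j; and j d \<le> 1 for j < 2^k keeps all of them in the larger
    ball.\<close>
  define B where "B = (\<lambda>j::nat. (\<lambda>x. (- (real j * d)) *\<^sub>R e + x) -` A k)"
  have TB: "real j * d + d / 2 < T x \<and> T x \<le> real j * d + d" if "x \<in> B j" for j x
  proof -
    have "(- (real j * d)) *\<^sub>R e + x \<in> A k" using that by (simp add: B_def)
    moreover have "T ((- (real j * d)) *\<^sub>R e + x) = T x - real j * d"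
      using T(2)[of x "- (real j * d)"] by (simp add: add.commute)
    ultimately show ?thesis by (auto simp: A_def d_def)
  qed
  have disj: "disjoint_family_on B {..<2 ^ k}"
    unfolding disjoint_family_on_def
  proof (intro ballI impI)
    fix i j :: nat assume "i \<noteq> j"
    show "B i \<inter> B j = {}"
    proof (rule ccontr)
      assume "B i \<inter> B j \<noteq> {}"
      then obtain x where "x \<in> B i" "x \<in> B j" by blast
      then have "real i * d < real (Suc j) * d" "real j * d < real (Suc i) * d"
        using TB[of x i] TB[of x j] d(1) by (auto simp: algebra_simps)
      then have "i < Suc j" "j < Suc i" using d(1) by (simp_all only: mult_less_cancel_right_pos of_nat_less_iff)
      then show False using \<open>i \<noteq> j\<close> by simp
    qed
  qed
  have sub: "B j \<subseteq> ball 0 (R + norm e)" if "j < 2 ^ k" for j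
  proof
    fix x assume "x \<in> B j"
    then have 1: "norm ((- (real j * d)) *\<^sub>R e + x) < R" by (simp add: B_def A_def)
    have "real j \<le> 2 ^ k" using that by (metis less_imp_le of_nat_le_iff of_nat_numeral of_nat_power)
    then have "real j * d \<le> 1" using d mult_right_mono[of "real j" "2 ^ k" d] by simp
    then have "norm ((real j * d) *\<^sub>R e) \<le> norm e" using d(1) by (simp add: mult_left_le_one_le)
    then show "x \<in> ball 0 (R + norm e)"
      using 1 norm_triangle_ineq[of "(- (real j * d)) *\<^sub>R e + x" "(real j * d) *\<^sub>R e"] by simp
  qed
  have mB: "B j \<in> sets lborel" "emeasure lborel (B j) = emeasure lborel (A k)" for j
    unfolding B_def sets_lborel by (rule emeasure_lborel_shift[OF A])+
  have "ennreal (2 ^ k) * emeasure lborel (A k) = (\<Sum>j<2 ^ k. emeasure lborel (B j))"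
    by (simp add: mB ennreal_power[symmetric] flip: ennreal_numeral ennreal_of_nat_eq_real_of_nat)
  also have "\<dots> = emeasure lborel (\<Union>j<2 ^ k. B j)"
    using mB disj by (intro sum_emeasure) auto
  also have "\<dots> \<le> emeasure lborel (ball (0::'a) (R + norm e))"
    using sub by (intro emeasure_mono) auto
  finally have "ennreal d * (ennreal (2 ^ k) * emeasure lborel (A k)) \<le> ennreal d * emeasure lborel (ball (0::'a) (R + norm e))"
    by (rule mult_left_mono) simp
  moreover have "ennreal d * ennreal (2 ^ k) = 1"
    using d by (simp add: ennreal_mult[symmetric] mult.commute)
  ultimately show "emeasure lborel (A k) \<le> ennreal ((1/2) ^ k) * emeasure lborel (ball (0::'a) (R + norm e))"
    by (simp add: mult.assoc[symmetric] d_def)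
qed

text \<open>Dyadic layers: the k-th has measure of order 2^(-k), and the integrand there is of order
  2^(\<gamma> k), so the sum is a geometric series of ratio 2^(\<gamma> - 1) < 1.\<close>

lemma nn_integral_height_power:
  fixes T :: "'a::euclidean_space \<Rightarrow> real"
  assumes T: "continuous_on UNIV T" "\<And>x t. T (x + t *\<^sub>R e) = T x + t"
    and \<gamma>: "0 \<le> \<gamma>" "\<gamma> < 1" and S: "S \<subseteq> ball 0 R" "\<And>x. x \<in> S \<Longrightarrow> 0 < T x \<and> T x \<le> 1"
  shows "(\<integral>\<^sup>+x. indicator S x * ennreal (T x powr - \<gamma>) \<partial>lborel) < \<infinity>"
proof -
  define A where "A = (\<lambda>k::nat. {x \<in> ball 0 R. (1/2) ^ Suc k < T x \<and> T x \<le> (1/2) ^ k})"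
  define M where "M = measure lborel (ball (0::'a) (R + norm e))"
  have M: "emeasure lborel (ball (0::'a) (R + norm e)) = ennreal M"
    unfolding M_def using emeasure_lborel_ball_finite[of "0::'a" "R + norm e"]
    by (intro emeasure_eq_ennreal_measure) auto
  have slab: "emeasure lborel (A k) \<le> ennreal ((1/2) ^ k) * emeasure lborel (ball (0::'a) (R + norm e))"
    and mA [measurable]: "A k \<in> sets borel" for k
    unfolding A_def by (rule slab_emeasure[OF T])+
  define c where "c = (\<lambda>k::nat. ((1/2) ^ Suc k) powr - \<gamma>)"
  have "indicator S x * ennreal (T x powr - \<gamma>) \<le> (\<Sum>k. indicator (A k) x * ennreal (c k))" for x
  proof (cases "x \<in> S")
    case True
    then have Tx: "0 < T x" "T x \<le> 1" "x \<in> ball 0 R" using S by auto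
    have "\<exists>k. (1/2) ^ Suc k < T x"
    proof -
      obtain k where "(1/2) ^ k < T x" using real_arch_pow_inv[OF Tx(1), of "1/2"] by auto
      moreover have "(1/2::real) ^ Suc k \<le> (1/2) ^ k" by simp
      ultimately show ?thesis by (intro exI[of _ k]) linarith
    qed
    then obtain k where k: "(1/2) ^ Suc k < T x" "\<And>j. j < k \<Longrightarrow> \<not> (1/2) ^ Suc j < T x"
      using exists_least_iff[of "\<lambda>k. (1/2) ^ Suc k < T x"] by blast
    \<comment> \<open>For k = 0 this is the assumption T x \<le> 1, otherwise it is the minimality
      of k.\<close>
    have "T x \<le> (1/2) ^ k" using k(2)[of "k - 1"] Tx by (cases k) auto
    then have xA: "x \<in> A k" using k Tx by (simp add: A_def)
    have "T x powr - \<gamma> \<le> c k" unfolding c_def using k(1) \<gamma> by (intro powr_mono2') auto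
    then have "indicator S x * ennreal (T x powr - \<gamma>) \<le> indicator (A k) x * ennreal (c k)"
      using True xA by (simp add: ennreal_leI)
    also have "\<dots> = (\<Sum>i\<in>{k}. indicator (A i) x * ennreal (c i))"
      by (simp only: sum.insert[OF finite.emptyI empty_iff[THEN iffD1, THEN notI]] sum.empty add_0_right)
    also have "\<dots> \<le> (\<Sum>k. indicator (A k) x * ennreal (c k))" by (intro sum_le_suminf) auto
    finally show ?thesis .
  qed simp
  then have "(\<integral>\<^sup>+x. indicator S x * ennreal (T x powr - \<gamma>) \<partial>lborel)
      \<le> (\<integral>\<^sup>+x. (\<Sum>k. indicator (A k) x * ennreal (c k)) \<partial>lborel)" by (intro nn_integral_mono)
  also have "\<dots> = (\<Sum>k. \<integral>\<^sup>+x. indicator (A k) x * ennreal (c k) \<partial>lborel)"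
    by (intro nn_integral_suminf) measurable
  also have "\<dots> = (\<Sum>k. emeasure lborel (A k) * ennreal (c k))"
    by (intro suminf_cong, subst nn_integral_multc) (auto simp: mA)
  also have "\<dots> \<le> (\<Sum>k. ennreal ((2 powr \<gamma> * M) * (2 powr (\<gamma> - 1)) ^ k))"
  proof (intro suminf_le)
    fix k
    have "emeasure lborel (A k) * ennreal (c k) \<le> (ennreal ((1/2) ^ k) * ennreal M) * ennreal (c k)"
      using slab[of k] M by (intro mult_right_mono) auto
    also have "\<dots> = ennreal ((1/2) ^ k * M * c k)"
      by (simp add: ennreal_mult M_def c_def)
    also have "(1/2) ^ k * M * c k = (2 powr \<gamma> * M) * (2 powr (\<gamma> - 1)) ^ k"
    proof -
      have h: "(1/2::real) ^ j = 2 powr (- real j)" for j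
        by (subst powr_minus) (simp add: powr_realpow power_one_over inverse_eq_divide)
      have "c k = 2 powr (\<gamma> * real (Suc k))" unfolding c_def h by (simp add: powr_powr algebra_simps)
      then have "(1/2) ^ k * c k = 2 powr (- real k + \<gamma> * real (Suc k))" by (simp only: h powr_add)
      also have "\<dots> = 2 powr \<gamma> * 2 powr ((\<gamma> - 1) * real k)" by (simp add: powr_add[symmetric] algebra_simps)
      also have "2 powr ((\<gamma> - 1) * real k) = (2 powr (\<gamma> - 1)) ^ k"
        by (simp add: powr_powr[symmetric] powr_realpow)
      finally show ?thesis by (simp add: mult_ac)
    qed
    finally show "emeasure lborel (A k) * ennreal (c k) \<le> ennreal ((2 powr \<gamma> * M) * (2 powr (\<gamma> - 1)) ^ k)" .
  qed auto
  also have "\<dots> < \<infinity>"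
  proof -
    have "2 powr (\<gamma> - 1) < (2::real) powr 0" using \<gamma> by (intro powr_less_mono) auto
    then have "summable (\<lambda>k. (2 powr \<gamma> * M) * (2 powr (\<gamma> - 1)) ^ k)"
      by (intro summable_mult summable_geometric) simp
    then show ?thesis by (subst suminf_ennreal2) (auto simp: M_def)
  qed
  finally show ?thesis .
qed

section \<open>Lower bounds for the solution\<close>

lemma neg_power_antimono:
  assumes "0 < m" "m \<le> t" "0 \<le> \<beta>" shows "neg_power \<beta> t \<le> ennreal (m powr - \<beta>)"
  using assms by (auto simp: neg_power_def intro!: ennreal_leI powr_mono2')

lemma neg_power_measurable [measurable]: "neg_power \<beta> \<in> borel_measurable borel"
  unfolding neg_power_def[abs_def] by measurable

context
  fixes \<Omega> :: "'a::euclidean_space set" and u :: "'a \<Rightarrow> real"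
  assumes \<Omega>: "open \<Omega>" "bounded \<Omega>" and u0: "W12_0 \<Omega> u" and weak: "weak_laplacian_minus_one \<Omega> u"
begin

text \<open>Only countably many of the barriers are needed, by Lindelof's theorem.\<close>

lemma AE_ge_if_barriers:
  assumes V: "open V" "V \<subseteq> \<Omega>" and m: "continuous_on V m"
    and bar: "\<And>x. x \<in> V \<Longrightarrow> \<exists>w. test_function \<Omega> w \<and> (\<forall>y. laplacian w y \<ge> -1) \<and> m x < w x"
  shows "AE x in lebesgue_on \<Omega>. x \<in> V \<longrightarrow> m x \<le> u x"
proof -
  obtain w where w: "\<And>x. x \<in> V \<Longrightarrow> test_function \<Omega> (w x) \<and> (\<forall>y. laplacian (w x) y \<ge> -1) \<and> m x < w x x"
    using bar by metis
  \<comment> \<open>The strict inequality at x persists on this neighbourhood, so the barrier chosen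
    for x serves all points of it.\<close>
  define N where "N = (\<lambda>x. {y \<in> V. m y < w x y})"
  have oN: "open (N x)" if "x \<in> V" for x
  proof -
    have "continuous_on V (\<lambda>y. w x y - m y)"
      using w[OF that] m by (intro continuous_on_diff) (auto intro: continuous_on_subset[OF test_function_continuous])
    then have "open (V \<inter> (\<lambda>y. w x y - m y) -` {0<..})"
      using V(1) by (intro continuous_open_preimage) auto
    moreover have "V \<inter> (\<lambda>y. w x y - m y) -` {0<..} = N x" by (auto simp: N_def)
    ultimately show ?thesis by simp
  qed
  obtain F where F: "F \<subseteq> N ` V" "countable F" "\<Union>F = \<Union>(N ` V)"
    using Lindelof[of "N ` V"] oN by blast
  obtain C where C: "C \<subseteq> V" "countable C" "F = N ` C"
    using countable_subset_image[of F N V] F by metis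
  have cover: "V \<subseteq> (\<Union>x\<in>C. N x)"
    using F(3) w unfolding C(3) by (auto simp: N_def)
  have "AE y in lebesgue_on \<Omega>. \<forall>x\<in>C. w x y \<le> u y"
    using C w by (subst AE_ball_countable) (auto intro!: weak_comparison[OF \<Omega> u0 weak])
  then show ?thesis
  proof eventually_elim
    case (elim y)
    show ?case
    proof
      assume "y \<in> V"
      then obtain x where "x \<in> C" "y \<in> N x" using cover by blast
      then show "m y \<le> u y" using elim by (force simp: N_def)
    qed
  qed
qed

lemma local_interior:
  assumes "x \<in> \<Omega>" "0 \<le> \<beta>"
  obtains U where "open U" "x \<in> U" "(\<integral>\<^sup>+y. indicator U y * neg_power \<beta> (u y) \<partial>lebesgue_on \<Omega>) < \<infinity>"
proof -
  obtain w where w: "test_function \<Omega> w" "\<And>y. laplacian w y \<ge> -1" "w x > 0"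
    using interior_barrier[OF \<Omega>(1) assms(1)] by blast
  define U where "U = {y. w x / 2 < w y}"
  have oU: "open U" unfolding U_def
    using test_function_continuous[OF w(1)] by (intro open_Collect_less) auto
  have AE: "AE y in lebesgue_on \<Omega>. w y \<le> u y"
    using weak_comparison[OF \<Omega> u0 weak w(1)] w(2) by blast
  interpret finite_measure "lebesgue_on \<Omega>"
    using \<Omega> by (intro finite_measure_lebesgue_on lmeasurable_open)
  have "(\<integral>\<^sup>+y. indicator U y * neg_power \<beta> (u y) \<partial>lebesgue_on \<Omega>) \<le> (\<integral>\<^sup>+y. ennreal ((w x / 2) powr - \<beta>) \<partial>lebesgue_on \<Omega>)"
    using AE
  proof (intro nn_integral_mono_AE, eventually_elim)
    case (elim y)
    then show ?case
      using neg_power_antimono[of "w x / 2" "u y" \<beta>] w(3) assms(2) by (auto simp: indicator_def U_def)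
  qed
  also have "\<dots> < \<infinity>" by (simp add: ennreal_mult_less_top emeasure_eq_measure)
  finally show ?thesis using that[OF oU] w(3) by (auto simp: U_def)
qed

text \<open>The last assumption places a sector with its apex at x - \<eta> T(x) \<nu> inside the
  domain. Then x lies on its axis at distance \<eta> T(x), and the cone barrier gives u \<ge> c
  T^\<alpha> almost everywhere near x0. The axis \<nu> of the cones may differ from e, the direction
  in which T grows at unit rate.\<close>

lemma local_boundary:
  fixes \<nu> e :: 'a
  assumes n: "DIM('a) \<ge> 2" and \<nu>: "norm \<nu> = 1" and \<alpha>: "\<alpha> > 0" and s: "0 < s" "s < 1"
    and zs: "zonal (half_dim TYPE('a)) (\<alpha> * (\<alpha> + real DIM('a) - 2)) s = 0"
      "\<And>t. 0 \<le> t \<Longrightarrow> t < s \<Longrightarrow> zonal (half_dim TYPE('a)) (\<alpha> * (\<alpha> + real DIM('a) - 2)) t > 0"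
    and \<beta>: "0 < \<beta>" "\<alpha> * \<beta> < 1"
    and T: "continuous_on UNIV T" "\<And>x t. T (x + t *\<^sub>R e) = T x + t" "T x0 = 0"
    and \<rho>: "\<rho> > 0" "\<And>y. y \<in> ball x0 \<rho> \<Longrightarrow> y \<in> \<Omega> \<longleftrightarrow> T y > 0"
    and \<eta>: "\<eta> > 0" and \<delta>: "\<delta> > 0"
      "\<And>x z. x \<in> ball x0 \<delta> \<Longrightarrow> 0 < T x \<Longrightarrow> \<eta> * T x \<le> \<delta> \<Longrightarrow> z \<in> closed_sector \<nu> s \<delta> \<Longrightarrow> T (x - (\<eta> * T x) *\<^sub>R \<nu> + z) > 0"
  obtains U where "open U" "x0 \<in> U" "(\<integral>\<^sup>+y. indicator U y * neg_power \<beta> (u y) \<partial>lebesgue_on \<Omega>) < \<infinity>"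
proof -
  \<comment> \<open>The position of x, the shift to the apex and the sector contribute at most R,
    R/2 and R to the distance from x0, so the support of the barrier stays where the sign of T
    decides membership.\<close>
  define R where "R = min \<delta> (\<rho> / 4)"
  have R: "R > 0" "R \<le> \<delta>" "R \<le> \<rho> / 4" using \<delta> \<rho> by (auto simp: R_def)
  obtain k where k: "k > 0" "\<And>t. 0 < t \<Longrightarrow> t \<le> R / 2 \<Longrightarrow> \<exists>w. test_function (closed_sector \<nu> s R) w \<and>
        (\<forall>x. laplacian w x \<ge> -1) \<and> w (t *\<^sub>R \<nu>) \<ge> k * t powr \<alpha>"
    using cone_barrier[OF n \<nu> \<alpha> s R(1) zs] by blast
  \<comment> \<open>The bound R / (2 \<eta>) keeps \<eta> T x in the range of the cone barrier; the
    bound 1 is the height limit in \<open>nn_integral_height_power\<close>.\<close>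
  define U where "U = ball x0 R \<inter> {x. T x < min 1 (R / (2 * \<eta>))}"
  have oU: "open U" unfolding U_def
    using T(1) by (intro open_Int open_ball open_Collect_less) auto
  have x0U: "x0 \<in> U" using R \<eta> T(3) by (simp add: U_def)
  define V where "V = U \<inter> \<Omega>"
  have oV: "open V" unfolding V_def using oU \<Omega> by blast
  have V: "T x > 0" "T x < 1" "\<eta> * T x \<le> R / 2" "x \<in> ball x0 R" if "x \<in> V" for x
  proof -
    have x: "x \<in> ball x0 R" "x \<in> \<Omega>" "T x < 1" "T x < R / (2 * \<eta>)" using that by (auto simp: V_def U_def)
    then have "x \<in> ball x0 \<rho>" using R \<rho> by auto
    then show "T x > 0" using \<rho>(2) x by blast
    show "T x < 1" "x \<in> ball x0 R" using x by auto
    show "\<eta> * T x \<le> R / 2" using x(4) \<eta> by (simp add: field_simps)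
  qed
  \<comment> \<open>Half of the barrier's bound, so that the barrier exceeds m strictly at x, as the
    covering by open sets demands.\<close>
  define m where "m = (\<lambda>x. k / 2 * (\<eta> * T x) powr \<alpha>)"
  have AE_ge: "AE x in lebesgue_on \<Omega>. x \<in> V \<longrightarrow> m x \<le> u x"
  proof (rule AE_ge_if_barriers[OF oV])
    show "V \<subseteq> \<Omega>" by (simp add: V_def)
    show "continuous_on V m"
      unfolding m_def using V(1) \<eta> by (intro continuous_intros continuous_on_powr continuous_on_subset[OF T(1)]) force+
    fix x assume x: "x \<in> V"
    define t where "t = \<eta> * T x"
    have t: "0 < t" "t \<le> R / 2" using V[OF x] \<eta> by (auto simp: t_def)
    obtain w where w: "test_function (closed_sector \<nu> s R) w" "\<And>x. laplacian w x \<ge> -1" "w (t *\<^sub>R \<nu>) \<ge> k * t powr \<alpha>"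
      using k(2)[OF t] by blast
    define y where "y = x - t *\<^sub>R \<nu>"
    have "y + z \<in> \<Omega>" if z: "z \<in> closed_sector \<nu> s R" for z
    proof -
      have "z \<in> closed_sector \<nu> s \<delta>" using z R by (auto simp: closed_sector_def)
      moreover have "x \<in> ball x0 \<delta>" using V(4)[OF x] R by auto
      ultimately have pos: "T (y + z) > 0"
        using \<delta>(2)[of x z] V[OF x] R unfolding y_def t_def by auto
      have "norm (y + z - x0) \<le> norm (x - x0) + norm (t *\<^sub>R \<nu>) + norm z"
        using norm_triangle_ineq[of "x - x0 - t *\<^sub>R \<nu>" z] norm_triangle_ineq4[of "x - x0" "t *\<^sub>R \<nu>"]
        by (simp add: y_def algebra_simps)
      also have "\<dots> < R + R / 2 + R + R / 2"
        using V(4)[OF x] t z \<nu> R(1) by (auto simp: dist_norm norm_minus_commute closed_sector_def)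
      also have "\<dots> \<le> \<rho>" using R by simp
      finally have "y + z \<in> ball x0 \<rho>" by (simp add: dist_norm norm_minus_commute)
      then show ?thesis using \<rho>(2) pos by blast
    qed
    then have "test_function \<Omega> (\<lambda>x. w (x - y))" by (rule test_function_shift[OF w(1)])
    moreover have "smooth_on UNIV w" using w(1) test_function_iff by blast
    then have "laplacian (\<lambda>x. w (x - y)) z \<ge> -1" for z using laplacian_shift[of w y z] w(2) by simp
    moreover have "m x < w (x - y)"
    proof -
      have "m x < k * t powr \<alpha>" using k(1) t(1) by (simp add: m_def t_def[symmetric])
      also have "\<dots> \<le> w (x - y)" using w(3) by (simp add: y_def)
      finally show ?thesis .
    qed
    ultimately show "\<exists>w. test_function \<Omega> w \<and> (\<forall>y. laplacian w y \<ge> -1) \<and> m x < w x"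
      by (intro exI[of _ "\<lambda>x. w (x - y)"]) auto
  qed
  define c where "c = (k / 2 * \<eta> powr \<alpha>) powr - \<beta>"
  have "AE y in lebesgue_on \<Omega>. indicator U y * neg_power \<beta> (u y)
      \<le> ennreal c * (indicator V y * ennreal (T y powr - (\<alpha> * \<beta>)))"
    using AE_ge AE_space[of "lebesgue_on \<Omega>"]
  proof eventually_elim
    case (elim y)
    show ?case
    proof (cases "y \<in> V")
      case True
      have "m y > 0" using k(1) \<eta> V(1)[OF True] by (simp add: m_def)
      then have "neg_power \<beta> (u y) \<le> ennreal (m y powr - \<beta>)"
        using elim True \<beta> by (intro neg_power_antimono) auto
      also have "m y powr - \<beta> = c * T y powr - (\<alpha> * \<beta>)"
      proof -
        have "m y = (k / 2 * \<eta> powr \<alpha>) * T y powr \<alpha>"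
          using \<eta> V(1)[OF True] by (simp add: m_def powr_mult)
        then show ?thesis unfolding c_def using k(1) by (simp only: powr_mult powr_powr) simp
      qed
      finally show ?thesis using True by (simp add: V_def ennreal_mult c_def)
    next
      case False
      then show ?thesis using elim(2) by (auto simp: V_def indicator_def)
    qed
  qed
  then have "(\<integral>\<^sup>+y. indicator U y * neg_power \<beta> (u y) \<partial>lebesgue_on \<Omega>)
      \<le> (\<integral>\<^sup>+y. ennreal c * (indicator V y * ennreal (T y powr - (\<alpha> * \<beta>))) \<partial>lebesgue_on \<Omega>)"
    by (rule nn_integral_mono_AE)
  also have "\<dots> = (\<integral>\<^sup>+y. (ennreal c * (indicator V y * ennreal (T y powr - (\<alpha> * \<beta>)))) * indicator \<Omega> y \<partial>lebesgue)"
    using \<Omega>(1) by (intro nn_integral_restrict_space) auto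
  also have "\<dots> = (\<integral>\<^sup>+y. ennreal c * (indicator V y * ennreal (T y powr - (\<alpha> * \<beta>))) \<partial>lebesgue)"
    by (intro nn_integral_cong) (auto simp: V_def indicator_def)
  also have "\<dots> = (\<integral>\<^sup>+y. ennreal c * (indicator V y * ennreal (T y powr - (\<alpha> * \<beta>))) \<partial>lborel)"
    by (rule nn_integral_completion)
  also have "\<dots> = ennreal c * (\<integral>\<^sup>+y. indicator V y * ennreal (T y powr - (\<alpha> * \<beta>)) \<partial>lborel)"
  proof (rule nn_integral_cmult)
    have [measurable]: "V \<in> sets borel" "T \<in> borel_measurable borel"
      using oV borel_measurable_continuous_onI[OF T(1)] by auto
    show "(\<lambda>y. indicator V y * ennreal (T y powr - (\<alpha> * \<beta>))) \<in> borel_measurable lborel"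
      by measurable
  qed
  also have "\<dots> < \<infinity>"
  proof -
    have "V \<subseteq> ball 0 (norm x0 + R)"
    proof
      fix y assume "y \<in> V"
      then show "y \<in> ball 0 (norm x0 + R)"
        using V(4)[of y] norm_triangle_ineq[of x0 "y - x0"] by (simp add: dist_norm norm_minus_commute)
    qed
    then have "(\<integral>\<^sup>+y. indicator V y * ennreal (T y powr - (\<alpha> * \<beta>)) \<partial>lborel) < \<infinity>"
      using V \<alpha> \<beta> by (intro nn_integral_height_power[OF T(1,2)]) (auto intro: less_imp_le)
    then show ?thesis by (simp add: ennreal_mult_less_top)
  qed
  finally show ?thesis using that[OF oU x0U] by blast
qed

lemma integral_finite_if_local:
  assumes loc: "\<And>x. x \<in> closure \<Omega> \<Longrightarrow> \<exists>U. open U \<and> x \<in> U \<and>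
    (\<integral>\<^sup>+y. indicator U y * neg_power \<beta> (u y) \<partial>lebesgue_on \<Omega>) < \<infinity>"
  shows "(\<integral>\<^sup>+x. neg_power \<beta> (u x) \<partial>lebesgue_on \<Omega>) < \<infinity>"
proof -
  obtain U where U: "\<And>x. x \<in> closure \<Omega> \<Longrightarrow> open (U x) \<and> x \<in> U x \<and>
    (\<integral>\<^sup>+y. indicator (U x) y * neg_power \<beta> (u y) \<partial>lebesgue_on \<Omega>) < \<infinity>"
    using loc by metis
  have "compact (closure \<Omega>)" using \<Omega>(2) by (simp add: compact_closure)
  moreover have "closure \<Omega> \<subseteq> (\<Union>x\<in>closure \<Omega>. U x)" using U by blast
  ultimately obtain C where C: "C \<subseteq> closure \<Omega>" "finite C" "closure \<Omega> \<subseteq> (\<Union>x\<in>C. U x)"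
    using compactE_image[of "closure \<Omega>" "closure \<Omega>" U] U by metis
  have mu: "u \<in> borel_measurable (lebesgue_on \<Omega>)"
    using u0 by (auto simp: W12_0_def W12_grad_def L2_on_def)
  have mU: "(\<lambda>y. indicator (U x) y * neg_power \<beta> (u y)) \<in> borel_measurable (lebesgue_on \<Omega>)" if "x \<in> C" for x
  proof -
    have "open (U x)" using U[of x] that C(1) by auto
    then have "U x \<in> sets borel" by simp
    then have "(\<lambda>y. indicator (U x) y :: ennreal) \<in> borel_measurable lborel" by simp
    then have "(\<lambda>y. indicator (U x) y :: ennreal) \<in> borel_measurable (lebesgue_on \<Omega>)"
      by (rule measurable_restrict_space1[OF measurable_completion])
    moreover have "(\<lambda>y. neg_power \<beta> (u y)) \<in> borel_measurable (lebesgue_on \<Omega>)"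
      using measurable_compose[OF mu neg_power_measurable] .
    ultimately show ?thesis by measurable
  qed
  have "(\<integral>\<^sup>+x. neg_power \<beta> (u x) \<partial>lebesgue_on \<Omega>) \<le> (\<integral>\<^sup>+y. (\<Sum>x\<in>C. indicator (U x) y * neg_power \<beta> (u y)) \<partial>lebesgue_on \<Omega>)"
  proof (intro nn_integral_mono)
    fix y assume "y \<in> space (lebesgue_on \<Omega>)"
    then obtain x where x: "x \<in> C" "y \<in> U x" using C(3) closure_subset by (force simp: space_restrict_space)
    have "neg_power \<beta> (u y) = (\<Sum>x\<in>{x}. indicator (U x) y * neg_power \<beta> (u y))" using x by simp
    also have "\<dots> \<le> (\<Sum>x\<in>C. indicator (U x) y * neg_power \<beta> (u y))"
      using x C(2) by (intro sum_mono2) auto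
    finally show "neg_power \<beta> (u y) \<le> (\<Sum>x\<in>C. indicator (U x) y * neg_power \<beta> (u y))" .
  qed
  also have "\<dots> = (\<Sum>x\<in>C. \<integral>\<^sup>+y. indicator (U x) y * neg_power \<beta> (u y) \<partial>lebesgue_on \<Omega>)"
    using mU by (intro nn_integral_sum) auto
  also have "\<dots> < \<infinity>" using C U by (auto simp: subset_eq)
  finally show ?thesis .
qed

end

section \<open>Charts\<close>

text \<open>The height above the graph, defined on the whole space because \<phi> is; only inside
  the cylinder does its sign decide membership in the domain.\<close>

definition chart_height :: "'a::euclidean_space \<times> real \<Rightarrow> ('a \<times> real \<Rightarrow> 'a \<times> real) \<Rightarrow> ('a \<Rightarrow> real) \<Rightarrow> 'a \<times> real \<Rightarrow> real" where
  "chart_height c0 Q \<phi> x = snd (Q (x - c0)) - \<phi> (fst (Q (x - c0)))"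

lemma orthogonal_preimage:
  fixes Q :: "'a::euclidean_space \<Rightarrow> 'a"
  assumes "orthogonal_transformation Q"
  obtains v where "Q v = w" "norm v = norm w" "\<And>z. z \<bullet> v = Q z \<bullet> w"
proof -
  obtain v where v: "Q v = w" using orthogonal_transformation_surj[OF assms] by (metis surjD)
  have "norm v = norm w" using orthogonal_transformation_norm[OF assms, of v] v by simp
  moreover have "z \<bullet> v = Q z \<bullet> w" for z
    using assms v by (auto simp: orthogonal_transformation_def)
  ultimately show ?thesis using that v by blast
qed

lemma chart_height_facts:
  assumes ch: "lipschitz_chart \<Omega> c0 Q r h \<phi>"
  shows "continuous_on UNIV (chart_height c0 Q \<phi>)"
    "\<And>k. chart_height c0 Q \<phi> (x + k) = chart_height c0 Q \<phi> x + snd (Q k)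
        - (\<phi> (fst (Q (x - c0)) + fst (Q k)) - \<phi> (fst (Q (x - c0))))"
    "x \<in> frontier \<Omega> \<Longrightarrow> x \<in> cylinder c0 Q r h \<Longrightarrow> chart_height c0 Q \<phi> x = 0"
    "x \<in> cylinder c0 Q r h \<Longrightarrow> \<exists>\<rho>>0. \<forall>y\<in>ball x \<rho>. y \<in> \<Omega> \<longleftrightarrow> chart_height c0 Q \<phi> y > 0"
    "open (cylinder c0 Q r h)" "c0 \<in> cylinder c0 Q r h"
proof -
  have Q: "orthogonal_transformation Q" and rh: "r > 0" "h > 0" and lip: "\<exists>L. L-lipschitz_on UNIV \<phi>"
    using ch by (auto simp: lipschitz_chart_def)
  have lin: "linear Q" using Q by (rule orthogonal_transformation_linear)
  have cQ: "continuous_on UNIV (\<lambda>x. Q (x - c0))"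
    by (rule continuous_on_compose2[OF linear_continuous_on[OF lin[unfolded linear_conv_bounded_linear]]])
      (auto intro!: continuous_intros)
  have c\<phi>: "continuous_on UNIV (\<lambda>x. \<phi> (fst (Q (x - c0))))"
    using lip cQ by (auto intro!: continuous_on_compose2[OF lipschitz_on_continuous_on[of _ UNIV \<phi>]] continuous_on_fst)
  show "continuous_on UNIV (chart_height c0 Q \<phi>)"
    unfolding chart_height_def[abs_def] by (intro continuous_on_diff continuous_on_snd cQ c\<phi>)
  show "chart_height c0 Q \<phi> (x + k) = chart_height c0 Q \<phi> x + snd (Q k)
        - (\<phi> (fst (Q (x - c0)) + fst (Q k)) - \<phi> (fst (Q (x - c0))))" for k
  proof -
    have "Q (x + k - c0) = Q (x - c0) + Q k" using linear_add[OF lin, of "x - c0" k] by (simp add: algebra_simps)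
    then show ?thesis by (simp add: chart_height_def)
  qed
  show "chart_height c0 Q \<phi> x = 0" if "x \<in> frontier \<Omega>" "x \<in> cylinder c0 Q r h"
  proof -
    have "x \<in> {x. norm (fst (Q (x - c0))) < r \<and> snd (Q (x - c0)) = \<phi> (fst (Q (x - c0)))}"
      using ch that unfolding lipschitz_chart_def by blast
    then show ?thesis by (simp add: chart_height_def)
  qed
  have "cylinder c0 Q r h = {x. norm (fst (Q (x - c0))) < r} \<inter> {x. - h < snd (Q (x - c0))} \<inter> {x. snd (Q (x - c0)) < h}"
    by (auto simp: cylinder_def)
  then show oc: "open (cylinder c0 Q r h)"
    by (auto intro!: open_Int open_Collect_less continuous_on_norm continuous_on_fst continuous_on_snd cQ continuous_on_const)
  show "c0 \<in> cylinder c0 Q r h" using rh linear_0[OF lin] by (simp add: cylinder_def)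
  show "\<exists>\<rho>>0. \<forall>y\<in>ball x \<rho>. y \<in> \<Omega> \<longleftrightarrow> chart_height c0 Q \<phi> y > 0" if x: "x \<in> cylinder c0 Q r h"
  proof -
    obtain \<rho> where \<rho>: "\<rho> > 0" "ball x \<rho> \<subseteq> cylinder c0 Q r h" using oc x openE by blast
    have "y \<in> \<Omega> \<longleftrightarrow> chart_height c0 Q \<phi> y > 0" if "y \<in> cylinder c0 Q r h" for y
    proof -
      have "y \<in> \<Omega> \<longleftrightarrow> y \<in> \<Omega> \<inter> cylinder c0 Q r h" using that by simp
      also have "\<dots> \<longleftrightarrow> norm (fst (Q (y - c0))) < r \<and> \<phi> (fst (Q (y - c0))) < snd (Q (y - c0)) \<and> snd (Q (y - c0)) < h"
        using ch unfolding lipschitz_chart_def by blast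
      also have "\<dots> \<longleftrightarrow> chart_height c0 Q \<phi> y > 0"
        using that by (auto simp: cylinder_def chart_height_def)
      finally show ?thesis .
    qed
    then show ?thesis using \<rho> by blast
  qed
qed

lemma chart_height_vertical:
  assumes ch: "lipschitz_chart \<Omega> c0 Q r h \<phi>" and e: "Q e = (0, 1)"
  shows "chart_height c0 Q \<phi> (x + t *\<^sub>R e) = chart_height c0 Q \<phi> x + t"
proof -
  have "linear Q" using ch orthogonal_transformation_linear by (auto simp: lipschitz_chart_def)
  then have "Q (t *\<^sub>R e) = (0, t)" using e by (simp add: linear_cmul)
  then show ?thesis by (simp add: chart_height_facts(2)[OF ch])
qed

lemma closed_sectorD:
  assumes "z \<in> closed_sector \<nu> ((1 - C) / 2) \<delta>"
  shows "norm z \<le> \<delta>" "C * norm z \<le> z \<bullet> \<nu>"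
proof -
  have z: "z \<noteq> 0" "norm z \<le> \<delta>" "polar \<nu> z \<le> (1 - C) / 2" using assms unfolding closed_sector_def by blast+
  have "1 - 2 * ((1 - C) / 2) = C" by (simp add: field_simps)
  then show "norm z \<le> \<delta>" "C * norm z \<le> z \<bullet> \<nu>" using z polar_le_iff[OF z(1), of \<nu> "(1 - C) / 2"] by metis+
qed

text \<open>For C > 0, the cosine of the half-angle, the condition on \<kappa> says that \<kappa>
  times the tangent of the half-angle is at most 1. So a step z in the sector rises at least as much
  as the graph can. The apex lies half-way down, which leaves height at least T/2.\<close>

lemma lipschitz_chart_sector:
  assumes ch: "lipschitz_chart \<Omega> c0 Q r h \<phi>"
    and lip: "\<And>p q. \<bar>\<phi> p - \<phi> q\<bar> \<le> \<kappa> * norm (p - q)" and \<kappa>: "0 \<le> \<kappa>" "\<kappa>\<^sup>2 * (1 - C\<^sup>2) \<le> C\<^sup>2" "0 \<le> C" "C < 1"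
    and e: "Q e = (0, 1)" "\<And>z. z \<bullet> e = Q z \<bullet> (0, 1)"
    and T: "chart_height c0 Q \<phi> x > 0" and z: "z \<in> closed_sector e ((1 - C) / 2) \<delta>"
  shows "chart_height c0 Q \<phi> (x - ((1/2) * chart_height c0 Q \<phi> x) *\<^sub>R e + z) > 0"
proof -
  let ?T = "chart_height c0 Q \<phi>"
  have "linear Q" and Q: "orthogonal_transformation Q"
    using ch orthogonal_transformation_linear by (auto simp: lipschitz_chart_def)
  have z0: "C * norm z \<le> z \<bullet> e" using closed_sectorD[OF z] by simp
  have ze: "z \<bullet> e = snd (Q z)" using e(2)[of z] by (simp add: inner_prod_def)
  have nz: "(norm z)\<^sup>2 = (norm (fst (Q z)))\<^sup>2 + (snd (Q z))\<^sup>2"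
    using orthogonal_transformation_norm[OF Q, of z] norm_Pair[of "fst (Q z)" "snd (Q z)"]
    by (simp add: real_sqrt_pow2)
  define a b where "a = norm (fst (Q z))" and "b = snd (Q z)"
  have b0: "0 \<le> b" using z0 ze \<kappa>(3) by (metis b_def mult_nonneg_nonneg norm_ge_zero order_trans)
  have "(C * norm z)\<^sup>2 \<le> b\<^sup>2" using z0 ze \<kappa>(3) by (intro power_mono) (auto simp: b_def)
  then have "C\<^sup>2 * a\<^sup>2 \<le> (1 - C\<^sup>2) * b\<^sup>2"
    using nz by (simp add: power_mult_distrib a_def b_def algebra_simps)
  moreover have "(\<kappa>\<^sup>2 * (1 - C\<^sup>2)) * a\<^sup>2 \<le> C\<^sup>2 * a\<^sup>2" using \<kappa>(2) by (intro mult_right_mono) auto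
  ultimately have "(1 - C\<^sup>2) * (\<kappa> * a)\<^sup>2 \<le> (1 - C\<^sup>2) * b\<^sup>2" by (simp add: power_mult_distrib mult_ac)
  moreover have "1 - C\<^sup>2 > 0" using \<kappa>(3,4) by (simp add: power_less_one_iff abs_square_less_1)
  ultimately have "(\<kappa> * a)\<^sup>2 \<le> b\<^sup>2" by simp
  then have kab: "\<kappa> * a \<le> b" using b0 by (rule power2_le_imp_le)
  have "?T (x + z) \<ge> ?T x"
    using chart_height_facts(2)[OF ch, of x z] lip[of "fst (Q (x - c0)) + fst (Q z)" "fst (Q (x - c0))"] kab
    by (simp add: a_def b_def)
  moreover have "?T (x - ((1/2) * ?T x) *\<^sub>R e + z) = ?T (x + z) - (1/2) * ?T x"
    using chart_height_vertical[OF ch e(1), of "x + z" "- ((1/2) * ?T x)"] by (simp add: algebra_simps)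
  ultimately show ?thesis using T by simp
qed

text \<open>The mean value inequality for \<phi> minus its linear part. Uniformity over pairs of
  points near p0 is the point, because sectors start at all points near the boundary point.\<close>

lemma C1_linear_approx:
  fixes \<phi> :: "'a::euclidean_space \<Rightarrow> real"
  assumes "Ck_on 1 \<phi> UNIV" "\<epsilon> > 0"
  obtains d where "d > 0" "\<And>p q. p \<in> ball p0 d \<Longrightarrow> q \<in> ball p0 d \<Longrightarrow>
    \<bar>\<phi> p - \<phi> q - grad \<phi> p0 \<bullet> (p - q)\<bar> \<le> \<epsilon> * norm (p - q)"
proof -
  have C: "Ck_on (Suc 0) \<phi> UNIV" using assms(1) by simp
  then have df: "\<phi> differentiable (at p)" for p by simp
  have "continuous_on UNIV (grad \<phi>)"
    unfolding grad_def using C by (auto intro!: continuous_intros)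
  then have "isCont (grad \<phi>) p0" by (simp add: continuous_on_eq_continuous_at)
  then obtain d where d: "d > 0" "\<And>p. dist p p0 < d \<Longrightarrow> dist (grad \<phi> p) (grad \<phi> p0) < \<epsilon>"
    unfolding continuous_at_eps_delta using assms(2) by blast
  have "\<bar>\<phi> p - \<phi> q - grad \<phi> p0 \<bullet> (p - q)\<bar> \<le> \<epsilon> * norm (p - q)" if pq: "p \<in> ball p0 d" "q \<in> ball p0 d" for p q
  proof -
    define \<psi> where "\<psi> = (\<lambda>p. \<phi> p - grad \<phi> p0 \<bullet> p)"
    have "norm (\<psi> p - \<psi> q) \<le> \<epsilon> * norm (p - q)"
    proof (rule differentiable_bound[OF convex_ball])
      fix y assume y: "y \<in> ball p0 d"
      have d\<phi>: "(\<phi> has_derivative (\<lambda>v. grad \<phi> y \<bullet> v)) (at y)"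
      proof -
        have "frechet_derivative \<phi> (at y) = (\<lambda>v. grad \<phi> y \<bullet> v)"
          by (rule ext) (rule pd_eq_grad_inner[OF df])
        then show ?thesis using df[of y] unfolding frechet_derivative_works by (simp only:)
      qed
      show "(\<psi> has_derivative (\<lambda>v. grad \<phi> y \<bullet> v - grad \<phi> p0 \<bullet> v)) (at y within ball p0 d)"
        unfolding \<psi>_def
        by (rule has_derivative_at_withinI[OF has_derivative_diff[OF d\<phi>
              bounded_linear_imp_has_derivative[OF bounded_linear_inner_right]]])
      have g: "norm (grad \<phi> y - grad \<phi> p0) \<le> \<epsilon>" using d(2)[of y] y by (simp add: dist_norm norm_minus_commute less_imp_le)
      show "onorm (\<lambda>v. grad \<phi> y \<bullet> v - grad \<phi> p0 \<bullet> v) \<le> \<epsilon>"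
      proof (rule onorm_le)
        fix v
        have "\<bar>(grad \<phi> y - grad \<phi> p0) \<bullet> v\<bar> \<le> norm (grad \<phi> y - grad \<phi> p0) * norm v" by (rule Cauchy_Schwarz_ineq2)
        also have "\<dots> \<le> \<epsilon> * norm v" using g by (intro mult_right_mono) auto
        finally show "norm (grad \<phi> y \<bullet> v - grad \<phi> p0 \<bullet> v) \<le> \<epsilon> * norm v" by (simp add: inner_diff_left)
      qed
    qed (use pq in auto)
    then show ?thesis by (simp add: \<psi>_def inner_diff_right algebra_simps)
  qed
  then show ?thesis using that d(1) by blast
qed

text \<open>The axis is the inner normal of the tangent plane at c0, the direction of (-grad \<phi>
  0, 1) in the coordinates of the chart. To first order the height changes by N (z . \<nu>), hence
  by at least N C |z| along the sector, which beats the error of linearisation for any C >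
  0.\<close>

lemma C1_chart_sector:
  assumes ch: "lipschitz_chart \<Omega> c0 Q r h \<phi>" and C1: "Ck_on 1 \<phi> UNIV" and C: "0 < C"
  obtains \<nu> \<eta> \<delta> where "norm \<nu> = 1" "\<eta> > 0" "\<delta> > 0"
    "\<And>x z. x \<in> ball c0 \<delta> \<Longrightarrow> 0 < chart_height c0 Q \<phi> x \<Longrightarrow> \<eta> * chart_height c0 Q \<phi> x \<le> \<delta> \<Longrightarrow>
      z \<in> closed_sector \<nu> ((1 - C) / 2) \<delta> \<Longrightarrow>
      chart_height c0 Q \<phi> (x - (\<eta> * chart_height c0 Q \<phi> x) *\<^sub>R \<nu> + z) > 0"
proof -
  let ?T = "chart_height c0 Q \<phi>"
  have lin: "linear Q" and Q: "orthogonal_transformation Q"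
    using ch orthogonal_transformation_linear by (auto simp: lipschitz_chart_def)
  define a where "a = grad \<phi> 0"
  define N where "N = norm (- a, 1::real)"
  have N: "N > 0" by (simp add: N_def zero_prod_def)
  obtain v where v: "Q v = (- a, 1)" "norm v = N" "\<And>z. z \<bullet> v = Q z \<bullet> (- a, 1)"
    using orthogonal_preimage[OF Q, of "(- a, 1)"] N_def by metis
  define \<nu> where "\<nu> = v /\<^sub>R N"
  have \<nu>: "norm \<nu> = 1" using v(2) N by (simp add: \<nu>_def)
  have \<nu>_inner: "snd (Q z) - a \<bullet> fst (Q z) = N * (z \<bullet> \<nu>)" for z
  proof -
    have "N * (z \<bullet> \<nu>) = z \<bullet> v" using N by (simp add: \<nu>_def)
    also have "\<dots> = snd (Q z) - a \<bullet> fst (Q z)" unfolding v(3) by (simp add: inner_prod_def inner_commute)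
    finally show ?thesis by simp
  qed
  \<comment> \<open>With \<epsilon> \<le> N C the gain along z absorbs its error; with \<epsilon>
    \<le> N the error of the descent along the axis is at most T/4.\<close>
  define \<epsilon> where "\<epsilon> = N * min C 1 / 2"
  have \<epsilon>: "\<epsilon> > 0" "\<epsilon> \<le> N * C" "\<epsilon> \<le> N"
    using N C by (auto simp: \<epsilon>_def min_def)
  obtain d where d: "d > 0" "\<And>p q. p \<in> ball 0 d \<Longrightarrow> q \<in> ball 0 d \<Longrightarrow> \<bar>\<phi> p - \<phi> q - a \<bullet> (p - q)\<bar> \<le> \<epsilon> * norm (p - q)"
    using C1_linear_approx[OF C1 \<epsilon>(1), of 0] unfolding a_def by blast
  \<comment> \<open>Base point, descent and sector each contribute at most d/4, so all arguments of
    \<phi> stay in the ball of radius d. The value of \<eta> makes the descent cost T/4 to first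
    order, leaving at least T/2 together with its error.\<close>
  define \<delta> where "\<delta> = d / 4"
  define \<eta> where "\<eta> = 1 / (4 * N)"
  have \<delta>: "\<delta> > 0" and \<eta>: "\<eta> > 0" using d N by (auto simp: \<delta>_def \<eta>_def)
  have fQ: "norm (fst (Q y)) \<le> norm y" for y
    using norm_fst_le[of "fst (Q y)" "snd (Q y)"] orthogonal_transformation_norm[OF Q, of y] by simp
  have "?T (x - (\<eta> * ?T x) *\<^sub>R \<nu> + z) > 0"
    if x: "x \<in> ball c0 \<delta>" "0 < ?T x" "\<eta> * ?T x \<le> \<delta>" and z: "z \<in> closed_sector \<nu> ((1 - C) / 2) \<delta>" for x z
  proof -
    define k where "k = z - (\<eta> * ?T x) *\<^sub>R \<nu>"
    have z': "C * norm z \<le> z \<bullet> \<nu>" "norm z \<le> \<delta>" using closed_sectorD[OF z] by simp_all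
    have nk: "norm k \<le> norm z + \<eta> * ?T x"
      using norm_triangle_ineq4[of z "(\<eta> * ?T x) *\<^sub>R \<nu>"] \<nu> \<eta> x(2) by (simp add: k_def)
    define p where "p = fst (Q (x - c0))"
    have "norm p \<le> norm (x - c0)" unfolding p_def by (rule fQ)
    then have p: "norm p < \<delta>" using x(1) by (simp add: dist_norm norm_minus_commute)
    have "norm (p + fst (Q k)) < d"
      using norm_triangle_ineq[of p "fst (Q k)"] p fQ[of k] nk z'(2) x(3) d(1) by (simp add: \<delta>_def)
    then have "\<bar>\<phi> (p + fst (Q k)) - \<phi> p - a \<bullet> fst (Q k)\<bar> \<le> \<epsilon> * norm (fst (Q k))"
      using d(2)[of "p + fst (Q k)" p] p d(1) by (simp add: \<delta>_def)
    also have "\<dots> \<le> \<epsilon> * (norm z + \<eta> * ?T x)"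
      using fQ[of k] nk \<epsilon>(1) by (intro mult_left_mono) auto
    finally have 1: "\<bar>\<phi> (p + fst (Q k)) - \<phi> p - a \<bullet> fst (Q k)\<bar> \<le> \<epsilon> * (norm z + \<eta> * ?T x)" .
    have "N * (k \<bullet> \<nu>) = N * (z \<bullet> \<nu>) - N * (\<eta> * ?T x)"
      using \<nu> by (simp add: k_def inner_diff_left dot_square_norm algebra_simps)
    moreover have "N * (C * norm z) \<le> N * (z \<bullet> \<nu>)" using z'(1) N by (intro mult_left_mono) auto
    moreover have "\<epsilon> * norm z \<le> N * C * norm z" using \<epsilon>(2) by (intro mult_right_mono) auto
    moreover have "\<epsilon> * (\<eta> * ?T x) \<le> N * (\<eta> * ?T x)" using \<epsilon>(3) \<eta> x(2) by (intro mult_right_mono) auto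
    moreover have "N * (\<eta> * ?T x) = ?T x / 4" using N by (simp add: \<eta>_def)
    ultimately have 2: "N * (k \<bullet> \<nu>) - \<epsilon> * (norm z + \<eta> * ?T x) \<ge> - (?T x / 2)"
      by (simp add: algebra_simps)
    have "?T (x + k) = ?T x + snd (Q k) - (\<phi> (p + fst (Q k)) - \<phi> p)"
      unfolding p_def by (rule chart_height_facts(2)[OF ch])
    then have "?T (x + k) \<ge> ?T x / 2" using 1 2 \<nu>_inner[of k] by linarith
    then show ?thesis using x(2) by (simp add: k_def algebra_simps)
  qed
  then show ?thesis using that[OF \<nu> \<eta> \<delta>] by blast
qed

text \<open>The infimum of an empty set of reals carries no information, so an atlas is first
  extracted from the charts by compactness of the frontier. Nonnegativity of
  \<open>grad_Linf\<close> then bounds the set below.\<close>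

lemma lipschitz_constant_facts:
  fixes \<Omega> :: "('a::euclidean_space \<times> real) set"
  assumes "bounded_lipschitz_domain \<Omega>"
  shows "0 \<le> lipschitz_constant \<Omega>"
    "lipschitz_constant \<Omega> < K \<Longrightarrow> \<exists>N x0 Q r h \<phi>. lipschitz_atlas \<Omega> N x0 Q r h \<phi> \<and> (\<forall>k\<in>{1..N}. grad_Linf (\<phi> k) < K)"
proof -
  let ?X = "{Max ((\<lambda>k. grad_Linf (\<phi> k)) ` {1..N}) | N x0 Q r h \<phi>. lipschitz_atlas \<Omega> N x0 Q r h \<phi>}"
  have dom: "open \<Omega>" "\<Omega> \<noteq> {}" "bounded \<Omega>"
    and charts: "\<And>x0. x0 \<in> frontier \<Omega> \<Longrightarrow> \<exists>Q r h \<phi>. lipschitz_chart \<Omega> x0 Q r h \<phi>"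
    using assms by (auto simp: bounded_lipschitz_domain_def bounded_domain_def)
  obtain Q r h \<phi> where ch: "\<And>x. x \<in> frontier \<Omega> \<Longrightarrow> lipschitz_chart \<Omega> x (Q x) (r x) (h x) (\<phi> x)"
    using charts by metis
  have "compact (frontier \<Omega>)" using dom(3) by (simp add: compact_frontier_bounded)
  moreover have "open (cylinder x (Q x) (r x) (h x))" if "x \<in> frontier \<Omega>" for x
    using chart_height_facts(5)[OF ch[OF that]] .
  moreover have "frontier \<Omega> \<subseteq> (\<Union>x\<in>frontier \<Omega>. cylinder x (Q x) (r x) (h x))"
    using chart_height_facts(6)[OF ch] by blast
  ultimately obtain F where F: "F \<subseteq> frontier \<Omega>" "finite F" "frontier \<Omega> \<subseteq> (\<Union>x\<in>F. cylinder x (Q x) (r x) (h x))"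
    using compactE_image[of "frontier \<Omega>" "frontier \<Omega>" "\<lambda>x. cylinder x (Q x) (r x) (h x)"] by blast
  \<comment> \<open>An atlas must have at least one chart, so the frontier has to be
    nonempty.\<close>
  have "\<Omega> \<noteq> UNIV" using dom(3) not_bounded_UNIV by blast
  then have "frontier \<Omega> \<noteq> {}" using dom(2) by (simp add: frontier_eq_empty)
  then have "F \<noteq> {}" using F(3) by auto
  obtain g where g: "bij_betw g {1..card F} F" using ex_bij_betw_nat_finite_1[OF F(2)] by blast
  have gF: "g ` {1..card F} = F" using g by (simp add: bij_betw_def)
  have "card F \<ge> 1" using F(2) \<open>F \<noteq> {}\<close> by (simp add: Suc_leI card_gt_0_iff)
  moreover have "lipschitz_chart \<Omega> (g k) (Q (g k)) (r (g k)) (h (g k)) (\<phi> (g k))" if "k \<in> {1..card F}" for k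
    using gF F(1) that by (intro ch) blast
  moreover have "frontier \<Omega> \<subseteq> (\<Union>x\<in>g ` {1..card F}. cylinder x (Q x) (r x) (h x))"
    using F(3) by (simp only: gF)
  then have "frontier \<Omega> \<subseteq> (\<Union>k\<in>{1..card F}. cylinder (g k) (Q (g k)) (r (g k)) (h (g k)))"
    by simp
  ultimately have "lipschitz_atlas \<Omega> (card F) g (\<lambda>k. Q (g k)) (\<lambda>k. r (g k)) (\<lambda>k. h (g k)) (\<lambda>k. \<phi> (g k))"
    unfolding lipschitz_atlas_def by blast
  then have ne: "?X \<noteq> {}" by blast
  have nn: "0 \<le> y" if yX: "y \<in> ?X" for y
  proof -
    obtain N x0 Q r h \<phi> where a: "lipschitz_atlas \<Omega> N x0 Q r h \<phi>" "y = Max ((\<lambda>k. grad_Linf (\<phi> k)) ` {1..N})"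
      using yX by blast
    then have N: "1 \<in> {1..N}" and ch1: "lipschitz_chart \<Omega> (x0 1) (Q 1) (r 1) (h 1) (\<phi> 1)"
      by (auto simp: lipschitz_atlas_def)
    then have "\<exists>L. L-lipschitz_on UNIV (\<phi> 1)" by (simp add: lipschitz_chart_def)
    then have "0 \<le> grad_Linf (\<phi> 1)" by (rule grad_Linf_lipschitz(2))
    also have "\<dots> \<le> y" unfolding a(2) using N by (intro Max_ge) auto
    finally show ?thesis .
  qed
  show "0 \<le> lipschitz_constant \<Omega>"
    unfolding lipschitz_constant_def using ne nn by (rule cInf_greatest)
  assume lt: "lipschitz_constant \<Omega> < K"
  obtain y where y: "y \<in> ?X" "y < K"
    using cInf_lessD[OF ne lt[unfolded lipschitz_constant_def]] by (elim bexE)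
  from y(1) obtain N x0 Q r h \<phi> where
    "lipschitz_atlas \<Omega> N x0 Q r h \<phi>" "y = Max ((\<lambda>k. grad_Linf (\<phi> k)) ` {1..N})" by blast
  then have a: "lipschitz_atlas \<Omega> N x0 Q r h \<phi>" "Max ((\<lambda>k. grad_Linf (\<phi> k)) ` {1..N}) < K"
    using y(2) by simp_all
  then have "\<forall>k\<in>{1..N}. grad_Linf (\<phi> k) < K"
    by (subst (asm) Max_less_iff) (auto simp: lipschitz_atlas_def)
  then show "\<exists>N x0 Q r h \<phi>. lipschitz_atlas \<Omega> N x0 Q r h \<phi> \<and> (\<forall>k\<in>{1..N}. grad_Linf (\<phi> k) < K)"
    using a(1) by blast
qed

section \<open>The critical exponent\<close>

text \<open>The formula for the cosine of an arctangent; it also yields 0 at \<kappa> = 0, so the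
  two cases of \<open>critical_angle\<close> need no further distinction.\<close>

lemma cos_critical_angle:
  assumes "0 \<le> lipschitz_constant \<Omega>"
  shows "cos (critical_angle \<Omega>) = lipschitz_constant \<Omega> / sqrt (1 + (lipschitz_constant \<Omega>)\<^sup>2)"
proof (cases "lipschitz_constant \<Omega> = 0")
  case False
  define \<kappa> where "\<kappa> = lipschitz_constant \<Omega>"
  have \<kappa>: "\<kappa> > 0" using assms False by (simp add: \<kappa>_def)
  have "1 + (1 / \<kappa>)\<^sup>2 = (1 + \<kappa>\<^sup>2) / \<kappa>\<^sup>2" using \<kappa> by (simp add: field_simps)
  then have "sqrt (1 + (1 / \<kappa>)\<^sup>2) = sqrt (1 + \<kappa>\<^sup>2) / \<kappa>" using \<kappa> by (simp add: real_sqrt_divide)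
  then show ?thesis using False by (simp add: critical_angle_def cos_arctan \<kappa>_def[symmetric])
qed (simp add: critical_angle_def)

text \<open>The critical exponent is the positive root of a (a + n - 2) = l, where l is the first
  eigenvalue of the cap. A larger exponent gives a larger eigenvalue parameter, and Sturm comparison
  moves the first zero strictly inside the cap.\<close>

lemma critical_exponent_zero:
  fixes \<Omega> :: "('a::euclidean_space \<times> real) set"
  assumes \<kappa>: "0 \<le> lipschitz_constant \<Omega>" and \<alpha>: "critical_exponent \<Omega> < \<alpha>"
  defines "n \<equiv> real DIM('a \<times> real)"
  obtains s where "0 < s" "(1 - 2 * s) > cos (critical_angle \<Omega>)" "0 < critical_exponent \<Omega>"
    "zonal (half_dim TYPE('a \<times> real)) (\<alpha> * (\<alpha> + n - 2)) s = 0"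
    "\<And>t. 0 \<le> t \<Longrightarrow> t < s \<Longrightarrow> zonal (half_dim TYPE('a \<times> real)) (\<alpha> * (\<alpha> + n - 2)) t > 0"
proof -
  let ?c = "half_dim TYPE('a \<times> real)"
  define \<gamma> where "\<gamma> = cos (critical_angle \<Omega>)"
  define r where "r = (1 - \<gamma>) / 2"
  have n: "DIM('a \<times> real) \<ge> 2" using DIM_positive[where 'a = 'a] by simp
  then have n2: "n \<ge> 2" by (simp add: n_def)
  have c: "?c > 0" using n by (simp add: half_dim_def)
  have \<gamma>: "0 \<le> \<gamma>" "\<gamma> < 1"
  proof -
    show "0 \<le> \<gamma>" unfolding \<gamma>_def cos_critical_angle[OF \<kappa>] using \<kappa> by simp
    have "lipschitz_constant \<Omega> < sqrt (1 + (lipschitz_constant \<Omega>)\<^sup>2)" by (rule real_less_rsqrt) simp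
    then show "\<gamma> < 1" unfolding \<gamma>_def cos_critical_angle[OF \<kappa>]
      by (simp add: divide_less_eq add_pos_nonneg)
  qed
  have r: "0 < r" "r \<le> 1/2" "r < 1" using \<gamma> by (auto simp: r_def)
  obtain l where l: "l > 0" "zonal ?c l r = 0" "\<And>s. 0 \<le> s \<Longrightarrow> s < r \<Longrightarrow> zonal ?c l s > 0"
    "\<And>L s. L < l \<Longrightarrow> 0 \<le> s \<Longrightarrow> s \<le> r \<Longrightarrow> zonal ?c L s > 0"
    using first_zonal_eigenvalue[OF c r(1,2)] by blast
  have "first_dirichlet_eigenvalue {\<omega> \<in> sphere 0 1. \<omega> \<bullet> (0::'a, 1::real) > 1 - 2 * r} = l"
    by (rule first_dirichlet_eigenvalue_cap[OF n _ r(1,3) l(2,4)]) (auto simp: norm_Pair)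
  moreover have "{\<omega> \<in> sphere 0 1. \<omega> \<bullet> (0::'a, 1::real) > 1 - 2 * r} = spherical_cap (critical_angle \<Omega>)"
  proof -
    have "1 - 2 * r = cos (critical_angle \<Omega>)" by (simp add: r_def \<gamma>_def field_simps)
    then show ?thesis by (simp only: spherical_cap_def)
  qed
  ultimately have ev: "first_dirichlet_eigenvalue (spherical_cap (critical_angle \<Omega>) :: ('a \<times> real) set) = l" by simp
  define a where "a = critical_exponent \<Omega>"
  have a: "a = - ((n - 2) / 2) + sqrt ((n - 2)\<^sup>2 / 4 + l)"
    by (simp add: a_def critical_exponent_def cap_exponent_def ev n_def)
  \<comment> \<open>Undoing the quadratic formula in the definition of the exponent.\<close>
  have "(a + (n - 2) / 2)\<^sup>2 = (n - 2)\<^sup>2 / 4 + l" using l(1) by (simp add: a)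
  then have al: "a * (a + n - 2) = l" by (simp add: power2_eq_square field_simps)
  have a0: "a > 0"
  proof -
    have "(n - 2) / 2 < sqrt ((n - 2)\<^sup>2 / 4 + l)" using l(1) by (intro real_less_rsqrt) (simp add: power_divide)
    then show ?thesis by (simp add: a)
  qed
  have "l < \<alpha> * (\<alpha> + n - 2)"
    unfolding al[symmetric] using \<alpha> a0 n2 by (intro mult_strict_mono) (auto simp: a_def)
  then obtain s where s: "0 < s" "s < r" "zonal ?c (\<alpha> * (\<alpha> + n - 2)) s = 0"
    "\<And>t. 0 \<le> t \<Longrightarrow> t < s \<Longrightarrow> zonal ?c (\<alpha> * (\<alpha> + n - 2)) t > 0"
    using zonal_zero_before[OF c l(1) _ r(1,3) l(3,2)] by blast
  show ?thesis using that[OF s(1) _ _ s(3,4)] s(2) a0 by (simp add: r_def \<gamma>_def a_def)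
qed

text \<open>Sturm comparison with the linear solution 1 - 2 s, whose zero is at 1/2: its parameter 2
  c = n - 1 belongs to degree 1.\<close>

lemma half_space_zero:
  fixes T :: "'a::euclidean_space itself"
  assumes n: "DIM('a) \<ge> 2" and \<alpha>: "1 < \<alpha>"
  obtains s where "0 < s" "s < 1/2" "zonal (half_dim TYPE('a)) (\<alpha> * (\<alpha> + real DIM('a) - 2)) s = 0"
    "\<And>t. 0 \<le> t \<Longrightarrow> t < s \<Longrightarrow> zonal (half_dim TYPE('a)) (\<alpha> * (\<alpha> + real DIM('a) - 2)) t > 0"
proof -
  let ?c = "half_dim TYPE('a)"
  have c: "?c > 0" using n by (simp add: half_dim_def)
  have "2 * ?c = 1 * (1 + real DIM('a) - 2)" by (simp add: half_dim_def)
  also have "\<dots> < \<alpha> * (\<alpha> + real DIM('a) - 2)"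
    using \<alpha> n by (intro mult_strict_mono) auto
  finally show ?thesis
    using zonal_zero_before[of ?c "2 * ?c" "\<alpha> * (\<alpha> + real DIM('a) - 2)" "1/2"] that c
    by (auto simp: zonal_linear)
qed

theorem corollary3p8:
  fixes \<Omega> :: "('a::euclidean_space \<times> real) set" and u :: "'a \<times> real \<Rightarrow> real"
  assumes "bounded_lipschitz_domain \<Omega>"
    and "W12_0 \<Omega> u" and "weak_laplacian_minus_one \<Omega> u"
  shows "(\<forall>\<beta>. 0 < \<beta> \<and> \<beta> < 1 / critical_exponent \<Omega> \<longrightarrow>
            (\<integral>\<^sup>+x. neg_power \<beta> (u x) \<partial>lebesgue_on \<Omega>) < \<infinity>) \<and>
         (bounded_C1_domain \<Omega> \<longrightarrow>
            (\<forall>\<beta>. 0 < \<beta> \<and> \<beta> < 1 \<longrightarrow> (\<integral>\<^sup>+x. neg_power \<beta> (u x) \<partial>lebesgue_on \<Omega>) < \<infinity>))"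
proof -
  have \<Omega>: "open \<Omega>" "bounded \<Omega>"
    using assms(1) by (auto simp: bounded_lipschitz_domain_def bounded_domain_def)
  note u = assms(2,3)
  have n: "DIM('a \<times> real) \<ge> 2" using DIM_positive[where 'a = 'a] by simp
  define fin where "fin = (\<lambda>\<beta> x. \<exists>U. open U \<and> x \<in> U \<and>
    (\<integral>\<^sup>+y. indicator U y * neg_power \<beta> (u y) \<partial>lebesgue_on \<Omega>) < \<infinity>)"
  have finite: "(\<integral>\<^sup>+x. neg_power \<beta> (u x) \<partial>lebesgue_on \<Omega>) < \<infinity>"
    if \<beta>: "0 < \<beta>" and bd: "\<And>x. x \<in> frontier \<Omega> \<Longrightarrow> fin \<beta> x" for \<beta>
  proof (rule integral_finite_if_local[OF \<Omega> u])
    fix x assume "x \<in> closure \<Omega>"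
    then consider "x \<in> \<Omega>" | "x \<in> frontier \<Omega>" using \<Omega>(1) by (auto simp: frontier_def interior_open)
    then show "\<exists>U. open U \<and> x \<in> U \<and> (\<integral>\<^sup>+y. indicator U y * neg_power \<beta> (u y) \<partial>lebesgue_on \<Omega>) < \<infinity>"
    proof cases
      case 1
      then show ?thesis using local_interior[OF \<Omega> u _ less_imp_le[OF \<beta>]] by metis
    qed (use bd in \<open>simp add: fin_def\<close>)
  qed
  have "(\<integral>\<^sup>+x. neg_power \<beta> (u x) \<partial>lebesgue_on \<Omega>) < \<infinity>" if \<beta>: "0 < \<beta>" "\<beta> < 1 / critical_exponent \<Omega>" for \<beta>
  proof (rule finite[OF \<beta>(1)])
    fix x assume x: "x \<in> frontier \<Omega>"
    have K0: "0 \<le> lipschitz_constant \<Omega>" by (rule lipschitz_constant_facts(1)[OF assms(1)])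
    \<comment> \<open>Positivity is part of \<open>critical_exponent_zero\<close>; any exponent
      above the critical one gives access to it.\<close>
    have a0: "0 < critical_exponent \<Omega>"
      using critical_exponent_zero[OF K0, of "critical_exponent \<Omega> + 1"] by auto
    then have "critical_exponent \<Omega> < 1 / \<beta>" using \<beta> by (simp add: field_simps)
    then obtain \<alpha> where \<alpha>: "critical_exponent \<Omega> < \<alpha>" "\<alpha> < 1 / \<beta>" using dense by blast
    have \<alpha>0: "\<alpha> > 0" "\<alpha> * \<beta> < 1" using a0 \<alpha> \<beta> by (auto simp: field_simps)
    obtain s where s: "0 < s" "cos (critical_angle \<Omega>) < 1 - 2 * s"
      "zonal (half_dim TYPE('a \<times> real)) (\<alpha> * (\<alpha> + real DIM('a \<times> real) - 2)) s = 0"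
      "\<And>t. 0 \<le> t \<Longrightarrow> t < s \<Longrightarrow> zonal (half_dim TYPE('a \<times> real)) (\<alpha> * (\<alpha> + real DIM('a \<times> real) - 2)) t > 0"
      using critical_exponent_zero[OF K0 \<alpha>(1)] by metis
    define C where "C = 1 - 2 * s"
    define K where "K = lipschitz_constant \<Omega>"
    have cK: "K / sqrt (1 + K\<^sup>2) < C" using s(2) cos_critical_angle[OF K0] by (simp add: C_def K_def)
    have K: "0 \<le> K" using K0 by (simp add: K_def)
    then have C: "0 < C" using cK by (auto intro: le_less_trans[of 0 "K / sqrt (1 + K\<^sup>2)"])
    have C1: "C < 1" using s(1) by (simp add: C_def)
    have C2: "1 - C\<^sup>2 > 0" using C C1 by (simp add: abs_square_less_1)
    define K' where "K' = C / sqrt (1 - C\<^sup>2)"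
    have K': "K'\<^sup>2 * (1 - C\<^sup>2) = C\<^sup>2" "0 \<le> K'" using C C2 by (auto simp: K'_def power_divide)
    have "K < K'"
    proof (rule ccontr)
      assume "\<not> K < K'"
      then have "K'\<^sup>2 \<le> K\<^sup>2" using K'(2) by (intro power_mono) auto
      then have "K'\<^sup>2 * (1 - C\<^sup>2) \<le> K\<^sup>2 * (1 - C\<^sup>2)" using C2 by (intro mult_right_mono) auto
      then have "C\<^sup>2 \<le> K\<^sup>2 * (1 - C\<^sup>2)" by (simp only: K'(1))
      then have "C\<^sup>2 * (1 + K\<^sup>2) \<le> K\<^sup>2" by (simp add: algebra_simps)
      moreover have "(K / sqrt (1 + K\<^sup>2))\<^sup>2 < C\<^sup>2" using cK K by (intro power_strict_mono) auto
      then have "K\<^sup>2 / (1 + K\<^sup>2) < C\<^sup>2" by (simp add: power_divide)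
      then have "K\<^sup>2 < C\<^sup>2 * (1 + K\<^sup>2)" by (simp add: divide_less_eq add_pos_nonneg)
      ultimately show False by simp
    qed
    then obtain N x0 Q r h \<phi> where at: "lipschitz_atlas \<Omega> N x0 Q r h \<phi>" "\<And>k. k \<in> {1..N} \<Longrightarrow> grad_Linf (\<phi> k) < K'"
      using lipschitz_constant_facts(2)[OF assms(1), of K'] unfolding K_def by blast
    then obtain k where k: "k \<in> {1..N}" "x \<in> cylinder (x0 k) (Q k) (r k) (h k)"
      using x unfolding lipschitz_atlas_def by blast
    have ch: "lipschitz_chart \<Omega> (x0 k) (Q k) (r k) (h k) (\<phi> k)"
      using at(1) k(1) by (simp add: lipschitz_atlas_def)
    have oQ: "orthogonal_transformation (Q k)" and lp: "\<exists>L. L-lipschitz_on UNIV (\<phi> k)"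
      using ch by (auto simp: lipschitz_chart_def)
    have lip: "\<bar>\<phi> k p - \<phi> k q\<bar> \<le> K' * norm (p - q)" for p q
      using grad_Linf_lipschitz(1)[OF lp, of p q] at(2)[OF k(1)] mult_right_mono[of "grad_Linf (\<phi> k)" K' "norm (p - q)"]
      by simp
    obtain e where e: "Q k e = (0, 1)" "norm e = norm (0::'a, 1::real)" "\<And>z. z \<bullet> e = Q k z \<bullet> (0, 1)"
      using orthogonal_preimage[OF oQ, of "(0, 1)"] by metis
    have ne: "norm e = 1" using e(2) by (simp add: norm_Pair)
    define T where "T = chart_height (x0 k) (Q k) (\<phi> k)"
    obtain \<rho> where \<rho>: "\<rho> > 0" "\<And>y. y \<in> ball x \<rho> \<Longrightarrow> y \<in> \<Omega> \<longleftrightarrow> T y > 0"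
      using chart_height_facts(4)[OF ch k(2)] unfolding T_def by blast
    have sec: "T (y - ((1/2) * T y) *\<^sub>R e + z) > 0"
      if "y \<in> ball x 1" "T y > 0" "(1/2) * T y \<le> 1" "z \<in> closed_sector e s 1" for y z
      using lipschitz_chart_sector[OF ch lip K'(2) eq_refl[OF K'(1)] less_imp_le[OF C] C1 e(1,3), of y z 1] that
      by (simp add: T_def C_def)
    have s1: "s < 1" using C by (simp add: C_def)
    have Tc: "continuous_on UNIV T" and Te: "\<And>y t. T (y + t *\<^sub>R e) = T y + t" and T0: "T x = 0"
      unfolding T_def using chart_height_facts(1)[OF ch] chart_height_vertical[OF ch e(1)]
        chart_height_facts(3)[OF ch x k(2)] by blast+
    \<comment> \<open>The values of \<eta> and \<delta>. The sector estimate for a Lipschitz graph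
      holds at every scale, so \<delta> = 1 is an arbitrary choice.\<close>
    have "0 < (1/2 :: real)" "0 < (1 :: real)" by simp_all
    from local_boundary[OF \<Omega> u n ne \<alpha>0(1) s(1) s1 s(3,4) \<beta>(1) \<alpha>0(2) Tc Te T0 \<rho> this sec]
    show "fin \<beta> x" unfolding fin_def by blast
  qed
  moreover have "(\<integral>\<^sup>+x. neg_power \<beta> (u x) \<partial>lebesgue_on \<Omega>) < \<infinity>"
    if C1: "bounded_C1_domain \<Omega>" and \<beta>: "0 < \<beta>" "\<beta> < 1" for \<beta>
  proof (rule finite[OF \<beta>(1)])
    fix x assume x: "x \<in> frontier \<Omega>"
    \<comment> \<open>A chart centred at x itself, so that the normal of its graph is taken at the
      right point.\<close>
    obtain Q r h \<phi> where ch: "lipschitz_chart \<Omega> x Q r h \<phi>" and \<phi>: "Ck_on 1 \<phi> UNIV"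
      using C1 x unfolding bounded_C1_domain_def by blast
    have "1 < 1 / \<beta>" using \<beta> by simp
    then obtain \<alpha> where \<alpha>: "1 < \<alpha>" "\<alpha> < 1 / \<beta>" using dense by blast
    have \<alpha>0: "\<alpha> > 0" "\<alpha> * \<beta> < 1" using \<alpha> \<beta> by (auto simp: field_simps)
    obtain s where s: "0 < s" "s < 1/2"
      "zonal (half_dim TYPE('a \<times> real)) (\<alpha> * (\<alpha> + real DIM('a \<times> real) - 2)) s = 0"
      "\<And>t. 0 \<le> t \<Longrightarrow> t < s \<Longrightarrow> zonal (half_dim TYPE('a \<times> real)) (\<alpha> * (\<alpha> + real DIM('a \<times> real) - 2)) t > 0"
      using half_space_zero[OF n \<alpha>(1)] by blast
    define T where "T = chart_height x Q \<phi>"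
    \<comment> \<open>Sectors are indexed by s = (1 - C) / 2; here C = 1 - 2 s > 0, since the zero s
      lies before the equator.\<close>
    have cs: "(1 - (1 - 2 * s)) / 2 = s" and "0 < 1 - 2 * s" using s(2) by (simp_all add: field_simps)
    from C1_chart_sector[OF ch \<phi> this(2), unfolded cs, folded T_def] obtain \<nu> \<eta> \<delta> where \<nu>: "norm \<nu> = 1" "\<eta> > 0" "\<delta> > 0"
      "\<And>y z. y \<in> ball x \<delta> \<Longrightarrow> 0 < T y \<Longrightarrow> \<eta> * T y \<le> \<delta> \<Longrightarrow> z \<in> closed_sector \<nu> s \<delta> \<Longrightarrow>
        T (y - (\<eta> * T y) *\<^sub>R \<nu> + z) > 0"
      by blast
    have oQ: "orthogonal_transformation Q" using ch by (auto simp: lipschitz_chart_def)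
    obtain e where e: "Q e = (0, 1)" using orthogonal_preimage[OF oQ, of "(0, 1)"] by metis
    have xc: "x \<in> cylinder x Q r h" by (rule chart_height_facts(6)[OF ch])
    obtain \<rho> where \<rho>: "\<rho> > 0" "\<And>y. y \<in> ball x \<rho> \<Longrightarrow> y \<in> \<Omega> \<longleftrightarrow> T y > 0"
      using chart_height_facts(4)[OF ch xc] unfolding T_def by blast
    have s1: "s < 1" using s(2) by simp
    have Tc: "continuous_on UNIV T" and Te: "\<And>y t. T (y + t *\<^sub>R e) = T y + t" and T0: "T x = 0"
      unfolding T_def using chart_height_facts(1)[OF ch] chart_height_vertical[OF ch e]
        chart_height_facts(3)[OF ch x xc] by blast+
    from local_boundary[OF \<Omega> u n \<nu>(1) \<alpha>0(1) s(1) s1 s(3,4) \<beta>(1) \<alpha>0(2) Tc Te T0 \<rho> \<nu>(2,3,4)]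
    show "fin \<beta> x" unfolding fin_def by blast
  qed
  ultimately show ?thesis by blast
qed

end
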